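(* Let $G$ be a finite group with identity $e$ and let $S\subseteq G\setminus\{e\}$ be a symmetric generating set of $G$. There exists a weight $w\in\mathcal{L}_S$ such that the weighted Laplacian $\Delta_w$ of the Cayley graph $\mathcal{C}(G,S)$ is real $G$-simple if and only if the following three conditions hold simultaneously: (i) $a_{W_1,W_2}\not\equiv 0$ on $\mathbb{R}^{S'}$ for all $W_1,W_2\in\operatorname{Irr}(G,\mathbb{C})$ such that $W_2$ is isomorphic neither to $W_1$ nor to $W_1^*$; (ii) $b_W\not\equiv 0$ on $\mathbb{R}^{S'}$ for all $W\in\operatorname{Irr}(G,\mathbb{C})$ of real type or of complex type; (iii) $c_W\not\equiv 0$ on $\mathbb{R}^{S'}$ for all $W\in\operatorname{Irr}(G,\mathbb{C})$ of quaternionic type. Moreover, if such a weight exists, then the set $\mathcal{W}_S$ of all $w\in\mathcal{L}_S$ for which $\Delta_w$ is real $G$-simple is a residual set in $\mathcal{L}_S$.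
   Context: $S$ symmetric means $s^{-1}\in S$ for all $s\in S$. The Cayley graph $\mathcal{C}(G,S)$ has vertex set $G$ and edges $\{x,xs\}$, $x\in G$, $s\in S$. Put $S'=\{\{s,s^{-1}\}: s\in S\}$; for $\alpha\in\mathbb{R}^{S'}$ and $s\in S$ write $\alpha_s:=\alpha_{\{s,s^{-1}\}}$ (so $\alpha_s=\alpha_{s^{-1}}$). The space of left-invariant weights is $\mathcal{L}_S=\{w\in\mathbb{R}^{S'}: w_{s'}>0 \text{ for all } s'\in S'\}$, with the topology induced from $\mathbb{R}^{S'}$; a subset is residual if its complement in $\mathcal{L}_S$ is meager. For $f:G\to\mathbb{C}$ (or $\mathbb{R}$), $\Delta_w f(x)=-\sum_{s\in S}w_s\big(f(xs)-f(x)\big)$. Let $\mathcal{A}_{\mathbb{R}}$ be the real vector space of functions $f:G\to\mathbb{R}$ with the left regular representation $(L(y)f)(x)=f(y^{-1}x)$. $\Delta_w$ is called real $G$-simple if every eigenspace of $\Delta_w:\mathcal{A}_{\mathbb{R}}\to\mathcal{A}_{\mathbb{R}}$ is an irreducible real subrepresentation of $(\mathcal{A}_{\mathbb{R}},L)$. $\operatorname{Irr}(G,\mathbb{C})$ is the set of isomorphism classes of irreducible complex representations $(W,\rho)$ of $G$; $W^*$ is the dual representation. $W$ is of real type (resp. quaternionic type) if it admits a conjugate-linear $G$-equivariant map $J:W\to W$ with $J^2=\mathrm{id}$ (resp. $J^2=-\mathrm{id}$); otherwise it is of complex type. For $(W,\rho)\in\operatorname{Irr}(G,\mathbb{C})$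 and $\alpha\in\mathbb{R}^{S'}$, let $D_W(\alpha)=-\sum_{s\in S}\alpha_s(\rho(s)-\rho(e)):W\to W$, and let $P_W(\alpha)\in\mathbb{C}[x]$ be its characteristic polynomial, with first and second derivatives (in $x$) $P_W'(\alpha)$ and $P_W''(\alpha)$. Let $\operatorname{res}$ denote the resultant of two complex polynomials, a polynomial expression in their coefficients with $\operatorname{res}(p,q)\neq 0$ if and only if $p$ and $q$ have no common zero. Define functions $\mathbb{R}^{S'}\to\mathbb{C}$ by $a_{W_1,W_2}(\alpha)=\operatorname{res}(P_{W_1}(\alpha),P_{W_2}(\alpha))$, $b_W(\alpha)=\operatorname{res}(P_W(\alpha),P_W'(\alpha))$, $c_W(\alpha)=\operatorname{res}(P_W(\alpha),P_W''(\alpha))$. *)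

theory Defs
  imports
    "HOL-Algebra.Generated_Groups"
    "HOL-Analysis.Function_Topology"
    "Jordan_Normal_Form.Char_Poly"
    "Jordan_Normal_Form.VS_Connect"
    "Subresultants.Resultant_Prelim"
begin

hide_const (open) Multiset.mult Polynomial.smult Modules.module

section \<open>Subrepresentations\<close>

text \<open>A representation is given by a vector space \<open>V\<close> (over the whole field type \<open>'k\<close>)
  and an action \<open>act\<close> of \<open>G\<close> on its carrier.\<close>

definition subrep ::
  "('g, 'b) monoid_scheme \<Rightarrow> ('k::field, 'v, 'c) module_scheme \<Rightarrow> ('g \<Rightarrow> 'v \<Rightarrow> 'v) \<Rightarrow> 'v set \<Rightarrow> bool"
  where "subrep G V act U \<longleftrightarrow>
    VectorSpace.subspace class_ring U V \<and> (\<forall>g\<in>carrier G. \<forall>u\<in>U. act g u \<in> U)"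

definition irreducible_subrep ::
  "('g, 'b) monoid_scheme \<Rightarrow> ('k::field, 'v, 'c) module_scheme \<Rightarrow> ('g \<Rightarrow> 'v \<Rightarrow> 'v) \<Rightarrow> 'v set \<Rightarrow> bool"
  where "irreducible_subrep G V act U \<longleftrightarrow>
    subrep G V act U \<and> U \<noteq> {\<zero>\<^bsub>V\<^esub>} \<and>
    (\<forall>U'. subrep G V act U' \<and> U' \<subseteq> U \<longrightarrow> U' = {\<zero>\<^bsub>V\<^esub>} \<or> U' = U)"

section \<open>Weights\<close>

definition inverse_pairs :: "('a, 'b) monoid_scheme \<Rightarrow> 'a set \<Rightarrow> 'a set set"
  where "inverse_pairs G S = (\<lambda>s. {s, inv\<^bsub>G\<^esub> s}) ` S"

definition coefficient_space :: "('a, 'b) monoid_scheme \<Rightarrow> 'a set \<Rightarrow> ('a set \<Rightarrow> real) set"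
  where "coefficient_space G S = (inverse_pairs G S \<rightarrow>\<^sub>E UNIV)"

definition left_invariant_weights :: "('a, 'b) monoid_scheme \<Rightarrow> 'a set \<Rightarrow> ('a set \<Rightarrow> real) set"
  where "left_invariant_weights G S =
    {w \<in> coefficient_space G S. \<forall>s'\<in>inverse_pairs G S. w s' > 0}"

definition weight_topology :: "('a, 'b) monoid_scheme \<Rightarrow> 'a set \<Rightarrow> ('a set \<Rightarrow> real) topology"
  where "weight_topology G S =
    subtopology (powertop_real (inverse_pairs G S)) (left_invariant_weights G S)"

definition nowhere_dense_in :: "'a topology \<Rightarrow> 'a set \<Rightarrow> bool"
  where "nowhere_dense_in X N \<longleftrightarrow> N \<subseteq> topspace X \<and> X interior_of (X closure_of N) = {}"

definition meager_in :: "'a topology \<Rightarrow> 'a set \<Rightarrow> bool"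
  where "meager_in X M \<longleftrightarrow>
    (\<exists>\<N>. countable \<N> \<and> (\<forall>N\<in>\<N>. nowhere_dense_in X N) \<and> M = \<Union>\<N>)"

definition residual_in :: "'a topology \<Rightarrow> 'a set \<Rightarrow> bool"
  where "residual_in X R \<longleftrightarrow> R \<subseteq> topspace X \<and> meager_in X (topspace X - R)"

section \<open>The weighted Laplacian on real functions\<close>

text \<open>Real functions on \<open>X\<close> are represented by functions that are \<open>undefined\<close> outside \<open>X\<close>.\<close>

definition real_functions :: "'a set \<Rightarrow> (real, 'a \<Rightarrow> real) module"
  where "real_functions X = \<lparr>
    carrier = X \<rightarrow>\<^sub>E UNIV,
    mult = undefined,
    one = undefined,
    zero = (\<lambda>x\<in>X. 0),
    add = (\<lambda>f g. \<lambda>x\<in>X. f x + g x),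
    smult = (\<lambda>c f. \<lambda>x\<in>X. c * f x)\<rparr>"

text \<open>Since \<^const>\<open>VectorSpace.subspace\<close> includes the vector space axioms for the ambient record,
  they are checked here.\<close>

lemma vectorspace_real_functions: "vectorspace class_ring (real_functions X)"
proof -
  have ag: "abelian_group (real_functions X)"
  proof (rule abelian_groupI)
    fix f assume f: "f \<in> carrier (real_functions X)"
    have "(\<lambda>x\<in>X. - f x) \<oplus>\<^bsub>real_functions X\<^esub> f = \<zero>\<^bsub>real_functions X\<^esub>"
      by (auto simp: real_functions_def fun_eq_iff)
    moreover have "(\<lambda>x\<in>X. - f x) \<in> carrier (real_functions X)"
      by (simp add: real_functions_def)
    ultimately show "\<exists>g\<in>carrier (real_functions X).
        g \<oplus>\<^bsub>real_functions X\<^esub> f = \<zero>\<^bsub>real_functions X\<^esub>" by blast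
  qed (auto simp: real_functions_def fun_eq_iff PiE_iff extensional_def)
  have "Module.module (class_ring :: real ring) (real_functions X)"
  proof (rule Module.moduleI)
    show "cring (class_ring :: real ring)"
      using class_field[where 'a=real] by (simp add: field_def domain_def)
    show "abelian_group (real_functions X)" by (rule ag)
  qed (auto simp: real_functions_def fun_eq_iff PiE_iff extensional_def algebra_simps)
  then show ?thesis
    using class_field[where 'a=real] by (simp add: vectorspace_def)
qed

definition left_regular :: "('a, 'b) monoid_scheme \<Rightarrow> 'a \<Rightarrow> ('a \<Rightarrow> real) \<Rightarrow> 'a \<Rightarrow> real"
  where "left_regular G y f = (\<lambda>x\<in>carrier G. f (inv\<^bsub>G\<^esub> y \<otimes>\<^bsub>G\<^esub> x))"

definition laplacian ::
  "('a, 'b) monoid_scheme \<Rightarrow> 'a set \<Rightarrow> ('a set \<Rightarrow> real) \<Rightarrow> ('a \<Rightarrow> real) \<Rightarrow> 'a \<Rightarrow> real"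
  where "laplacian G S w f =
    (\<lambda>x\<in>carrier G. - (\<Sum>s\<in>S. w {s, inv\<^bsub>G\<^esub> s} * (f (x \<otimes>\<^bsub>G\<^esub> s) - f x)))"

definition laplacian_eigenspace ::
  "('a, 'b) monoid_scheme \<Rightarrow> 'a set \<Rightarrow> ('a set \<Rightarrow> real) \<Rightarrow> real \<Rightarrow> ('a \<Rightarrow> real) set"
  where "laplacian_eigenspace G S w \<mu> =
    {f \<in> carrier (real_functions (carrier G)).
       laplacian G S w f = \<mu> \<odot>\<^bsub>real_functions (carrier G)\<^esub> f}"

definition real_G_simple :: "('a, 'b) monoid_scheme \<Rightarrow> 'a set \<Rightarrow> ('a set \<Rightarrow> real) \<Rightarrow> bool"
  where "real_G_simple G S w \<longleftrightarrow>
    (\<forall>\<mu>. laplacian_eigenspace G S w \<mu> \<noteq> {\<zero>\<^bsub>real_functions (carrier G)\<^esub>} \<longrightarrow>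
      irreducible_subrep G (real_functions (carrier G)) (left_regular G)
        (laplacian_eigenspace G S w \<mu>))"

section \<open>Complex representations\<close>

text \<open>Every finite-dimensional complex representation is isomorphic to a matrix representation
  on \<open>\<complex>\<^sup>n\<close>, and irreducible representations of finite groups are finite-dimensional. Isomorphism
  classes are therefore represented by (all) matrix representations \<open>\<rho>\<close> of degree \<open>n\<close>; the
  values of \<open>\<rho>\<close> outside \<open>carrier G\<close> are irrelevant.\<close>

definition matrix_rep :: "('a, 'b) monoid_scheme \<Rightarrow> nat \<Rightarrow> ('a \<Rightarrow> complex mat) \<Rightarrow> bool"
  where "matrix_rep G n \<rho> \<longleftrightarrow>
    (\<forall>g\<in>carrier G. \<rho> g \<in> carrier_mat n n) \<and>
    \<rho> \<one>\<^bsub>G\<^esub> = 1\<^sub>m n \<and>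
    (\<forall>g\<in>carrier G. \<forall>h\<in>carrier G. \<rho> (g \<otimes>\<^bsub>G\<^esub> h) = \<rho> g * \<rho> h)"

definition irreducible_rep :: "('a, 'b) monoid_scheme \<Rightarrow> nat \<Rightarrow> ('a \<Rightarrow> complex mat) \<Rightarrow> bool"
  where "irreducible_rep G n \<rho> \<longleftrightarrow>
    matrix_rep G n \<rho> \<and>
    irreducible_subrep G (module_vec TYPE(complex) n) (\<lambda>g v. \<rho> g *\<^sub>v v) (carrier_vec n)"

definition isomorphic_reps ::
  "('a, 'b) monoid_scheme \<Rightarrow> nat \<Rightarrow> ('a \<Rightarrow> complex mat) \<Rightarrow> nat \<Rightarrow> ('a \<Rightarrow> complex mat) \<Rightarrow> bool"
  where "isomorphic_reps G n \<rho> m \<sigma> \<longleftrightarrow>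
    (\<exists>T\<in>carrier_mat m n. invertible_mat T \<and> (\<forall>g\<in>carrier G. T * \<rho> g = \<sigma> g * T))"

definition dual_rep :: "('a, 'b) monoid_scheme \<Rightarrow> ('a \<Rightarrow> complex mat) \<Rightarrow> 'a \<Rightarrow> complex mat"
  where "dual_rep G \<rho> g = transpose_mat (\<rho> (inv\<^bsub>G\<^esub> g))"

definition conjugate_linear_equivariant ::
  "('a, 'b) monoid_scheme \<Rightarrow> nat \<Rightarrow> ('a \<Rightarrow> complex mat) \<Rightarrow> (complex vec \<Rightarrow> complex vec) \<Rightarrow> bool"
  where "conjugate_linear_equivariant G n \<rho> J \<longleftrightarrow>
    (\<forall>v\<in>carrier_vec n. J v \<in> carrier_vec n) \<and>
    (\<forall>u\<in>carrier_vec n. \<forall>v\<in>carrier_vec n. J (u + v) = J u + J v) \<and>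
    (\<forall>c. \<forall>v\<in>carrier_vec n. J (c \<cdot>\<^sub>v v) = cnj c \<cdot>\<^sub>v J v) \<and>
    (\<forall>g\<in>carrier G. \<forall>v\<in>carrier_vec n. J (\<rho> g *\<^sub>v v) = \<rho> g *\<^sub>v J v)"

definition real_type :: "('a, 'b) monoid_scheme \<Rightarrow> nat \<Rightarrow> ('a \<Rightarrow> complex mat) \<Rightarrow> bool"
  where "real_type G n \<rho> \<longleftrightarrow>
    (\<exists>J. conjugate_linear_equivariant G n \<rho> J \<and> (\<forall>v\<in>carrier_vec n. J (J v) = v))"

definition quaternionic_type :: "('a, 'b) monoid_scheme \<Rightarrow> nat \<Rightarrow> ('a \<Rightarrow> complex mat) \<Rightarrow> bool"
  where "quaternionic_type G n \<rho> \<longleftrightarrow>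
    (\<exists>J. conjugate_linear_equivariant G n \<rho> J \<and> (\<forall>v\<in>carrier_vec n. J (J v) = - v))"

definition complex_type :: "('a, 'b) monoid_scheme \<Rightarrow> nat \<Rightarrow> ('a \<Rightarrow> complex mat) \<Rightarrow> bool"
  where "complex_type G n \<rho> \<longleftrightarrow> \<not> real_type G n \<rho> \<and> \<not> quaternionic_type G n \<rho>"

section \<open>The operators \<open>D\<^sub>W\<close>, their characteristic polynomials, and resultants\<close>

text \<open>The sum \<open>- (\<Sum>s\<in>S. \<alpha>\<^sub>s (\<rho>(s) - \<rho>(e)))\<close> is written entrywise, because the matrix type,
  containing matrices of all dimensions, is not additively a monoid.\<close>

definition rep_operator ::
  "('a, 'b) monoid_scheme \<Rightarrow> 'a set \<Rightarrow> nat \<Rightarrow> ('a \<Rightarrow> complex mat) \<Rightarrow> ('a set \<Rightarrow> real) \<Rightarrow> complex mat"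
  where "rep_operator G S n \<rho> \<alpha> =
    mat n n (\<lambda>(i, j). - (\<Sum>s\<in>S. complex_of_real (\<alpha> {s, inv\<^bsub>G\<^esub> s}) *
      (\<rho> s $$ (i, j) - \<rho> \<one>\<^bsub>G\<^esub> $$ (i, j))))"

definition rep_char_poly ::
  "('a, 'b) monoid_scheme \<Rightarrow> 'a set \<Rightarrow> nat \<Rightarrow> ('a \<Rightarrow> complex mat) \<Rightarrow> ('a set \<Rightarrow> real) \<Rightarrow> complex poly"
  where "rep_char_poly G S n \<rho> \<alpha> = char_poly (rep_operator G S n \<rho> \<alpha>)"

definition a_res ::
  "('a, 'b) monoid_scheme \<Rightarrow> 'a set \<Rightarrow> nat \<Rightarrow> ('a \<Rightarrow> complex mat) \<Rightarrow> nat \<Rightarrow> ('a \<Rightarrow> complex mat) \<Rightarrow>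
   ('a set \<Rightarrow> real) \<Rightarrow> complex"
  where "a_res G S n \<rho> m \<sigma> \<alpha> = resultant (rep_char_poly G S n \<rho> \<alpha>) (rep_char_poly G S m \<sigma> \<alpha>)"

definition b_res ::
  "('a, 'b) monoid_scheme \<Rightarrow> 'a set \<Rightarrow> nat \<Rightarrow> ('a \<Rightarrow> complex mat) \<Rightarrow> ('a set \<Rightarrow> real) \<Rightarrow> complex"
  where "b_res G S n \<rho> \<alpha> =
    resultant (rep_char_poly G S n \<rho> \<alpha>) (pderiv (rep_char_poly G S n \<rho> \<alpha>))"

definition c_res ::
  "('a, 'b) monoid_scheme \<Rightarrow> 'a set \<Rightarrow> nat \<Rightarrow> ('a \<Rightarrow> complex mat) \<Rightarrow> ('a set \<Rightarrow> real) \<Rightarrow> complex"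
  where "c_res G S n \<rho> \<alpha> =
    resultant (rep_char_poly G S n \<rho> \<alpha>) (pderiv (pderiv (rep_char_poly G S n \<rho> \<alpha>)))"

end

theory Submission
  imports
    Defs
    "Jordan_Normal_Form.Schur_Decomposition"
    "Subresultants.Subresultant_Gcd"
    "HOL-Computational_Algebra.Field_as_Ring"
begin

text \<open>Complex functions on \<open>G\<close> form the space \<open>\<complex>\<^sup>N\<close>, \<open>N = |G|\<close>, on which \<open>G\<close> acts from the left
  and the Laplacian acts from the right, by a real symmetric matrix. Let \<open>E\<^sub>\<mu>\<close> be its complex
  eigenspace for a real number \<open>\<mu>\<close>. Complexification turns the \<open>G\<close>-invariant subspaces of the real
  eigenspace into the subspaces of \<open>E\<^sub>\<mu>\<close> that are invariant under \<open>G\<close> and under complex conjugation, so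
  \<open>\<Delta>\<^sub>w\<close> is real \<open>G\<close>-simple iff no \<open>E\<^sub>\<mu>\<close> has a proper nonzero subspace of that kind.

  By Frobenius reciprocity a \<open>G\<close>-map from an irreducible \<open>W\<close> to \<open>E\<^sub>\<mu>\<close> is a matrix coefficient map
  \<open>v \<mapsto> (x \<mapsto> \<psi>(\<rho>(x\<^sup>-\<^sup>1) v))\<close> for an eigenvector \<open>\<psi>\<close> of the transpose of \<open>D\<^sub>W(w)\<close> with
  eigenvalue \<open>\<mu>\<close>. Since the Laplacian is symmetric, \<open>D\<^sub>W(w)\<close> is diagonalisable, and the space of these
  maps has the multiplicity of \<open>\<mu>\<close> as a root of \<open>P\<^sub>W(w)\<close> as its dimension (\<open>dual_evecs_basis\<close>). The
  three resultants express statements on these multiplicities: a common root, a root of multiplicity at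
  least two, and, when multiplicity one is impossible, a root of multiplicity at least three.

  Suppose that \<open>\<Delta>\<^sub>w\<close> is simple and that \<open>T : W \<rightarrow> E\<^sub>\<mu>\<close> is a nonzero \<open>G\<close>-map. The image of \<open>T\<close> and its
  complex conjugate span a conjugation invariant subspace, hence all of \<open>E\<^sub>\<mu>\<close>. So every other \<open>G\<close>-map
  into \<open>E\<^sub>\<mu>\<close> comes from a \<open>G\<close>-map into \<open>W\<close> or into the conjugate of \<open>W\<close>, which is isomorphic to \<open>W\<^sup>*\<close>
  (\<open>simple_hom_decomposition\<close>). By Schur's lemma no class other than those of \<open>W\<close> and \<open>W\<^sup>*\<close> occurs in
  \<open>E\<^sub>\<mu>\<close>, and \<open>W\<close> has multiplicity at most two. It has multiplicity one if \<open>W\<close> has complex type (there are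
  no nonzero \<open>G\<close>-maps from \<open>W\<close> to its conjugate) or real type (\<open>T\<close> can be chosen compatible with the
  real structure, and then its image is all of \<open>E\<^sub>\<mu>\<close>). If \<open>W\<close> has quaternionic type, the multiplicity is
  two, because twisting \<open>T\<close> by the quaternionic structure gives an independent map.

  Conversely (\<open>resultants_imp_simple\<close>), if an invariant, conjugation invariant subspace \<open>X\<close> of \<open>E\<^sub>\<mu>\<close> is
  proper and nonzero, take irreducible subspaces of \<open>X\<close> and of its orthogonal complement in \<open>E\<^sub>\<mu>\<close>. If the
  resultants \<open>a\<close> do not vanish at \<open>w\<close>, both can be taken isomorphic to one \<open>W\<close>, as the complement is
  closed under conjugation too. Then \<open>W\<close> has multiplicity at least two, and at least three if it has
  quaternionic type, since the twisted map stays in \<open>X\<close>. So one of \<open>b\<close> and \<open>c\<close> vanishes at \<open>w\<close>.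

  Thus simplicity at \<open>w\<close> is the nonvanishing at \<open>w\<close> of all the resultants. They are polynomial
  functions of the weight, and there are finitely many of them, because inequivalent irreducible
  representations have orthogonal images in \<open>\<complex>\<^sup>N\<close> (\<open>finite_rep_char_polys\<close>). The zero set of a
  polynomial function that is not identically zero is closed and has empty interior
  (\<open>polyfun_nonzero_in_open\<close>), which gives both the existence of a simple weight and the residuality of
  the set of simple weights.\<close>

section \<open>Injective matrices and subspaces\<close>

definition inj_mat :: "'a :: field mat \<Rightarrow> bool"
  where "inj_mat C \<longleftrightarrow> (\<forall>v\<in>carrier_vec (dim_col C). C *\<^sub>v v = 0\<^sub>v (dim_row C) \<longrightarrow> v = 0\<^sub>v (dim_col C))"

definition mat_range :: "'a :: field mat \<Rightarrow> 'a vec set"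
  where "mat_range C = (\<lambda>v. C *\<^sub>v v) ` carrier_vec (dim_col C)"

definition lin_subspace :: "nat \<Rightarrow> 'a :: field vec set \<Rightarrow> bool"
  where "lin_subspace n V \<longleftrightarrow> V \<subseteq> carrier_vec n \<and> 0\<^sub>v n \<in> V \<and>
    (\<forall>u\<in>V. \<forall>v\<in>V. u + v \<in> V) \<and> (\<forall>c. \<forall>v\<in>V. c \<cdot>\<^sub>v v \<in> V)"

lemma lin_subspaceD:
  assumes "lin_subspace n V"
  shows "V \<subseteq> carrier_vec n" "0\<^sub>v n \<in> V" "u \<in> V \<Longrightarrow> v \<in> V \<Longrightarrow> u + v \<in> V" "v \<in> V \<Longrightarrow> c \<cdot>\<^sub>v v \<in> V"
    "v \<in> V \<Longrightarrow> v \<in> carrier_vec n"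
  using assms by (auto simp: lin_subspace_def)

lemma lin_subspace_diff:
  assumes "lin_subspace n V" "u \<in> V" "v \<in> V" shows "u - v \<in> V"
proof -
  have "u - v = u + (-1) \<cdot>\<^sub>v v"
    using lin_subspaceD(5)[OF assms(1)] assms(2,3)
    by (intro eq_vecI) (auto dest!: carrier_vecD)
  then show ?thesis using lin_subspaceD(3,4)[OF assms(1)] assms(2,3) by simp
qed

text \<open>The predicate \<^const>\<open>lin_subspace\<close> spells out the closure properties, which is what all the
  arguments below use; this lemma connects it to the notion that the definition of irreducibility refers to.\<close>

lemma lin_subspace_iff_subspace:
  "VectorSpace.subspace class_ring V (module_vec TYPE('a::field) n) \<longleftrightarrow> lin_subspace n V"
proof
  assume "VectorSpace.subspace class_ring V (module_vec TYPE('a) n)"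
  then have s: "LinearCombinations.submodule class_ring V (module_vec TYPE('a) n)"
    by (simp add: VectorSpace.subspace_def)
  show "lin_subspace n V"
    using s unfolding LinearCombinations.submodule_def lin_subspace_def
    by (auto simp: module_vec_simps)
next
  assume a: "lin_subspace n V"
  have "- v = (-1) \<cdot>\<^sub>v v" for v :: "'a vec" by (intro eq_vecI) auto
  then show "VectorSpace.subspace class_ring V (module_vec TYPE('a) n)"
    using a vec_vs[of n, where 'a='a] vec_module[of n, where 'a='a]
    unfolding VectorSpace.subspace_def LinearCombinations.submodule_def lin_subspace_def
    by (auto simp: module_vec_simps)
qed

lemma inj_matD:
  assumes "inj_mat C" "C \<in> carrier_mat n m" "v \<in> carrier_vec m" "C *\<^sub>v v = 0\<^sub>v n"
  shows "v = 0\<^sub>v m"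
  using assms by (auto simp: inj_mat_def)

lemma mult_mat_vec_diff:
  assumes "(A :: 'a :: ring mat) \<in> carrier_mat n m" "u \<in> carrier_vec m" "v \<in> carrier_vec m"
  shows "A *\<^sub>v (u - v) = A *\<^sub>v u - A *\<^sub>v v"
  using assms mult_minus_distrib_mat_vec by blast

lemma inj_mat_eqD:
  assumes C: "inj_mat C" "C \<in> carrier_mat n m" and uv: "u \<in> carrier_vec m" "v \<in> carrier_vec m"
    and eq: "C *\<^sub>v u = C *\<^sub>v v"
  shows "u = v"
proof -
  have "C *\<^sub>v (u - v) = 0\<^sub>v n" using C uv eq by (simp add: mult_mat_vec_diff)
  then have z: "u - v = 0\<^sub>v m" using C uv by (intro inj_matD[OF C]) auto
  show ?thesis
  proof (rule eq_vecI)
    fix i assume i: "i < dim_vec v"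
    then have "(u - v) $ i = 0" using z uv by auto
    then show "u $ i = v $ i" using uv i by auto
  qed (use uv in auto)
qed

lemma mult_mat_unit_vec:
  assumes "(A :: 'a :: semiring_1 mat) \<in> carrier_mat n m" "j < m"
  shows "A *\<^sub>v unit_vec m j = col A j"
  using assms by (intro eq_vecI) (auto simp: scalar_prod_right_unit)

lemma mat_eq_by_action:
  assumes A: "(A :: 'a :: semiring_1 mat) \<in> carrier_mat n m" and B: "B \<in> carrier_mat n m"
    and eq: "\<And>v. v \<in> carrier_vec m \<Longrightarrow> A *\<^sub>v v = B *\<^sub>v v"
  shows "A = B"
proof (rule mat_col_eqI)
  fix j assume "j < dim_col B"
  then have j: "j < m" using B by simp
  then show "col A j = col B j"
    using eq[of "unit_vec m j"] mult_mat_unit_vec[OF A j] mult_mat_unit_vec[OF B j] by simp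
qed (use A B in auto)

lemma inj_mat_cancel:
  assumes C: "inj_mat C" "C \<in> carrier_mat n m" and A: "A \<in> carrier_mat m k" "B \<in> carrier_mat m k"
    and eq: "C * A = C * B"
  shows "A = B"
proof (rule mat_eq_by_action[OF A])
  fix v :: "'a vec" assume v: "v \<in> carrier_vec k"
  have "C *\<^sub>v (A *\<^sub>v v) = C *\<^sub>v (B *\<^sub>v v)"
    using eq C A v by (metis assoc_mult_mat_vec)
  then show "A *\<^sub>v v = B *\<^sub>v v"
    by (rule inj_mat_eqD[OF C mult_mat_vec_carrier[OF A(1) v] mult_mat_vec_carrier[OF A(2) v]])
qed

lemma inj_mat_mult:
  assumes "inj_mat A" "A \<in> carrier_mat n m" "inj_mat B" "B \<in> carrier_mat m k"
  shows "inj_mat (A * B)"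
  unfolding inj_mat_def
proof (intro ballI impI)
  fix v assume "v \<in> carrier_vec (dim_col (A * B))" "A * B *\<^sub>v v = 0\<^sub>v (dim_row (A * B))"
  then have "v \<in> carrier_vec k" "A *\<^sub>v (B *\<^sub>v v) = 0\<^sub>v n" using assms by auto
  then show "v = 0\<^sub>v (dim_col (A * B))"
    using inj_matD[OF assms(1,2), of "B *\<^sub>v v"] inj_matD[OF assms(3,4), of v] assms by auto
qed

lemma inj_mat_right_factor:
  assumes "inj_mat (A * B)" "A \<in> carrier_mat n m" "B \<in> carrier_mat m k"
  shows "inj_mat B"
  unfolding inj_mat_def
proof (intro ballI impI)
  fix v assume "v \<in> carrier_vec (dim_col B)" "B *\<^sub>v v = 0\<^sub>v (dim_row B)"
  then have "v \<in> carrier_vec k" "B *\<^sub>v v = 0\<^sub>v m" using assms by auto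
  then have "A * B *\<^sub>v v = 0\<^sub>v n" using assms by auto
  then show "v = 0\<^sub>v (dim_col B)"
    using inj_matD[OF assms(1) mult_carrier_mat[OF assms(2,3)]] assms \<open>v \<in> carrier_vec k\<close> by auto
qed

lemma inj_mat_dim_le:
  assumes C: "inj_mat C" "C \<in> carrier_mat n m"
  shows "m \<le> n"
proof (rule ccontr)
  assume "\<not> m \<le> n"
  then have nm: "n < m" by simp
  \<comment> \<open>Pad with zero rows to a square matrix, which is then singular.\<close>
  define D where "D = mat m m (\<lambda>(i, j). if i < n then C $$ (i, j) else 0)"
  have D: "D \<in> carrier_mat m m" by (simp add: D_def)
  have "transpose_mat D *\<^sub>v unit_vec m (m - 1) = col (transpose_mat D) (m - 1)"
    using D nm by (intro mult_mat_unit_vec[where n = m]) auto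
  also have "\<dots> = 0\<^sub>v m" using nm by (intro eq_vecI) (auto simp: D_def)
  finally have z: "transpose_mat D *\<^sub>v unit_vec m (m - 1) = 0\<^sub>v m" .
  have "unit_vec m (m - 1) $ (m - 1) \<noteq> (0\<^sub>v m :: 'a vec) $ (m - 1)" using nm by simp
  then have "unit_vec m (m - 1) \<noteq> (0\<^sub>v m :: 'a vec)" by metis
  then have "det (transpose_mat D) = 0"
    using z D nm by (intro iffD2[OF det_0_iff_vec_prod_zero[of _ m]] exI[of _ "unit_vec m (m - 1)"] conjI) auto
  then have "det D = 0" using det_transpose[OF D] by simp
  then obtain v where v: "v \<in> carrier_vec m" "v \<noteq> 0\<^sub>v m" "D *\<^sub>v v = 0\<^sub>v m"
    using det_0_iff_vec_prod_zero[OF D] by auto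
  have "C *\<^sub>v v = 0\<^sub>v n"
  proof (rule eq_vecI)
    fix i assume i: "i < dim_vec (0\<^sub>v n :: 'a vec)"
    then have "(D *\<^sub>v v) $ i = 0" using v nm by auto
    moreover have "row D i = row C i" using i nm C by (intro eq_vecI) (auto simp: D_def)
    ultimately show "(C *\<^sub>v v) $ i = 0\<^sub>v n $ i" using i C nm D by auto
  qed (use C in auto)
  then show False using inj_matD[OF C v(1)] v(2) by simp
qed

lemma inj_mat_square_inverse:
  assumes C: "inj_mat C" "C \<in> carrier_mat n n"
  obtains C' where "C' \<in> carrier_mat n n" "C * C' = 1\<^sub>m n" "C' * C = 1\<^sub>m n"
proof -
  have "det C \<noteq> 0" using det_0_iff_vec_prod_zero[OF C(2)] inj_matD[OF C] by auto
  then have "C \<in> Units (ring_mat TYPE('a) n ())" 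
    by (rule det_non_zero_imp_unit[OF C(2)])
  then show ?thesis using that by (auto simp: Units_def ring_mat_def)
qed

lemma inverse_imp_inj_mat:
  assumes "A \<in> carrier_mat m n" "B \<in> carrier_mat n m" "B * A = 1\<^sub>m n"
  shows "inj_mat A"
  by (rule inj_mat_right_factor[OF _ assms(2,1)]) (use assms in \<open>auto simp: inj_mat_def\<close>)

lemma lin_subspace_mat_range:
  assumes "C \<in> carrier_mat n m" shows "lin_subspace n (mat_range C)"
  unfolding lin_subspace_def mat_range_def
proof (intro conjI ballI allI)
  show "0\<^sub>v n \<in> (*\<^sub>v) C ` carrier_vec (dim_col C)"
    using assms by (intro image_eqI[where x="0\<^sub>v m"]) auto
  fix u v assume "u \<in> (*\<^sub>v) C ` carrier_vec (dim_col C)" "v \<in> (*\<^sub>v) C ` carrier_vec (dim_col C)"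
  then obtain u' v' where "u' \<in> carrier_vec m" "v' \<in> carrier_vec m" "u = C *\<^sub>v u'" "v = C *\<^sub>v v'"
    using assms by auto
  then show "u + v \<in> (*\<^sub>v) C ` carrier_vec (dim_col C)"
    using assms by (intro image_eqI[where x="u' + v'"]) (auto simp: mult_add_distrib_mat_vec)
next
  fix c v assume "v \<in> (*\<^sub>v) C ` carrier_vec (dim_col C)"
  then obtain v' where "v' \<in> carrier_vec m" "v = C *\<^sub>v v'" using assms by auto
  then show "c \<cdot>\<^sub>v v \<in> (*\<^sub>v) C ` carrier_vec (dim_col C)"
    using assms by (intro image_eqI[where x="c \<cdot>\<^sub>v v'"]) (auto simp: mult_mat_vec)
qed (use assms in auto)

lemma mat_rangeI: "C \<in> carrier_mat n m \<Longrightarrow> v \<in> carrier_vec m \<Longrightarrow> C *\<^sub>v v \<in> mat_range C"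
  by (auto simp: mat_range_def)

lemma mat_rangeE:
  assumes "u \<in> mat_range C" "C \<in> carrier_mat n m"
  obtains v where "v \<in> carrier_vec m" "u = C *\<^sub>v v"
  using assms by (auto simp: mat_range_def)

text \<open>Bases of subspaces are handled as injective matrices with the given range. Appending a column is the
  step that extends a basis.\<close>

definition append_col :: "'a :: field mat \<Rightarrow> 'a vec \<Rightarrow> 'a mat"
  where "append_col C v = mat (dim_row C) (Suc (dim_col C))
    (\<lambda>(i, j). if j < dim_col C then C $$ (i, j) else v $ i)"

lemma append_col_mult:
  assumes C: "C \<in> carrier_mat n m" and v: "v \<in> carrier_vec n" and u: "u \<in> carrier_vec (Suc m)"
  shows "append_col C v *\<^sub>v u = C *\<^sub>v vec m (($) u) + u $ m \<cdot>\<^sub>v v"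
proof (rule eq_vecI)
  fix i assume "i < dim_vec (C *\<^sub>v vec m (($) u) + u $ m \<cdot>\<^sub>v v)"
  then have i: "i < n" using v by simp
  then show "(append_col C v *\<^sub>v u) $ i = (C *\<^sub>v vec m (($) u) + u $ m \<cdot>\<^sub>v v) $ i"
    using C v u by (simp add: append_col_def scalar_prod_def row_def mult.commute)
qed (use C v in \<open>auto simp: append_col_def\<close>)

lemma append_col_carrier[simp]: "C \<in> carrier_mat n m \<Longrightarrow> append_col C v \<in> carrier_mat n (Suc m)"
  by (simp add: append_col_def)

lemma inj_append_col:
  assumes C: "inj_mat C" "C \<in> carrier_mat n m" and v: "v \<in> carrier_vec n" "v \<notin> mat_range C"
  shows "inj_mat (append_col C v)"
  unfolding inj_mat_def
proof (intro ballI impI)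
  fix u assume "u \<in> carrier_vec (dim_col (append_col C v))"
    "append_col C v *\<^sub>v u = 0\<^sub>v (dim_row (append_col C v))"
  then have u: "u \<in> carrier_vec (Suc m)" and z: "append_col C v *\<^sub>v u = 0\<^sub>v n"
    using append_col_carrier[OF C(2), of v] by (metis carrier_matD)+
  let ?u = "vec m (($) u)"
  have eq: "C *\<^sub>v ?u + u $ m \<cdot>\<^sub>v v = 0\<^sub>v n" using append_col_mult[OF C(2) v(1) u] z by simp
  have um: "u $ m = 0"
  proof (rule ccontr)
    assume nz: "u $ m \<noteq> 0"
    have "v = C *\<^sub>v ((- inverse (u $ m)) \<cdot>\<^sub>v ?u)"
    proof (rule eq_vecI)
      fix i assume "i < dim_vec (C *\<^sub>v ((- inverse (u $ m)) \<cdot>\<^sub>v ?u))"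
      then have i: "i < n" using C by auto
      then have "(C *\<^sub>v ?u + u $ m \<cdot>\<^sub>v v) $ i = 0" using eq by simp
      then have "(C *\<^sub>v ?u) $ i + u $ m * v $ i = 0" using i C v by auto
      then have "v $ i = - inverse (u $ m) * (C *\<^sub>v ?u) $ i"
        using nz by (simp add: field_simps eq_neg_iff_add_eq_0)
      moreover have "C *\<^sub>v ((- inverse (u $ m)) \<cdot>\<^sub>v ?u) = (- inverse (u $ m)) \<cdot>\<^sub>v (C *\<^sub>v ?u)"
        using C by (intro mult_mat_vec) auto
      ultimately show "v $ i = (C *\<^sub>v ((- inverse (u $ m)) \<cdot>\<^sub>v ?u)) $ i" using i C by simp
    qed (use C v in auto)
    then show False using v(2) mat_rangeI[OF C(2), of "(- inverse (u $ m)) \<cdot>\<^sub>v ?u"] by simp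
  qed
  have "C *\<^sub>v ?u = 0\<^sub>v n"
  proof (rule eq_vecI)
    fix i assume i: "i < dim_vec (0\<^sub>v n :: 'a vec)"
    have "(C *\<^sub>v ?u + u $ m \<cdot>\<^sub>v v) $ i = 0" using eq i by simp
    then show "(C *\<^sub>v ?u) $ i = 0\<^sub>v n $ i" using um i C v by auto
  qed (use C in auto)
  then have u0: "?u = 0\<^sub>v m" using inj_matD[OF C] by simp
  show "u = 0\<^sub>v (dim_col (append_col C v))"
  proof (rule eq_vecI)
    fix i assume "i < dim_vec (0\<^sub>v (dim_col (append_col C v)) :: 'a vec)"
    then have i: "i < Suc m" using C by (simp add: append_col_def)
    show "u $ i = 0\<^sub>v (dim_col (append_col C v)) $ i"
    proof (cases "i < m")
      case True
      have "?u $ i = 0" using u0 True by simp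
      then show ?thesis using True C by (simp add: append_col_def)
    next
      case False
      then have "i = m" using i by simp
      then show ?thesis using um C by (simp add: append_col_def)
    qed
  qed (use u C in \<open>auto simp: append_col_def\<close>)
qed

text \<open>As long as the range is not all of \<open>V\<close>, a vector of \<open>V\<close> outside the range can be appended as a new
  column without losing injectivity. An injective matrix has at most as many columns as rows, so this stops.\<close>

lemma extend_to_basis:
  assumes V: "lin_subspace n V" and C: "inj_mat C" "C \<in> carrier_mat n k" "mat_range C \<subseteq> V"
  shows "\<exists>m D. k \<le> m \<and> D \<in> carrier_mat n m \<and> inj_mat D \<and> mat_range D = V \<and>
    (\<forall>i<n. \<forall>j<k. D $$ (i, j) = C $$ (i, j))"
  using C
proof (induction "n - k" arbitrary: k C rule: less_induct)
  case less
  show ?case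
  proof (cases "mat_range C = V")
    case True
    then show ?thesis using less.prems by (intro exI[of _ k] exI[of _ C]) auto
  next
    case False
    then obtain v where v: "v \<in> V" "v \<notin> mat_range C" using less.prems by auto
    have vn: "v \<in> carrier_vec n" using v V by (auto simp: lin_subspace_def)
    let ?D = "append_col C v"
    have inj: "inj_mat ?D" using inj_append_col less.prems vn v by blast
    have car: "?D \<in> carrier_mat n (Suc k)" using less.prems by simp
    have "Suc k \<le> n" using inj_mat_dim_le[OF inj car] .
    moreover have "mat_range ?D \<subseteq> V"
    proof
      fix x assume "x \<in> mat_range ?D"
      then obtain u where u: "u \<in> carrier_vec (Suc k)" "x = ?D *\<^sub>v u" using mat_rangeE car by blast
      have "C *\<^sub>v vec k (($) u) \<in> V" using less.prems mat_rangeI[OF less.prems(2)] by auto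
      then show "x \<in> V" using u append_col_mult[OF less.prems(2) vn u(1)] v(1) V
        by (auto simp: lin_subspace_def)
    qed
    ultimately obtain m D where D: "Suc k \<le> m" "D \<in> carrier_mat n m" "inj_mat D" "mat_range D = V"
      "\<forall>i<n. \<forall>j<Suc k. D $$ (i, j) = ?D $$ (i, j)"
      using less.hyps[of "Suc k" ?D] inj car by force
    have "\<forall>i<n. \<forall>j<k. D $$ (i, j) = C $$ (i, j)" using D(5) less.prems(2) by (auto simp: append_col_def)
    then show ?thesis using D by (intro exI[of _ m] exI[of _ D]) auto
  qed
qed

lemma subspace_basis:
  assumes V: "lin_subspace n V"
  obtains m D where "m \<le> n" "D \<in> carrier_mat n m" "inj_mat D" "mat_range D = V"
proof -
  have "inj_mat (0\<^sub>m n 0 :: 'a mat)" by (auto simp: inj_mat_def)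
  moreover have "mat_range (0\<^sub>m n 0) \<subseteq> V" 
  proof
    fix x assume "x \<in> mat_range (0\<^sub>m n 0 :: 'a mat)"
    then obtain u where "u \<in> carrier_vec 0" "x = 0\<^sub>m n 0 *\<^sub>v u" by (auto simp: mat_range_def)
    then have "x = 0\<^sub>v n" by (intro eq_vecI) (auto simp: scalar_prod_def)
    then show "x \<in> V" using V by (auto simp: lin_subspace_def)
  qed
  ultimately obtain m D where "D \<in> carrier_mat n m" "inj_mat D" "mat_range D = V"
    using extend_to_basis[OF V, of "0\<^sub>m n 0" 0] by auto
  then show ?thesis using that inj_mat_dim_le by blast
qed

lemma inj_mat_square_range:
  assumes C: "inj_mat C" "C \<in> carrier_mat n n" shows "mat_range C = carrier_vec n"
proof
  obtain C' where C': "C' \<in> carrier_mat n n" "C * C' = 1\<^sub>m n" using inj_mat_square_inverse[OF C] by metis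
  show "carrier_vec n \<subseteq> mat_range C"
  proof
    fix v :: "'a vec" assume v: "v \<in> carrier_vec n"
    have "C *\<^sub>v (C' *\<^sub>v v) = v" using C C' v by (metis assoc_mult_mat_vec one_mult_mat_vec)
    then show "v \<in> mat_range C" using mat_rangeI[OF C(2), of "C' *\<^sub>v v"] C' v by auto
  qed
qed (use C in \<open>auto simp: mat_range_def\<close>)

text \<open>The columns of \<open>Y\<close> are preimages under \<open>B\<close> of the columns of \<open>X\<close>.\<close>

lemma mat_range_factor:
  assumes B: "B \<in> carrier_mat N n" and X: "X \<in> carrier_mat N m"
    and sub: "\<And>v. v \<in> carrier_vec m \<Longrightarrow> X *\<^sub>v v \<in> mat_range B"
  obtains Y where "Y \<in> carrier_mat n m" "X = B * Y"
proof -
  have "\<forall>j<m. \<exists>y. y \<in> carrier_vec n \<and> col X j = B *\<^sub>v y"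
  proof (intro allI impI)
    fix j assume j: "j < m"
    have "col X j \<in> mat_range B" using sub[of "unit_vec m j"] mult_mat_unit_vec[OF X j] by simp
    then show "\<exists>y. y \<in> carrier_vec n \<and> col X j = B *\<^sub>v y" using B by (auto elim: mat_rangeE)
  qed
  then obtain y where y: "\<And>j. j < m \<Longrightarrow> y j \<in> carrier_vec n \<and> col X j = B *\<^sub>v y j" by metis
  define Y where "Y = mat n m (\<lambda>(i, j). y j $ i)"
  have colY: "col Y j = y j" if "j < m" for j using y[OF that] that by (intro eq_vecI) (auto simp: Y_def)
  have Y: "Y \<in> carrier_mat n m" by (simp add: Y_def)
  have "X = B * Y"
  proof (rule mat_col_eqI)
    fix j assume "j < dim_col (B * Y)"
    then have j: "j < m" using Y by simp
    then show "col X j = col (B * Y) j" using col_mult2[OF B Y j] colY y by simp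
  qed (use B Y X in auto)
  then show ?thesis using that Y by blast
qed

text \<open>A surjective matrix has a right inverse, which is injective.\<close>

lemma surj_mat_dim_le:
  fixes A :: "'a :: field mat"
  assumes A: "A \<in> carrier_mat m n" and r: "mat_range A = carrier_vec m" shows "m \<le> n"
proof -
  obtain Y where Y: "Y \<in> carrier_mat n m" "1\<^sub>m m = A * Y"
    using mat_range_factor[OF A, of "1\<^sub>m m" m] r by auto
  have "inj_mat (1\<^sub>m m :: 'a mat)" by (auto simp: inj_mat_def)
  then have "inj_mat (A * Y)" unfolding Y(2) .
  then have "inj_mat Y" using inj_mat_right_factor[OF _ A Y(1)] by blast
  then show ?thesis using inj_mat_dim_le Y by blast
qed

lemma mult_mat_zero_vec: "(A :: 'k :: comm_ring_1 mat) \<in> carrier_mat n m \<Longrightarrow> A *\<^sub>v 0\<^sub>v m = 0\<^sub>v n"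
  by (intro eq_vecI) auto

lemma smult_vec_zero: "c \<cdot>\<^sub>v 0\<^sub>v n = (0\<^sub>v n :: 'k :: comm_ring_1 vec)"
  by (intro eq_vecI) auto

lemma lin_subspace_eigenvectors:
  fixes A :: "'a :: field mat"
  assumes A: "A \<in> carrier_mat n n"
  shows "lin_subspace n {v \<in> carrier_vec n. A *\<^sub>v v = \<mu> \<cdot>\<^sub>v v}"
  unfolding lin_subspace_def
  by (auto simp: mult_mat_zero_vec[OF A] smult_vec_zero mult_add_distrib_mat_vec[OF A] mult_mat_vec[OF A]
      smult_add_distrib_vec[of _ n] smult_smult_assoc mult.commute)

lemma lin_subspace_kernel:
  fixes A :: "'a :: field mat"
  assumes A: "A \<in> carrier_mat m n"
  shows "lin_subspace n {v \<in> carrier_vec n. A *\<^sub>v v = 0\<^sub>v m}"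
  unfolding lin_subspace_def
  by (auto simp: mult_mat_zero_vec[OF A] smult_vec_zero mult_add_distrib_mat_vec[OF A] mult_mat_vec[OF A])

section \<open>Complex conjugation and the standard inner product\<close>

abbreviation vcnj :: "complex vec \<Rightarrow> complex vec" where "vcnj \<equiv> map_vec cnj"
abbreviation mcnj :: "complex mat \<Rightarrow> complex mat" where "mcnj \<equiv> map_mat cnj"

interpretation cnj_hom: comm_ring_hom cnj by unfold_locales auto

lemma vcnj_vcnj[simp]: "vcnj (vcnj v) = v" by (intro eq_vecI) auto
lemma mcnj_mcnj[simp]: "mcnj (mcnj A) = A" by (intro eq_matI) auto
lemma vcnj_eq_conjugate: "vcnj v = conjugate v" by (intro eq_vecI) auto
lemma vcnj_mult: "A \<in> carrier_mat n m \<Longrightarrow> v \<in> carrier_vec m \<Longrightarrow> vcnj (A *\<^sub>v v) = mcnj A *\<^sub>v vcnj v"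
  by (rule cnj_hom.mult_mat_vec_hom)
lemma mcnj_mult: "A \<in> carrier_mat n m \<Longrightarrow> B \<in> carrier_mat m k \<Longrightarrow> mcnj (A * B) = mcnj A * mcnj B"
  by (rule cnj_hom.mat_hom_mult)
lemma vcnj_add: "u \<in> carrier_vec n \<Longrightarrow> v \<in> carrier_vec n \<Longrightarrow> vcnj (u + v) = vcnj u + vcnj v"
  by (intro eq_vecI) auto
lemma vcnj_smult: "vcnj (c \<cdot>\<^sub>v v) = cnj c \<cdot>\<^sub>v vcnj v" by (intro eq_vecI) auto
lemma vcnj_zero: "vcnj (0\<^sub>v n) = 0\<^sub>v n" by (intro eq_vecI) auto
lemma mcnj_one: "mcnj (1\<^sub>m n) = 1\<^sub>m n" by (intro eq_matI) auto

lemma inj_mcnj: assumes "inj_mat C" "C \<in> carrier_mat n m" shows "inj_mat (mcnj C)"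
  unfolding inj_mat_def
proof (intro ballI impI)
  fix v assume "v \<in> carrier_vec (dim_col (mcnj C))" "mcnj C *\<^sub>v v = 0\<^sub>v (dim_row (mcnj C))"
  then have v: "v \<in> carrier_vec m" "mcnj C *\<^sub>v v = 0\<^sub>v n" using assms by auto
  have "vcnj (C *\<^sub>v vcnj v) = 0\<^sub>v n" using v assms by (subst vcnj_mult) auto
  then have "C *\<^sub>v vcnj v = 0\<^sub>v n" using vcnj_zero vcnj_vcnj by metis
  then have "vcnj v = 0\<^sub>v m" using inj_matD[OF assms] v by auto
  then have "v = 0\<^sub>v m" using vcnj_zero vcnj_vcnj by metis
  then show "v = 0\<^sub>v (dim_col (mcnj C))" using assms by auto
qed

abbreviation cinner :: "complex vec \<Rightarrow> complex vec \<Rightarrow> complex" where "cinner u v \<equiv> u \<bullet> vcnj v"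

lemma cinner_self_eq_0: "v \<in> carrier_vec n \<Longrightarrow> cinner v v = 0 \<Longrightarrow> v = 0\<^sub>v n"
  using conjugate_square_eq_0_vec[of v n] by (simp add: vcnj_eq_conjugate)

definition cadj :: "complex mat \<Rightarrow> complex mat" where "cadj A = mcnj (transpose_mat A)"

lemma cadj_carrier[simp]: "A \<in> carrier_mat n m \<Longrightarrow> cadj A \<in> carrier_mat m n"
  by (simp add: cadj_def)

lemma cinner_commute: "u \<in> carrier_vec n \<Longrightarrow> v \<in> carrier_vec n \<Longrightarrow> cinner u v = cnj (cinner v u)"
  by (simp add: scalar_prod_def mult.commute)

lemma cinner_adj_right:
  assumes A: "A \<in> carrier_mat n m" and u: "u \<in> carrier_vec m" and v: "v \<in> carrier_vec n"
  shows "cinner (A *\<^sub>v u) v = cinner u (cadj A *\<^sub>v v)"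
proof -
  have "vcnj (cadj A *\<^sub>v v) = transpose_mat A *\<^sub>v vcnj v"
    using vcnj_mult[of "cadj A" m n v] A v by (simp add: cadj_def)
  moreover have "(transpose_mat A *\<^sub>v vcnj v) \<bullet> u = vcnj v \<bullet> (A *\<^sub>v u)"
    using transpose_vec_mult_scalar[OF A u, of "vcnj v"] v by simp
  ultimately show ?thesis using A u v
    by (metis carrier_vecI cadj_carrier comm_scalar_prod map_carrier_vec mult_mat_vec_carrier)
qed

lemma cadj_mult: "A \<in> carrier_mat n m \<Longrightarrow> B \<in> carrier_mat m k \<Longrightarrow> cadj (A * B) = cadj B * cadj A"
  unfolding cadj_def by (subst transpose_mult, assumption, assumption) (rule mcnj_mult, auto)

lemma gram_inj:
  assumes C: "inj_mat C" "C \<in> carrier_mat n m" shows "inj_mat (cadj C * C)"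
  unfolding inj_mat_def
proof (intro ballI impI)
  fix v assume "v \<in> carrier_vec (dim_col (cadj C * C))" "cadj C * C *\<^sub>v v = 0\<^sub>v (dim_row (cadj C * C))"
  then have v: "v \<in> carrier_vec m" "cadj C *\<^sub>v (C *\<^sub>v v) = 0\<^sub>v m"
    using C cadj_carrier[OF C(2)] by auto
  have "cinner (C *\<^sub>v v) (C *\<^sub>v v) = cinner v (cadj C *\<^sub>v (C *\<^sub>v v))"
    by (rule cinner_adj_right[OF C(2)]) (use v C in auto)
  also have "\<dots> = 0" using v by (simp add: vcnj_zero)
  finally have "C *\<^sub>v v = 0\<^sub>v n" using C v by (intro cinner_self_eq_0) auto
  then show "v = 0\<^sub>v (dim_col (cadj C * C))" using inj_matD[OF C v(1)] C by simp
qed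

text \<open>The normal equations: for a basis matrix \<open>C\<close> of \<open>V\<close> the Gram matrix \<open>C\<^sup>*C\<close> is invertible, and
  \<open>p = C(C\<^sup>*C)\<^sup>-\<^sup>1C\<^sup>*f\<close>.\<close>

lemma orthogonal_projection:
  assumes V: "lin_subspace n V" and f: "f \<in> carrier_vec n"
  obtains p where "p \<in> V" "\<And>u. u \<in> V \<Longrightarrow> cinner (f - p) u = 0"
proof -
  obtain m C where C: "C \<in> carrier_mat n m" "inj_mat C" "mat_range C = V"
    using subspace_basis[OF V] by metis
  have M: "cadj C * C \<in> carrier_mat m m" by (rule mult_carrier_mat[OF cadj_carrier[OF C(1)] C(1)])
  obtain M' where M': "M' \<in> carrier_mat m m" "(cadj C * C) * M' = 1\<^sub>m m"
    using inj_mat_square_inverse[OF gram_inj[OF C(2,1)] M] by metis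
  define y where "y = M' *\<^sub>v (cadj C *\<^sub>v f)"
  have y: "y \<in> carrier_vec m" using M' f cadj_carrier[OF C(1)] by (simp add: y_def)
  have cf: "cadj C *\<^sub>v f \<in> carrier_vec m" using f cadj_carrier[OF C(1)] by simp
  have "cadj C *\<^sub>v (C *\<^sub>v y) = (cadj C * C) *\<^sub>v y"
    by (rule assoc_mult_mat_vec[OF cadj_carrier[OF C(1)] C(1) y, symmetric])
  also have "\<dots> = ((cadj C * C) * M') *\<^sub>v (cadj C *\<^sub>v f)"
    unfolding y_def by (rule assoc_mult_mat_vec[OF M M'(1) cf, symmetric])
  also have "\<dots> = cadj C *\<^sub>v f" using M' cf by simp
  finally have eq: "cadj C *\<^sub>v (C *\<^sub>v y) = cadj C *\<^sub>v f" .
  show thesis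
  proof (rule that[of "C *\<^sub>v y"])
    show "C *\<^sub>v y \<in> V" using C y mat_rangeI by blast
    fix u assume "u \<in> V"
    then obtain x where x: "x \<in> carrier_vec m" "u = C *\<^sub>v x" using C mat_rangeE by blast
    have Cy: "C *\<^sub>v y \<in> carrier_vec n" using C y by simp
    have "cinner u (f - C *\<^sub>v y) = cinner x (cadj C *\<^sub>v (f - C *\<^sub>v y))"
      unfolding x(2) by (rule cinner_adj_right[OF C(1)]) (use f Cy x in auto)
    also have "cadj C *\<^sub>v (f - C *\<^sub>v y) = 0\<^sub>v m"
      using mult_mat_vec_diff[OF cadj_carrier[OF C(1)] f Cy] eq cf by simp
    also have "cinner x (0\<^sub>v m) = 0" using x by (simp add: vcnj_zero)
    finally have "cinner u (f - C *\<^sub>v y) = 0" .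
    then show "cinner (f - C *\<^sub>v y) u = 0"
      using cinner_commute[of "f - C *\<^sub>v y" n u] f Cy C x by simp
  qed
qed

section \<open>Root multiplicities of characteristic polynomials\<close>

lemma scalar_mat_mult_vec:
  assumes "(v :: 'a :: comm_ring_1 vec) \<in> carrier_vec n"
  shows "(c \<cdot>\<^sub>m 1\<^sub>m n) *\<^sub>v v = c \<cdot>\<^sub>v v"
proof (rule eq_vecI)
  fix i assume "i < dim_vec (c \<cdot>\<^sub>v v)"
  then have i: "i < n" using assms by simp
  then have "row (c \<cdot>\<^sub>m 1\<^sub>m n) i = c \<cdot>\<^sub>v unit_vec n i" by (intro eq_vecI) auto
  then show "((c \<cdot>\<^sub>m 1\<^sub>m n) *\<^sub>v v) $ i = (c \<cdot>\<^sub>v v) $ i"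
    using i assms by (simp add: scalar_prod_left_unit)
qed (use assms in auto)

lemma char_poly_scalar_mat:
  "char_poly (c \<cdot>\<^sub>m 1\<^sub>m k :: 'a :: comm_ring_1 mat) = [:-c, 1:] ^ k"
proof -
  have "char_poly (c \<cdot>\<^sub>m 1\<^sub>m k) = (\<Prod>a\<leftarrow>diag_mat (c \<cdot>\<^sub>m 1\<^sub>m k). [:- a, 1:])"
    by (rule char_poly_upper_triangular[of _ k]) (auto simp: upper_triangular_def)
  also have "diag_mat (c \<cdot>\<^sub>m 1\<^sub>m k) = replicate k c"
    by (auto simp: diag_mat_def intro!: nth_equalityI)
  finally show ?thesis by (simp add: prod_list_replicate)
qed

lemma char_matrix_mult_vec:
  assumes "A \<in> carrier_mat n n" "v \<in> carrier_vec n"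
  shows "char_matrix A \<mu> *\<^sub>v v = A *\<^sub>v v - \<mu> \<cdot>\<^sub>v v"
proof -
  have "char_matrix A \<mu> *\<^sub>v v = A *\<^sub>v v + ((-\<mu>) \<cdot>\<^sub>m 1\<^sub>m n) *\<^sub>v v"
    unfolding char_matrix_def using assms by (subst add_mult_distrib_mat_vec[of _ n n]) auto
  also have "((-\<mu>) \<cdot>\<^sub>m 1\<^sub>m n) *\<^sub>v v = (-\<mu>) \<cdot>\<^sub>v v" using assms(2) by (rule scalar_mat_mult_vec)
  also have "A *\<^sub>v v + (-\<mu>) \<cdot>\<^sub>v v = A *\<^sub>v v - \<mu> \<cdot>\<^sub>v v" using assms by (intro eq_vecI) auto
  finally show ?thesis .
qed

lemma vec_diff_eq_0_iff:
  assumes "(u :: 'a :: ab_group_add vec) \<in> carrier_vec n" "v \<in> carrier_vec n"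
  shows "u - v = 0\<^sub>v n \<longleftrightarrow> u = v"
  using assms by (auto simp: vec_eq_iff)

lemma vec_add_eq_imp_diff_eq:
  assumes "u \<in> carrier_vec n" "v \<in> carrier_vec n" "x \<in> carrier_vec n" "y \<in> carrier_vec n"
    and "u + v = x + (y :: 'a :: ab_group_add vec)"
  shows "u - x = y - v"
proof (rule eq_vecI)
  fix i assume i: "i < dim_vec (y - v)"
  have "(u + v) $ i = (x + y) $ i" using assms(5) by simp
  then show "(u - x) $ i = (y - v) $ i" using assms(1-4) i by (simp add: algebra_simps)
qed (use assms in auto)

text \<open>If \<open>(A - \<mu>)\<^sup>2v = 0\<close> implies \<open>(A - \<mu>)v = 0\<close>, the algebraic multiplicity of \<open>\<mu>\<close> is the dimension of
  the eigenspace. In a basis that extends a basis of the eigenspace, \<open>A\<close> is block upper triangular with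
  first diagonal block \<open>\<mu>\<close>. The other diagonal block does not have the eigenvalue \<open>\<mu>\<close>, since an
  eigenvector of it would give a vector \<open>w\<close> outside the eigenspace with \<open>(A - \<mu>)w\<close> in the eigenspace.\<close>

lemma semisimple_order_eigenspace:
  fixes A :: "complex mat"
  assumes A: "A \<in> carrier_mat n n"
    and ss: "\<And>v. v \<in> carrier_vec n \<Longrightarrow> char_matrix A \<mu> *\<^sub>v (char_matrix A \<mu> *\<^sub>v v) = 0\<^sub>v n \<Longrightarrow>
      char_matrix A \<mu> *\<^sub>v v = 0\<^sub>v n"
  obtains C where "C \<in> carrier_mat n (order \<mu> (char_poly A))" "inj_mat C"
    "mat_range C = {v \<in> carrier_vec n. A *\<^sub>v v = \<mu> \<cdot>\<^sub>v v}"
proof -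
  define V where "V = {v \<in> carrier_vec n. A *\<^sub>v v = \<mu> \<cdot>\<^sub>v v}"
  define B where "B = char_matrix A \<mu>"
  have B: "B \<in> carrier_mat n n" using A by (simp add: B_def)
  have Bv: "B *\<^sub>v v = A *\<^sub>v v - \<mu> \<cdot>\<^sub>v v" if "v \<in> carrier_vec n" for v
    using char_matrix_mult_vec[OF A that] by (simp add: B_def)
  have VB: "v \<in> V \<longleftrightarrow> v \<in> carrier_vec n \<and> B *\<^sub>v v = 0\<^sub>v n" for v
  proof (cases "v \<in> carrier_vec n")
    case True
    then have "B *\<^sub>v v = 0\<^sub>v n \<longleftrightarrow> A *\<^sub>v v = \<mu> \<cdot>\<^sub>v v"
      unfolding Bv[OF True] by (intro vec_diff_eq_0_iff mult_mat_vec_carrier[OF A]) auto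
    then show ?thesis using True by (simp add: V_def)
  qed (simp add: V_def)
  have V: "lin_subspace n V" unfolding V_def by (rule lin_subspace_eigenvectors[OF A])
  obtain k C where C: "C \<in> carrier_mat n k" "inj_mat C" "mat_range C = V"
    using subspace_basis[OF V] by metis
  have full: "lin_subspace n (carrier_vec n :: complex vec set)" by (auto simp: lin_subspace_def)
  have "mat_range C \<subseteq> carrier_vec n" using C V by (auto simp: lin_subspace_def)
  then obtain m D where D: "k \<le> m" "D \<in> carrier_mat n m" "inj_mat D" "mat_range D = carrier_vec n"
    "\<forall>i<n. \<forall>j<k. D $$ (i, j) = C $$ (i, j)"
    using extend_to_basis[OF full C(2,1)] by auto
  have "m = n"
  proof (rule antisym)
    show "m \<le> n" using inj_mat_dim_le D by blast
    show "n \<le> m" by (rule surj_mat_dim_le[OF D(2,4)])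
  qed
  then obtain l where n: "n = k + l" using D(1) le_Suc_ex by blast
  have D2: "D \<in> carrier_mat n n" using D \<open>m = n\<close> by simp
  obtain D' where D': "D' \<in> carrier_mat n n" "D * D' = 1\<^sub>m n" "D' * D = 1\<^sub>m n"
    using inj_mat_square_inverse[OF D(3) D2] by metis
  define M where "M = D' * A * D"
  have M: "M \<in> carrier_mat n n" using D' A D2 by (simp add: M_def)
  have DM: "D *\<^sub>v (M *\<^sub>v v) = A *\<^sub>v (D *\<^sub>v v)" if v: "v \<in> carrier_vec n" for v
  proof -
    have "D *\<^sub>v (M *\<^sub>v v) = D *\<^sub>v (D' *\<^sub>v (A *\<^sub>v (D *\<^sub>v v)))"
      unfolding M_def using v D2 A D' by (simp add: assoc_mult_mat_vec[of _ n n _ n])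
    also have "\<dots> = (D * D') *\<^sub>v (A *\<^sub>v (D *\<^sub>v v))"
      by (rule assoc_mult_mat_vec[OF D2 D'(1), symmetric]) (use v D2 A in auto)
    also have "\<dots> = A *\<^sub>v (D *\<^sub>v v)" unfolding D'(2) using v D2 A by simp
    finally show ?thesis .
  qed
  have sim: "similar_mat A M"
  proof (rule similar_matI[of A M D D'])
    have "D * M * D' = (D * D') * A * (D * D')"
      unfolding M_def using D2 A D'(1) by (simp add: assoc_mult_mat[of _ n n _ n _ n])
    also have "\<dots> = A" unfolding D'(2) using A by simp
    finally show "A = D * M * D'" by (rule sym)
  qed (use A M D2 D' in auto)
  have DC: "D *\<^sub>v (y @\<^sub>v 0\<^sub>v l) = C *\<^sub>v y" if y: "y \<in> carrier_vec k" for y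
  proof (rule eq_vecI)
    fix i assume "i < dim_vec (C *\<^sub>v y)"
    then have i: "i < n" using C by simp
    have "(D *\<^sub>v (y @\<^sub>v 0\<^sub>v l)) $ i = (\<Sum>j\<in>{0..<k+l}. D $$ (i, j) * (if j < k then y $ j else 0))"
      using i D2 y n by (auto simp: scalar_prod_def intro!: sum.cong)
    also have "\<dots> = (\<Sum>j\<in>{0..<k}. D $$ (i, j) * (if j < k then y $ j else 0))"
      by (rule sum.mono_neutral_right) auto
    also have "\<dots> = (\<Sum>j\<in>{0..<k}. C $$ (i, j) * y $ j)"
      using D(5) i by (intro sum.cong) auto
    also have "\<dots> = (C *\<^sub>v y) $ i" using i C y by (auto simp: scalar_prod_def)
    finally show "(D *\<^sub>v (y @\<^sub>v 0\<^sub>v l)) $ i = (C *\<^sub>v y) $ i" .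
  qed (use C D2 in auto)
  have Mker: "M *\<^sub>v (y @\<^sub>v 0\<^sub>v l) = \<mu> \<cdot>\<^sub>v (y @\<^sub>v 0\<^sub>v l)" if y: "y \<in> carrier_vec k" for y
  proof (rule inj_mat_eqD[OF D(3) D2])
    have y0: "y @\<^sub>v 0\<^sub>v l \<in> carrier_vec n" using y n by auto
    have "C *\<^sub>v y \<in> V" using C y mat_rangeI by blast
    then have "A *\<^sub>v (C *\<^sub>v y) = \<mu> \<cdot>\<^sub>v (C *\<^sub>v y)" by (simp add: V_def)
    then show "D *\<^sub>v (M *\<^sub>v (y @\<^sub>v 0\<^sub>v l)) = D *\<^sub>v (\<mu> \<cdot>\<^sub>v (y @\<^sub>v 0\<^sub>v l))"
      using DM[OF y0] DC[OF y] mult_mat_vec[OF D2 y0] by simp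
  qed (use y n M in auto)
  obtain M1 M2 M3 M4 where split: "split_block M k k = (M1, M2, M3, M4)" by (cases "split_block M k k")
  note Ms = split_block[OF split, of l l]
  have Mc: "M1 \<in> carrier_mat k k" "M2 \<in> carrier_mat k l" "M3 \<in> carrier_mat l k" "M4 \<in> carrier_mat l l"
    and M4b: "M = four_block_mat M1 M2 M3 M4" using Ms M n by auto
  have Mact: "M *\<^sub>v (y @\<^sub>v z) = (M1 *\<^sub>v y + M2 *\<^sub>v z) @\<^sub>v (M3 *\<^sub>v y + M4 *\<^sub>v z)"
    if "y \<in> carrier_vec k" "z \<in> carrier_vec l" for y z
    unfolding M4b by (rule four_block_mat_mult_vec[OF Mc that])
  have M13: "M1 *\<^sub>v y = \<mu> \<cdot>\<^sub>v y \<and> M3 *\<^sub>v y = 0\<^sub>v l" if y: "y \<in> carrier_vec k" for y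
  proof -
    have z: "M2 *\<^sub>v 0\<^sub>v l = 0\<^sub>v k" "M4 *\<^sub>v 0\<^sub>v l = 0\<^sub>v l" using Mc by auto
    have "M *\<^sub>v (y @\<^sub>v 0\<^sub>v l) = (M1 *\<^sub>v y) @\<^sub>v (M3 *\<^sub>v y)"
      using Mact[OF y, of "0\<^sub>v l"] z Mc y by simp
    moreover have "\<mu> \<cdot>\<^sub>v (y @\<^sub>v 0\<^sub>v l) = (\<mu> \<cdot>\<^sub>v y) @\<^sub>v 0\<^sub>v l"
      using y by (intro eq_vecI) auto
    ultimately have "(M1 *\<^sub>v y) @\<^sub>v (M3 *\<^sub>v y) = (\<mu> \<cdot>\<^sub>v y) @\<^sub>v 0\<^sub>v l" using Mker[OF y] by simp
    then show ?thesis using append_vec_eq[of "M1 *\<^sub>v y" k "\<mu> \<cdot>\<^sub>v y"] Mc y by simp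
  qed
  have M1: "M1 = \<mu> \<cdot>\<^sub>m 1\<^sub>m k"
    by (rule mat_eq_by_action[OF Mc(1)]) (use M13 scalar_mat_mult_vec in auto)
  have M3: "M3 = 0\<^sub>m l k"
    by (rule mat_eq_by_action[OF Mc(3)]) (use M13 in auto)
  obtain es where es: "char_poly M4 = (\<Prod>a\<leftarrow>es. [:- a, 1:])"
    using char_poly_factorized[OF Mc(4)] by auto
  \<comment> \<open>It remains to see that \<open>\<mu>\<close> is not a root of the characteristic polynomial of \<open>M4\<close>.\<close>
  have cp1: "char_poly M1 = [:-\<mu>, 1:] ^ k" unfolding M1 by (rule char_poly_scalar_mat)
  have "char_poly M = char_poly M1 * char_poly M4"
  proof (rule char_poly_0_block[OF M4b[unfolded M3]])
    show "\<exists>es. char_poly M1 = (\<Prod>a\<leftarrow>es. [:- a, 1:])"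
      by (rule exI[of _ "replicate k \<mu>"]) (simp add: cp1 prod_list_replicate)
    show "\<exists>es. char_poly M4 = (\<Prod>a\<leftarrow>es. [:- a, 1:])" using es by blast
  qed (use Mc in auto)
  then have cp: "char_poly A = [:-\<mu>, 1:] ^ k * char_poly M4"
    using char_poly_similar[OF sim] cp1 by simp
  have "poly (char_poly M4) \<mu> \<noteq> 0"
  proof
    assume "poly (char_poly M4) \<mu> = 0"
    then have "eigenvalue M4 \<mu>" using eigenvalue_root_char_poly[OF Mc(4)] by simp
    then obtain u where u: "u \<in> carrier_vec l" "u \<noteq> 0\<^sub>v l" "M4 *\<^sub>v u = \<mu> \<cdot>\<^sub>v u"
      using Mc by (auto simp: eigenvalue_def eigenvector_def)
    define w where "w = D *\<^sub>v (0\<^sub>v k @\<^sub>v u)"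
    have u0: "0\<^sub>v k @\<^sub>v u \<in> carrier_vec n" using u n by auto
    have w: "w \<in> carrier_vec n" using D2 u0 by (simp add: w_def)
    have M2u: "M2 *\<^sub>v u \<in> carrier_vec k" using Mc u by simp
    have "M *\<^sub>v (0\<^sub>v k @\<^sub>v u) = (M2 *\<^sub>v u) @\<^sub>v (\<mu> \<cdot>\<^sub>v u)"
    proof -
      have "M1 *\<^sub>v 0\<^sub>v k = 0\<^sub>v k" "M3 *\<^sub>v 0\<^sub>v k = 0\<^sub>v l" using Mc by auto
      then show ?thesis using Mact[of "0\<^sub>v k" u] u M2u by simp
    qed
    also have "\<dots> = \<mu> \<cdot>\<^sub>v (0\<^sub>v k @\<^sub>v u) + (M2 *\<^sub>v u @\<^sub>v 0\<^sub>v l)"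
      using u(1) Mc(2) by (intro eq_vecI) auto
    finally have Mu: "M *\<^sub>v (0\<^sub>v k @\<^sub>v u) = \<mu> \<cdot>\<^sub>v (0\<^sub>v k @\<^sub>v u) + (M2 *\<^sub>v u @\<^sub>v 0\<^sub>v l)" .
    have M2u0: "M2 *\<^sub>v u @\<^sub>v 0\<^sub>v l \<in> carrier_vec n" using M2u n by auto
    have "A *\<^sub>v w = D *\<^sub>v (\<mu> \<cdot>\<^sub>v (0\<^sub>v k @\<^sub>v u) + (M2 *\<^sub>v u @\<^sub>v 0\<^sub>v l))"
      using DM[OF u0] Mu by (simp add: w_def)
    also have "\<dots> = \<mu> \<cdot>\<^sub>v w + C *\<^sub>v (M2 *\<^sub>v u)"
      using DC[OF M2u] mult_add_distrib_mat_vec[OF D2 _ M2u0, of "\<mu> \<cdot>\<^sub>v (0\<^sub>v k @\<^sub>v u)"]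
        mult_mat_vec[OF D2 u0] u0 by (simp add: w_def)
    finally have "B *\<^sub>v w = \<mu> \<cdot>\<^sub>v w + C *\<^sub>v (M2 *\<^sub>v u) - \<mu> \<cdot>\<^sub>v w" using Bv[OF w] by simp
    also have "\<dots> = C *\<^sub>v (M2 *\<^sub>v u)" using w C by (intro eq_vecI) auto
    finally have Bw: "B *\<^sub>v w = C *\<^sub>v (M2 *\<^sub>v u)" .
    have "C *\<^sub>v (M2 *\<^sub>v u) \<in> V" using C M2u mat_rangeI by blast
    then have "B *\<^sub>v (B *\<^sub>v w) = 0\<^sub>v n" using Bw VB by simp
    then have "B *\<^sub>v w = 0\<^sub>v n" using ss[OF w] by (simp add: B_def)
    then have "w \<in> mat_range C" using VB w C by simp
    then obtain y where y: "y \<in> carrier_vec k" "w = C *\<^sub>v y" using C mat_rangeE by blast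
    have "0\<^sub>v k @\<^sub>v u = y @\<^sub>v 0\<^sub>v l"
      by (rule inj_mat_eqD[OF D(3) D2 u0]) (use y n DC[OF y(1)] in \<open>auto simp: w_def\<close>)
    then show False using append_vec_eq[of "0\<^sub>v k" k y] y u by simp
  qed
  then have z: "order \<mu> (char_poly M4) = 0" by (rule order_0I)
  have "char_poly A \<noteq> 0" using degree_monic_char_poly[OF A] by auto
  then have "order \<mu> (char_poly A) = order \<mu> ([:-\<mu>, 1:] ^ k) + order \<mu> (char_poly M4)"
    unfolding cp by (rule order_mult)
  also have "\<dots> = k" unfolding z order_power_n_n by simp
  finally have "order \<mu> (char_poly A) = k" .
  then show thesis using that C V_def by auto
qed

lemma root_imp_degree_nonzero:
  assumes "p \<noteq> 0" "poly p z = 0" shows "degree p \<noteq> 0"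
proof
  assume "degree p = 0"
  then obtain a where "p = [:a:]" using degree_eq_zeroE by blast
  then show False using assms by simp
qed

lemma resultant_eq_0_iff_common_root:
  fixes p q :: "complex poly"
  assumes "p \<noteq> 0"
  shows "resultant p q = 0 \<longleftrightarrow> (\<exists>z. poly p z = 0 \<and> poly q z = 0)"
proof -
  have "degree (gcd p q) \<noteq> 0 \<longleftrightarrow> (\<exists>z. poly (gcd p q) z = 0)"
  proof
    assume "degree (gcd p q) \<noteq> 0"
    then show "\<exists>z. poly (gcd p q) z = 0"
      using fundamental_theorem_of_algebra[of "gcd p q"] constant_degree by metis
  next
    assume "\<exists>z. poly (gcd p q) z = 0"
    moreover have "gcd p q \<noteq> 0" using assms by simp
    ultimately show "degree (gcd p q) \<noteq> 0"
      using root_imp_degree_nonzero by blast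
  qed
  also have "\<dots> \<longleftrightarrow> (\<exists>z. poly p z = 0 \<and> poly q z = 0)"
    by (simp add: poly_eq_0_iff_dvd)
  finally show ?thesis by (simp add: resultant_0_gcd)
qed

lemma order_ge_1_iff: "p \<noteq> 0 \<Longrightarrow> poly p z = 0 \<longleftrightarrow> order z p \<ge> 1"
  by (auto simp: order_root)

lemma root_imp_pderiv_nonzero:
  fixes p :: "complex poly"
  assumes "p \<noteq> 0" "poly p z = 0" shows "pderiv p \<noteq> 0"
  using root_imp_degree_nonzero[OF assms] by (simp add: pderiv_eq_0_iff)

lemma order_ge_2_iff:
  fixes p :: "complex poly"
  assumes "p \<noteq> 0" shows "poly p z = 0 \<and> poly (pderiv p) z = 0 \<longleftrightarrow> order z p \<ge> 2"
proof (cases "poly p z = 0")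
  case True
  have "pderiv p \<noteq> 0" using root_imp_pderiv_nonzero[OF assms True] .
  then show ?thesis using True order_pderiv[OF assms True] order_root[of "pderiv p" z] by auto
next
  case False
  then show ?thesis using order_root[of p z] by auto
qed

text \<open>In the quaternionic case simple roots do not occur, and then the second derivative tells double
  roots from roots of higher multiplicity.\<close>

lemma order_not_1_second_deriv:
  fixes p :: "complex poly"
  assumes p: "p \<noteq> 0" and z: "poly p z = 0" and no1: "order z p \<noteq> 1"
  shows "poly (pderiv (pderiv p)) z = 0 \<longleftrightarrow> order z p \<ge> 3"
proof -
  have "order z p \<ge> 2" using z no1 p order_root[of p z] by auto
  then have "poly (pderiv p) z = 0" using order_ge_2_iff[OF p, of z] by simp
  moreover have "pderiv p \<noteq> 0" using root_imp_pderiv_nonzero[OF p z] .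
  ultimately show ?thesis using order_ge_2_iff[of "pderiv p" z] order_pderiv[OF p z] by auto
qed

section \<open>Intertwiners and Schur's lemma\<close>

definition intertwiner ::
  "('g, 'b) monoid_scheme \<Rightarrow> nat \<Rightarrow> ('g \<Rightarrow> complex mat) \<Rightarrow> nat \<Rightarrow> ('g \<Rightarrow> complex mat) \<Rightarrow> complex mat \<Rightarrow> bool"
  where "intertwiner G n \<rho> m \<sigma> A \<longleftrightarrow> A \<in> carrier_mat m n \<and>
    (\<forall>g\<in>carrier G. \<rho> g \<in> carrier_mat n n \<and> \<sigma> g \<in> carrier_mat m m \<and> A * \<rho> g = \<sigma> g * A)"

definition invariant_set :: "('g, 'b) monoid_scheme \<Rightarrow> ('g \<Rightarrow> complex mat) \<Rightarrow> complex vec set \<Rightarrow> bool"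
  where "invariant_set G \<rho> V \<longleftrightarrow> (\<forall>g\<in>carrier G. \<forall>v\<in>V. \<rho> g *\<^sub>v v \<in> V)"

lemma irreducible_rep_iff:
  "irreducible_rep G n \<rho> \<longleftrightarrow> matrix_rep G n \<rho> \<and> 0 < n \<and>
    (\<forall>V. lin_subspace n V \<and> invariant_set G \<rho> V \<longrightarrow> V = {0\<^sub>v n} \<or> V = carrier_vec n)"
proof -
  have sr: "subrep G (module_vec TYPE(complex) n) (\<lambda>g v. \<rho> g *\<^sub>v v) U \<longleftrightarrow>
    lin_subspace n U \<and> invariant_set G \<rho> U" for U
    by (simp add: subrep_def lin_subspace_iff_subspace invariant_set_def)
  have z: "\<zero>\<^bsub>module_vec TYPE(complex) n\<^esub> = 0\<^sub>v n" by (simp add: module_vec_simps)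
  have full: "lin_subspace n (carrier_vec n :: complex vec set)" by (auto simp: lin_subspace_def)
  have ne: "(carrier_vec n :: complex vec set) \<noteq> {0\<^sub>v n} \<longleftrightarrow> 0 < n"
  proof
    assume "(carrier_vec n :: complex vec set) \<noteq> {0\<^sub>v n}"
    moreover have "v = 0\<^sub>v n" if "v \<in> carrier_vec n" "n = 0" for v :: "complex vec"
      using that by (intro eq_vecI) auto
    ultimately show "0 < n" by (cases "n = 0") auto
  next
    assume "0 < n"
    then have "unit_vec n 0 $ 0 \<noteq> (0\<^sub>v n :: complex vec) $ 0" by simp
    then have "unit_vec n 0 \<noteq> (0\<^sub>v n :: complex vec)" by metis
    then show "(carrier_vec n :: complex vec set) \<noteq> {0\<^sub>v n}" using unit_vec_carrier by blast
  qed
  have inv: "matrix_rep G n \<rho> \<Longrightarrow> invariant_set G \<rho> (carrier_vec n)"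
    unfolding matrix_rep_def invariant_set_def by (metis mult_mat_vec_carrier)
  show ?thesis
    unfolding irreducible_rep_def irreducible_subrep_def sr z using ne full inv
    by (auto dest: lin_subspaceD(1))
qed

lemma irreducible_repD:
  assumes "irreducible_rep G n \<rho>"
  shows "matrix_rep G n \<rho>" "0 < n"
    "lin_subspace n V \<Longrightarrow> invariant_set G \<rho> V \<Longrightarrow> V = {0\<^sub>v n} \<or> V = carrier_vec n"
    "g \<in> carrier G \<Longrightarrow> \<rho> g \<in> carrier_mat n n"
  using assms unfolding irreducible_rep_iff by (auto simp: matrix_rep_def)

lemma intertwinerD:
  assumes "intertwiner G n \<rho> m \<sigma> A"
  shows "A \<in> carrier_mat m n" "g \<in> carrier G \<Longrightarrow> \<rho> g \<in> carrier_mat n n"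
    "g \<in> carrier G \<Longrightarrow> \<sigma> g \<in> carrier_mat m m" "g \<in> carrier G \<Longrightarrow> A * \<rho> g = \<sigma> g * A"
  using assms by (auto simp: intertwiner_def)

lemma intertwiner_act:
  assumes "intertwiner G n \<rho> m \<sigma> A" "g \<in> carrier G" "v \<in> carrier_vec n"
  shows "A *\<^sub>v (\<rho> g *\<^sub>v v) = \<sigma> g *\<^sub>v (A *\<^sub>v v)"
  using intertwinerD[OF assms(1)] assms(2,3) by (metis assoc_mult_mat_vec)

lemma intertwinerI:
  assumes A: "A \<in> carrier_mat m n"
    and d: "\<And>g. g \<in> carrier G \<Longrightarrow> \<rho> g \<in> carrier_mat n n" "\<And>g. g \<in> carrier G \<Longrightarrow> \<sigma> g \<in> carrier_mat m m"
    and eq: "\<And>g v. g \<in> carrier G \<Longrightarrow> v \<in> carrier_vec n \<Longrightarrow> A *\<^sub>v (\<rho> g *\<^sub>v v) = \<sigma> g *\<^sub>v (A *\<^sub>v v)"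
  shows "intertwiner G n \<rho> m \<sigma> A"
  unfolding intertwiner_def
proof (intro conjI ballI A d)
  fix g assume g: "g \<in> carrier G"
  note d = d[OF g]
  show "A * \<rho> g = \<sigma> g * A"
  proof (rule mat_eq_by_action[of _ m n])
    fix v :: "complex vec" assume v: "v \<in> carrier_vec n"
    show "A * \<rho> g *\<^sub>v v = \<sigma> g * A *\<^sub>v v"
      unfolding assoc_mult_mat_vec[OF A d(1) v] assoc_mult_mat_vec[OF d(2) A v] by (rule eq[OF g v])
  qed (use A d in auto)
qed

lemma intertwiner_mult:
  assumes A: "intertwiner G n \<rho> m \<sigma> A" and B: "intertwiner G m \<sigma> k \<tau> B"
  shows "intertwiner G n \<rho> k \<tau> (B * A)"
proof (rule intertwinerI)
  note a = intertwinerD[OF A] and b = intertwinerD[OF B]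
  show "B * A \<in> carrier_mat k n" using a b by auto
  fix g assume g: "g \<in> carrier G"
  show "\<rho> g \<in> carrier_mat n n" "\<tau> g \<in> carrier_mat k k" using a(2)[OF g] b(3)[OF g] by auto
  fix v :: "complex vec" assume v: "v \<in> carrier_vec n"
  have Av: "A *\<^sub>v v \<in> carrier_vec m" and rv: "\<rho> g *\<^sub>v v \<in> carrier_vec n"
    using mult_mat_vec_carrier[OF a(1) v] mult_mat_vec_carrier[OF a(2)[OF g] v] by auto
  show "B * A *\<^sub>v (\<rho> g *\<^sub>v v) = \<tau> g *\<^sub>v (B * A *\<^sub>v v)"
    unfolding assoc_mult_mat_vec[OF b(1) a(1) v] assoc_mult_mat_vec[OF b(1) a(1) rv]
      intertwiner_act[OF A g v] by (rule intertwiner_act[OF B g Av])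
qed

lemma intertwiner_add:
  assumes A: "intertwiner G n \<rho> m \<sigma> A" and B: "intertwiner G n \<rho> m \<sigma> B"
  shows "intertwiner G n \<rho> m \<sigma> (A + B)"
  unfolding intertwiner_def
proof (intro conjI ballI)
  note a = intertwinerD[OF A] and b = intertwinerD[OF B]
  show "A + B \<in> carrier_mat m n" using a b by auto
  fix g assume g: "g \<in> carrier G"
  show "\<rho> g \<in> carrier_mat n n" "\<sigma> g \<in> carrier_mat m m" using a g by auto
  show "(A + B) * \<rho> g = \<sigma> g * (A + B)"
    unfolding add_mult_distrib_mat[OF a(1) b(1) a(2)[OF g]] mult_add_distrib_mat[OF a(3)[OF g] a(1) b(1)]
    using a(4) b(4) g by simp
qed

lemma intertwiner_smult:
  assumes A: "intertwiner G n \<rho> m \<sigma> A"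
  shows "intertwiner G n \<rho> m \<sigma> (c \<cdot>\<^sub>m A)"
  unfolding intertwiner_def
proof (intro conjI ballI)
  note a = intertwinerD[OF A]
  show "c \<cdot>\<^sub>m A \<in> carrier_mat m n" using a by auto
  fix g assume g: "g \<in> carrier G"
  show "\<rho> g \<in> carrier_mat n n" "\<sigma> g \<in> carrier_mat m m" using a g by auto
  show "c \<cdot>\<^sub>m A * \<rho> g = \<sigma> g * (c \<cdot>\<^sub>m A)"
    using mult_smult_assoc_mat[OF a(1) a(2)[OF g]] mult_smult_distrib[OF a(3)[OF g] a(1)] a(4)[OF g] by simp
qed

lemma intertwiner_one:
  assumes "matrix_rep G n \<rho>" shows "intertwiner G n \<rho> n \<rho> (1\<^sub>m n)"
  using assms by (auto simp: intertwiner_def matrix_rep_def)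

lemma inj_mat_of_inverse:
  assumes "A \<in> carrier_mat n n" "invertible_mat A" shows "inj_mat A"
proof -
  obtain B where B: "A * B = 1\<^sub>m n" "B * A = 1\<^sub>m (dim_row B)"
    using assms by (auto simp: invertible_mat_def inverts_mat_def)
  have "dim_row B = n" using B assms
    by (metis carrier_matD(2) index_mult_mat(3) index_one_mat(3))
  moreover have "dim_col B = n" using B(1) by (metis index_mult_mat(3) index_one_mat(3))
  ultimately show ?thesis using B assms inverse_imp_inj_mat[of A n n B] by auto
qed

lemma invertible_mat_inj:
  assumes "A \<in> carrier_mat n n" "inj_mat A" shows "invertible_mat A"
proof -
  obtain B where "B \<in> carrier_mat n n" "A * B = 1\<^sub>m n" "B * A = 1\<^sub>m n"
    using inj_mat_square_inverse[OF assms(2,1)] by metis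
  then show ?thesis using assms by (auto simp: invertible_mat_def inverts_mat_def)
qed

lemma intertwiner_inverse:
  assumes A: "intertwiner G n \<rho> n \<sigma> A" and inv: "B \<in> carrier_mat n n" "A * B = 1\<^sub>m n" "B * A = 1\<^sub>m n"
  shows "intertwiner G n \<sigma> n \<rho> B"
proof (rule intertwinerI)
  note a = intertwinerD[OF A]
  fix g v assume g: "g \<in> carrier G" and v: "(v :: complex vec) \<in> carrier_vec n"
  have Bv: "B *\<^sub>v v \<in> carrier_vec n" using inv v by simp
  have AB: "A *\<^sub>v (B *\<^sub>v u) = u" if "u \<in> carrier_vec n" for u
    using assoc_mult_mat_vec[OF a(1) inv(1) that] inv that by simp
  have sv: "\<sigma> g *\<^sub>v v \<in> carrier_vec n" using mult_mat_vec_carrier[OF a(3)[OF g] v] .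
  show "B *\<^sub>v (\<sigma> g *\<^sub>v v) = \<rho> g *\<^sub>v (B *\<^sub>v v)"
  proof (rule inj_mat_eqD[OF inverse_imp_inj_mat[OF a(1) inv(1,3)] a(1)])
    show "A *\<^sub>v (B *\<^sub>v (\<sigma> g *\<^sub>v v)) = A *\<^sub>v (\<rho> g *\<^sub>v (B *\<^sub>v v))"
      using AB[OF sv] AB[OF v] intertwiner_act[OF A g Bv] by simp
  qed (use mult_mat_vec_carrier[OF inv(1) sv] mult_mat_vec_carrier[OF a(2)[OF g] Bv] in auto)
qed (use inv intertwinerD[OF A] in auto)

lemma mat_nonzero_action:
  assumes "A \<in> carrier_mat m n" "A \<noteq> 0\<^sub>m m n"
  obtains v :: "'a :: field vec" where "v \<in> carrier_vec n" "A *\<^sub>v v \<noteq> 0\<^sub>v m"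
  using mat_eq_by_action[OF assms(1) zero_carrier_mat] assms(2) by force

text \<open>The first half of Schur's lemma: the kernel of an intertwiner is invariant. The target will
  mostly be the regular representation.\<close>

lemma schur_inj:
  assumes irr: "irreducible_rep G n \<rho>" and A: "intertwiner G n \<rho> m \<sigma> A" and nz: "A \<noteq> 0\<^sub>m m n"
  shows "inj_mat A"
proof -
  note a = intertwinerD[OF A]
  define V where "V = {v \<in> carrier_vec n. A *\<^sub>v v = 0\<^sub>v m}"
  have "lin_subspace n V" unfolding V_def by (rule lin_subspace_kernel[OF a(1)])
  moreover have "invariant_set G \<rho> V"
    unfolding invariant_set_def V_def
  proof (intro ballI CollectI conjI)
    fix g v assume g: "g \<in> carrier G" and "v \<in> {v \<in> carrier_vec n. A *\<^sub>v v = 0\<^sub>v m}"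
    then have v: "v \<in> carrier_vec n" "A *\<^sub>v v = 0\<^sub>v m" by auto
    show "\<rho> g *\<^sub>v v \<in> carrier_vec n" using mult_mat_vec_carrier[OF a(2)[OF g] v(1)] .
    show "A *\<^sub>v (\<rho> g *\<^sub>v v) = 0\<^sub>v m"
      using intertwiner_act[OF A g v(1)] v(2) a(3)[OF g] by (auto intro!: eq_vecI)
  qed
  ultimately have "V = {0\<^sub>v n} \<or> V = carrier_vec n" using irreducible_repD(3)[OF irr] by blast
  moreover have "V \<noteq> carrier_vec n" using mat_nonzero_action[OF a(1) nz] by (auto simp: V_def)
  ultimately have "V = {0\<^sub>v n}" by simp
  then show ?thesis unfolding inj_mat_def V_def using a(1) by auto
qed

text \<open>The second half: the range of an intertwiner is invariant.\<close>

lemma schur_surj: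
  assumes irr: "irreducible_rep G m \<sigma>" and A: "intertwiner G n \<rho> m \<sigma> A" and nz: "A \<noteq> 0\<^sub>m m n"
  shows "mat_range A = carrier_vec m"
proof -
  note a = intertwinerD[OF A]
  have "invariant_set G \<sigma> (mat_range A)"
    unfolding invariant_set_def
  proof (intro ballI)
    fix g v assume g: "g \<in> carrier G" and "v \<in> mat_range A"
    then obtain u where u: "u \<in> carrier_vec n" "v = A *\<^sub>v u" using mat_rangeE a(1) by blast
    have "\<sigma> g *\<^sub>v v = A *\<^sub>v (\<rho> g *\<^sub>v u)" using intertwiner_act[OF A g u(1)] u by simp
    then show "\<sigma> g *\<^sub>v v \<in> mat_range A"
      using mat_rangeI[OF a(1) mult_mat_vec_carrier[OF a(2)[OF g] u(1)]] by simp
  qed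
  then have "mat_range A = {0\<^sub>v m} \<or> mat_range A = carrier_vec m"
    using irreducible_repD(3)[OF irr] lin_subspace_mat_range[OF a(1)] by blast
  moreover have "mat_range A \<noteq> {0\<^sub>v m}"
    using mat_nonzero_action[OF a(1) nz] mat_rangeI[OF a(1)] by blast
  ultimately show ?thesis by simp
qed

lemma schur_iso:
  assumes irr: "irreducible_rep G n \<rho>" "irreducible_rep G m \<sigma>"
    and A: "intertwiner G n \<rho> m \<sigma> A" and nz: "A \<noteq> 0\<^sub>m m n"
  shows "n = m" "invertible_mat A" "isomorphic_reps G n \<rho> m \<sigma>"
proof -
  note a = intertwinerD[OF A]
  have inj: "inj_mat A" by (rule schur_inj[OF irr(1) A nz])
  show nm: "n = m"
    using inj_mat_dim_le[OF inj a(1)] surj_mat_dim_le[OF a(1) schur_surj[OF irr(2) A nz]] by simp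
  show inv: "invertible_mat A" using invertible_mat_inj inj a(1) nm by blast
  show "isomorphic_reps G n \<rho> m \<sigma>" unfolding isomorphic_reps_def using inv a by blast
qed

text \<open>For an eigenvalue \<open>c\<close> of \<open>A\<close>, the intertwiner \<open>A - c\<close> is not injective, hence zero.\<close>

lemma schur_scalar:
  assumes irr: "irreducible_rep G n \<rho>" and A: "intertwiner G n \<rho> n \<rho> A"
  obtains c where "A = c \<cdot>\<^sub>m 1\<^sub>m n"
proof -
  note a = intertwinerD[OF A]
  have "degree (char_poly A) = n" using degree_monic_char_poly[OF a(1)] by simp
  then have "\<not> constant (poly (char_poly A))"
    using irreducible_repD(2)[OF irr] constant_degree[of "char_poly A"] by simp
  then obtain c where "poly (char_poly A) c = 0" using fundamental_theorem_of_algebra by blast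
  then have "eigenvalue A c" using eigenvalue_root_char_poly[OF a(1)] by simp
  then obtain v where v: "v \<in> carrier_vec n" "v \<noteq> 0\<^sub>v n" "char_matrix A c *\<^sub>v v = 0\<^sub>v n"
    using eigenvector_char_matrix[OF a(1)] by (auto simp: eigenvalue_def)
  have eq: "char_matrix A c = A + (-c) \<cdot>\<^sub>m 1\<^sub>m n" using a(1) by (simp add: char_matrix_def)
  have "intertwiner G n \<rho> n \<rho> (char_matrix A c)"
    unfolding eq by (intro intertwiner_add A intertwiner_smult intertwiner_one irreducible_repD[OF irr])
  moreover have "\<not> inj_mat (char_matrix A c)"
    using v inj_matD[of "char_matrix A c" n n v] a(1) by auto
  ultimately have z: "char_matrix A c = 0\<^sub>m n n" using schur_inj[OF irr] by blast
  have "A = c \<cdot>\<^sub>m 1\<^sub>m n"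
  proof (rule eq_matI)
    fix i j assume ij: "i < dim_row (c \<cdot>\<^sub>m 1\<^sub>m n)" "j < dim_col (c \<cdot>\<^sub>m 1\<^sub>m n)"
    have "char_matrix A c $$ (i, j) = 0" using z ij by simp
    then show "A $$ (i, j) = (c \<cdot>\<^sub>m 1\<^sub>m n) $$ (i, j)" using ij a(1) by (auto simp: eq)
  qed (use a in auto)
  then show thesis by (rule that)
qed

section \<open>Conjugate representations and types\<close>

definition conj_rep :: "('g \<Rightarrow> complex mat) \<Rightarrow> 'g \<Rightarrow> complex mat" where "conj_rep \<rho> g = mcnj (\<rho> g)"

lemma conj_rep_conj_rep[simp]: "conj_rep (conj_rep \<rho>) = \<rho>" by (auto simp: conj_rep_def)

lemma intertwiner_mcnj:
  assumes A: "intertwiner G n \<rho> m \<sigma> A"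
  shows "intertwiner G n (conj_rep \<rho>) m (conj_rep \<sigma>) (mcnj A)"
  unfolding intertwiner_def conj_rep_def
proof (intro conjI ballI)
  note a = intertwinerD[OF A]
  show "mcnj A \<in> carrier_mat m n" using a by auto
  fix g assume g: "g \<in> carrier G"
  show "mcnj (\<rho> g) \<in> carrier_mat n n" "mcnj (\<sigma> g) \<in> carrier_mat m m" using a g by auto
  show "mcnj A * mcnj (\<rho> g) = mcnj (\<sigma> g) * mcnj A"
    using mcnj_mult[OF a(1) a(2)[OF g]] mcnj_mult[OF a(3)[OF g] a(1)] a(4)[OF g] by simp
qed

lemma matrix_rep_conj_rep: "matrix_rep G n \<rho> \<Longrightarrow> matrix_rep G n (conj_rep \<rho>)"
  unfolding matrix_rep_def conj_rep_def using mcnj_mult[of _ n n _ n] by (auto simp: mcnj_one)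

lemma lin_subspace_vcnj: assumes "lin_subspace n V" shows "lin_subspace n (vcnj ` V)"
  unfolding lin_subspace_def
proof (intro conjI ballI allI)
  note v = lin_subspaceD[OF assms]
  show "vcnj ` V \<subseteq> carrier_vec n" using v(1) by auto
  show "0\<^sub>v n \<in> vcnj ` V" using v(2) vcnj_zero[of n] by (metis imageI)
  fix x y assume "x \<in> vcnj ` V" "y \<in> vcnj ` V"
  then obtain a b where ab: "a \<in> V" "b \<in> V" "x = vcnj a" "y = vcnj b" by auto
  have "x + y = vcnj (a + b)" using vcnj_add[OF v(5) v(5)] ab by simp
  then show "x + y \<in> vcnj ` V" using v(3) ab by auto
next
  note v = lin_subspaceD[OF assms]
  fix c x assume "x \<in> vcnj ` V"
  then obtain a where a: "a \<in> V" "x = vcnj a" by auto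
  have "c \<cdot>\<^sub>v x = vcnj (cnj c \<cdot>\<^sub>v a)" using a by (simp add: vcnj_smult)
  then show "c \<cdot>\<^sub>v x \<in> vcnj ` V" using v(4) a by auto
qed

lemma irreducible_conj_rep:
  assumes irr: "irreducible_rep G n \<rho>" shows "irreducible_rep G n (conj_rep \<rho>)"
  unfolding irreducible_rep_iff
proof (intro conjI allI impI)
  show "matrix_rep G n (conj_rep \<rho>)" "0 < n" using irreducible_repD[OF irr] matrix_rep_conj_rep by auto
  fix V assume V: "lin_subspace n V \<and> invariant_set G (conj_rep \<rho>) V"
  have "invariant_set G \<rho> (vcnj ` V)"
    unfolding invariant_set_def
  proof (intro ballI)
    fix g v assume g: "g \<in> carrier G" and "v \<in> vcnj ` V"
    then obtain u where u: "u \<in> V" "v = vcnj u" by auto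
    have uc: "u \<in> carrier_vec n" using u V lin_subspaceD(5) by blast
    have r: "\<rho> g \<in> carrier_mat n n" using irreducible_repD(4)[OF irr g] .
    have "\<rho> g *\<^sub>v v = vcnj (mcnj (\<rho> g) *\<^sub>v u)"
      using vcnj_mult[of "mcnj (\<rho> g)" n n u] r uc u by simp
    moreover have "mcnj (\<rho> g) *\<^sub>v u \<in> V" using V u g by (auto simp: invariant_set_def conj_rep_def)
    ultimately show "\<rho> g *\<^sub>v v \<in> vcnj ` V" by simp
  qed
  then have "vcnj ` V = {0\<^sub>v n} \<or> vcnj ` V = carrier_vec n"
    using irreducible_repD(3)[OF irr lin_subspace_vcnj] V by blast
  moreover have "vcnj ` vcnj ` V = V" by (simp add: image_image)
  moreover have "vcnj ` carrier_vec n = carrier_vec n"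
  proof
    show "carrier_vec n \<subseteq> vcnj ` carrier_vec n"
    proof
      fix x :: "complex vec" assume "x \<in> carrier_vec n"
      then show "x \<in> vcnj ` carrier_vec n" by (intro image_eqI[where x="vcnj x"]) auto
    qed
  qed auto
  ultimately show "V = {0\<^sub>v n} \<or> V = carrier_vec n" using vcnj_zero[of n] by force
qed

text \<open>The structure maps that define the type of a representation are functions on vectors; this turns
  their composition with the conjugation, which is linear, into a matrix.\<close>

lemma linear_map_as_matrix:
  fixes f :: "'a :: field vec \<Rightarrow> 'a vec"
  assumes c: "\<And>v. v \<in> carrier_vec n \<Longrightarrow> f v \<in> carrier_vec m"
    and add: "\<And>u v. u \<in> carrier_vec n \<Longrightarrow> v \<in> carrier_vec n \<Longrightarrow> f (u + v) = f u + f v"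
    and smult: "\<And>a v. v \<in> carrier_vec n \<Longrightarrow> f (a \<cdot>\<^sub>v v) = a \<cdot>\<^sub>v f v"
  obtains A where "A \<in> carrier_mat m n" "\<And>v. v \<in> carrier_vec n \<Longrightarrow> f v = A *\<^sub>v v"
proof -
  define A where "A = mat m n (\<lambda>(i, j). f (unit_vec n j) $ i)"
  have A: "A \<in> carrier_mat m n" by (simp add: A_def)
  have "f v = A *\<^sub>v v" if v: "v \<in> carrier_vec n" for v
  proof -
    define p where "p k = vec n (\<lambda>i. if i < k then v $ i else 0)" for k
    have pc: "p k \<in> carrier_vec n" for k by (simp add: p_def)
    have "f (p k) = A *\<^sub>v p k" if "k \<le> n" for k
      using that
    proof (induction k)
      case 0
      have z: "0 \<cdot>\<^sub>v u = 0\<^sub>v m" if "u \<in> carrier_vec m" for u :: "'a vec"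
        using that by (intro eq_vecI) auto
      have p0: "0 \<cdot>\<^sub>v p 0 = p 0" by (intro eq_vecI) (auto simp: p_def)
      have "f (p 0) = 0\<^sub>v m" using smult[OF pc, of 0 0] z[OF c[OF pc]] p0 by simp
      moreover have "A *\<^sub>v p 0 = 0\<^sub>v m"
        using mult_mat_vec[OF A pc, of 0 0] z[OF mult_mat_vec_carrier[OF A pc]] p0 by simp
      ultimately show ?case by simp
    next
      case (Suc k)
      have u: "f (unit_vec n k) = A *\<^sub>v unit_vec n k"
        using mult_mat_unit_vec[OF A, of k] c[of "unit_vec n k"] Suc.prems
        by (intro eq_vecI) (auto simp: A_def)
      have s: "p (Suc k) = p k + v $ k \<cdot>\<^sub>v unit_vec n k"
        using Suc.prems by (intro eq_vecI) (auto simp: p_def less_Suc_eq)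
      show ?case
        unfolding s using add[OF pc, of "v $ k \<cdot>\<^sub>v unit_vec n k"] smult[of "unit_vec n k" "v $ k"]
          mult_add_distrib_mat_vec[OF A pc, of "v $ k \<cdot>\<^sub>v unit_vec n k"]
          mult_mat_vec[OF A, of "unit_vec n k" "v $ k"] Suc u by simp
    qed
    moreover have "p n = v" using v by (intro eq_vecI) (auto simp: p_def)
    ultimately show ?thesis by auto
  qed
  then show thesis using that A by blast
qed

lemma conjugate_linear_as_intertwiner:
  assumes rep: "matrix_rep G n \<rho>" and J: "conjugate_linear_equivariant G n \<rho> J"
  obtains K where "intertwiner G n (conj_rep \<rho>) n \<rho> K" "\<And>v. v \<in> carrier_vec n \<Longrightarrow> J v = K *\<^sub>v vcnj v"
proof -
  have r: "\<rho> g \<in> carrier_mat n n" if "g \<in> carrier G" for g using rep that by (simp add: matrix_rep_def)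
  have J: "\<And>v. v \<in> carrier_vec n \<Longrightarrow> J v \<in> carrier_vec n"
    "\<And>u v. u \<in> carrier_vec n \<Longrightarrow> v \<in> carrier_vec n \<Longrightarrow> J (u + v) = J u + J v"
    "\<And>c v. v \<in> carrier_vec n \<Longrightarrow> J (c \<cdot>\<^sub>v v) = cnj c \<cdot>\<^sub>v J v"
    "\<And>g v. g \<in> carrier G \<Longrightarrow> v \<in> carrier_vec n \<Longrightarrow> J (\<rho> g *\<^sub>v v) = \<rho> g *\<^sub>v J v"
    using J by (auto simp: conjugate_linear_equivariant_def)
  obtain K where K: "K \<in> carrier_mat n n" "\<And>v. v \<in> carrier_vec n \<Longrightarrow> J (vcnj v) = K *\<^sub>v v"
  proof (rule linear_map_as_matrix[of n "\<lambda>v. J (vcnj v)" n])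
    fix u v :: "complex vec" and c assume u: "u \<in> carrier_vec n" and v: "v \<in> carrier_vec n"
    show "J (vcnj (u + v)) = J (vcnj u) + J (vcnj v)"
      unfolding vcnj_add[OF u v] by (rule J(2)) (use u v in auto)
  next
    fix v :: "complex vec" and c assume v: "v \<in> carrier_vec n"
    show "J (vcnj (c \<cdot>\<^sub>v v)) = c \<cdot>\<^sub>v J (vcnj v)"
      unfolding vcnj_smult using J(3)[of "vcnj v" "cnj c"] v by simp
  qed (use J(1) in auto)
  have JK: "J v = K *\<^sub>v vcnj v" if "v \<in> carrier_vec n" for v using K(2)[of "vcnj v"] that by simp
  have "intertwiner G n (conj_rep \<rho>) n \<rho> K"
  proof (rule intertwinerI)
    fix g v assume g: "g \<in> carrier G" and v: "(v :: complex vec) \<in> carrier_vec n"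
    have "vcnj (conj_rep \<rho> g *\<^sub>v v) = \<rho> g *\<^sub>v vcnj v"
      using vcnj_mult[of "conj_rep \<rho> g" n n v] r[OF g] v by (simp add: conj_rep_def)
    moreover have "conj_rep \<rho> g *\<^sub>v v \<in> carrier_vec n" using r[OF g] v by (auto simp: conj_rep_def)
    ultimately show "K *\<^sub>v (conj_rep \<rho> g *\<^sub>v v) = \<rho> g *\<^sub>v (K *\<^sub>v v)"
      using K(2) J(4)[OF g, of "vcnj v"] v by (metis map_carrier_vec)
  qed (use K r in \<open>auto simp: conj_rep_def\<close>)
  then show thesis using that JK by blast
qed

lemma intertwiner_conjugate_linear:
  assumes K: "intertwiner G n (conj_rep \<rho>) n \<rho> K"
  shows "conjugate_linear_equivariant G n \<rho> (\<lambda>v. K *\<^sub>v vcnj v)"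
    and "v \<in> carrier_vec n \<Longrightarrow> K *\<^sub>v vcnj (K *\<^sub>v vcnj v) = K * mcnj K *\<^sub>v v"
proof -
  note k = intertwinerD[OF K]
  show "conjugate_linear_equivariant G n \<rho> (\<lambda>v. K *\<^sub>v vcnj v)"
    unfolding conjugate_linear_equivariant_def
  proof (intro conjI ballI allI)
    fix g v assume g: "g \<in> carrier G" and v: "(v :: complex vec) \<in> carrier_vec n"
    have "vcnj (\<rho> g *\<^sub>v v) = conj_rep \<rho> g *\<^sub>v vcnj v"
      using vcnj_mult[OF k(3)[OF g] v] by (simp add: conj_rep_def)
    then show "K *\<^sub>v vcnj (\<rho> g *\<^sub>v v) = \<rho> g *\<^sub>v (K *\<^sub>v vcnj v)"
      using intertwiner_act[OF K g, of "vcnj v"] v by simp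
  qed (use k(1) in \<open>auto simp: vcnj_add vcnj_smult mult_add_distrib_mat_vec[OF k(1)] mult_mat_vec[OF k(1)]\<close>)
  assume v: "v \<in> carrier_vec n"
  have "vcnj (K *\<^sub>v vcnj v) = mcnj K *\<^sub>v v" using vcnj_mult[OF k(1), of "vcnj v"] v by simp
  then show "K *\<^sub>v vcnj (K *\<^sub>v vcnj v) = K * mcnj K *\<^sub>v v"
    using assoc_mult_mat_vec[of K n n "mcnj K" n v] k(1) v by simp
qed

lemma smult_mat_1: "(1 :: 'a :: comm_ring_1) \<cdot>\<^sub>m A = A" by (intro eq_matI) auto

lemma smult_mat_assoc: "(a :: 'a :: comm_ring_1) \<cdot>\<^sub>m (b \<cdot>\<^sub>m A) = (a * b) \<cdot>\<^sub>m A"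
  by (intro eq_matI) auto

text \<open>A conjugate-linear map has the form \<open>v \<mapsto> K v\<^sup>c\<close>, where \<open>v\<^sup>c\<close> is the entrywise conjugate. It is
  equivariant iff \<open>K\<close> intertwines the conjugate representation with \<open>\<rho>\<close>, and its square is
  \<open>K\<close> times the conjugate of \<open>K\<close>.\<close>

lemma structure_map_iff:
  assumes rep: "matrix_rep G n \<rho>"
  shows "(\<exists>J. conjugate_linear_equivariant G n \<rho> J \<and> (\<forall>v\<in>carrier_vec n. J (J v) = c \<cdot>\<^sub>v v)) \<longleftrightarrow>
    (\<exists>K. intertwiner G n (conj_rep \<rho>) n \<rho> K \<and> K * mcnj K = c \<cdot>\<^sub>m 1\<^sub>m n)"
proof
  assume "\<exists>J. conjugate_linear_equivariant G n \<rho> J \<and> (\<forall>v\<in>carrier_vec n. J (J v) = c \<cdot>\<^sub>v v)"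
  then obtain J where J: "conjugate_linear_equivariant G n \<rho> J" "\<forall>v\<in>carrier_vec n. J (J v) = c \<cdot>\<^sub>v v" by auto
  obtain K where K: "intertwiner G n (conj_rep \<rho>) n \<rho> K" "\<And>v. v \<in> carrier_vec n \<Longrightarrow> J v = K *\<^sub>v vcnj v"
    using conjugate_linear_as_intertwiner[OF rep J(1)] by metis
  note k = intertwinerD[OF K(1)]
  have "K * mcnj K = c \<cdot>\<^sub>m 1\<^sub>m n"
  proof (rule mat_eq_by_action[of _ n n])
    fix v :: "complex vec" assume v: "v \<in> carrier_vec n"
    have "K *\<^sub>v vcnj v \<in> carrier_vec n" using k(1) v by auto
    then have "K * mcnj K *\<^sub>v v = J (J v)" using intertwiner_conjugate_linear(2)[OF K(1) v] K(2) v by simp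
    then show "K * mcnj K *\<^sub>v v = (c \<cdot>\<^sub>m 1\<^sub>m n) *\<^sub>v v" using J(2) v scalar_mat_mult_vec[OF v] by simp
  qed (use k(1) in auto)
  then show "\<exists>K. intertwiner G n (conj_rep \<rho>) n \<rho> K \<and> K * mcnj K = c \<cdot>\<^sub>m 1\<^sub>m n" using K by blast
next
  assume "\<exists>K. intertwiner G n (conj_rep \<rho>) n \<rho> K \<and> K * mcnj K = c \<cdot>\<^sub>m 1\<^sub>m n"
  then obtain K where K: "intertwiner G n (conj_rep \<rho>) n \<rho> K" "K * mcnj K = c \<cdot>\<^sub>m 1\<^sub>m n" by auto
  show "\<exists>J. conjugate_linear_equivariant G n \<rho> J \<and> (\<forall>v\<in>carrier_vec n. J (J v) = c \<cdot>\<^sub>v v)"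
    using intertwiner_conjugate_linear[OF K(1)] K(2) scalar_mat_mult_vec
    by (intro exI[of _ "\<lambda>v. K *\<^sub>v vcnj v"]) auto
qed

lemma real_type_iff:
  assumes "matrix_rep G n \<rho>"
  shows "real_type G n \<rho> \<longleftrightarrow> (\<exists>K. intertwiner G n (conj_rep \<rho>) n \<rho> K \<and> K * mcnj K = 1\<^sub>m n)"
  using structure_map_iff[OF assms, of 1] by (simp add: real_type_def smult_mat_1)

lemma quaternionic_type_iff:
  assumes "matrix_rep G n \<rho>"
  shows "quaternionic_type G n \<rho> \<longleftrightarrow> (\<exists>K. intertwiner G n (conj_rep \<rho>) n \<rho> K \<and> K * mcnj K = (-1) \<cdot>\<^sub>m 1\<^sub>m n)"
proof -
  have "(-1) \<cdot>\<^sub>v v = - v" for v :: "complex vec" by (intro eq_vecI) auto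
  then show ?thesis using structure_map_iff[OF assms, of "-1"] by (simp add: quaternionic_type_def)
qed

text \<open>By Schur's lemma \<open>K\<close> times its conjugate is a scalar \<open>c\<close>. Bracketing the product of \<open>K\<close>, its conjugate
  and \<open>K\<close> in two ways gives \<open>c K = c\<^sup>* K\<close>, so \<open>c\<close> is real, and rescaling \<open>K\<close> makes it \<open>1\<close> or \<open>-1\<close>.\<close>

lemma self_conjugate_real_or_quaternionic:
  assumes irr: "irreducible_rep G n \<rho>" and K: "intertwiner G n (conj_rep \<rho>) n \<rho> K" and nz: "K \<noteq> 0\<^sub>m n n"
  shows "real_type G n \<rho> \<or> quaternionic_type G n \<rho>"
proof -
  note k = intertwinerD[OF K]
  have rep: "matrix_rep G n \<rho>" and n: "0 < n" using irreducible_repD[OF irr] by auto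
  have cK: "intertwiner G n \<rho> n (conj_rep \<rho>) (mcnj K)" using intertwiner_mcnj[OF K] by simp
  have mK: "mcnj K \<in> carrier_mat n n" using k(1) by simp
  obtain c where c: "K * mcnj K = c \<cdot>\<^sub>m 1\<^sub>m n"
    using schur_scalar[OF irr intertwiner_mult[OF cK K]] by metis
  have c': "mcnj K * K = cnj c \<cdot>\<^sub>m 1\<^sub>m n"
  proof -
    have "mcnj (K * mcnj K) = mcnj K * K" using mcnj_mult[OF k(1) mK] by simp
    moreover have "mcnj (c \<cdot>\<^sub>m 1\<^sub>m n) = cnj c \<cdot>\<^sub>m 1\<^sub>m n" by (intro eq_matI) auto
    ultimately show ?thesis using c by simp
  qed
  have inj: "inj_mat K" by (rule schur_inj[OF irreducible_conj_rep[OF irr] K nz])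
  have "c \<cdot>\<^sub>m K = K * mcnj K * K" unfolding c using k(1) by (simp add: mult_smult_assoc_mat[of _ n n _ n])
  also have "\<dots> = K * (mcnj K * K)" using assoc_mult_mat[OF k(1) mK k(1)] .
  also have "\<dots> = cnj c \<cdot>\<^sub>m K" unfolding c' using k(1) by (simp add: mult_smult_distrib[of _ n n _ n])
  finally have ceq: "c \<cdot>\<^sub>m K = cnj c \<cdot>\<^sub>m K" .
  obtain i j where ij: "i < n" "j < n" "K $$ (i, j) \<noteq> 0" using nz k(1) by (auto simp: mat_eq_iff)
  have "(c \<cdot>\<^sub>m K) $$ (i, j) = (cnj c \<cdot>\<^sub>m K) $$ (i, j)" using ceq by simp
  then have cc: "c = cnj c" using ij k(1) by simp
  have "inj_mat (K * mcnj K)" using inj_mat_mult[OF inj k(1) inj_mcnj[OF inj k(1)] mK] .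
  then have c0: "c \<noteq> 0"
  proof (rule contrapos_pn)
    assume "c = 0"
    then have "K * mcnj K *\<^sub>v unit_vec n 0 = 0 \<cdot>\<^sub>v unit_vec n 0"
      unfolding c by (simp add: scalar_mat_mult_vec)
    also have "\<dots> = 0\<^sub>v n" by (intro eq_vecI) auto
    finally have "inj_mat (K * mcnj K) \<Longrightarrow> unit_vec n 0 = (0\<^sub>v n :: complex vec)"
      using inj_matD[of "K * mcnj K" n n "unit_vec n 0"] k(1) mK by auto
    moreover have "unit_vec n 0 $ 0 \<noteq> (0\<^sub>v n :: complex vec) $ 0" using n by simp
    ultimately show "\<not> inj_mat (K * mcnj K)" by metis
  qed
  define r where "r = Re c"
  have cr: "c = complex_of_real r" using cc by (simp add: r_def complex_eq_iff)
  define t where "t = complex_of_real (1 / sqrt \<bar>r\<bar>)"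
  have mt: "mcnj (t \<cdot>\<^sub>m K) = t \<cdot>\<^sub>m mcnj K" by (intro eq_matI) (auto simp: t_def)
  \<comment> \<open>The factor \<open>t\<close> is real, so it enters the product twice and turns \<open>c\<close> into its sign.\<close>
  have "(t \<cdot>\<^sub>m K) * mcnj (t \<cdot>\<^sub>m K) = (t * t * c) \<cdot>\<^sub>m 1\<^sub>m n"
    unfolding mt using c k(1) mK
    by (simp add: mult_smult_assoc_mat[of _ n n _ n] mult_smult_distrib[of _ n n _ n] smult_mat_assoc mult.assoc)
  moreover have "t * t * c = complex_of_real (sgn r)"
  proof -
    have "sqrt \<bar>r\<bar> * sqrt \<bar>r\<bar> = \<bar>r\<bar>" by simp
    then have "1 / sqrt \<bar>r\<bar> * (1 / sqrt \<bar>r\<bar>) * r = sgn r"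
      using c0 cr by (simp add: sgn_if field_simps abs_if)
    then show ?thesis unfolding t_def cr by (metis of_real_mult)
  qed
  moreover have "sgn r = 1 \<or> sgn r = -1" using c0 cr by (auto simp: sgn_if)
  moreover have "intertwiner G n (conj_rep \<rho>) n \<rho> (t \<cdot>\<^sub>m K)" by (rule intertwiner_smult[OF K])
  ultimately show ?thesis
    unfolding real_type_iff[OF rep] quaternionic_type_iff[OF rep]
    by (metis of_real_1 of_real_minus smult_mat_1)
qed

section \<open>Intertwiners into the sum of two images\<close>

lemma intertwiner_cancel:
  assumes T: "intertwiner G n \<rho> N \<tau> T" "inj_mat T" and TA: "intertwiner G m \<sigma> N \<tau> (T * A)"
    and A: "A \<in> carrier_mat n m"
  shows "intertwiner G m \<sigma> n \<rho> A"
proof (rule intertwinerI[OF A])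
  note t = intertwinerD[OF T(1)] and ta = intertwinerD[OF TA]
  fix g assume g: "g \<in> carrier G"
  show "\<rho> g \<in> carrier_mat n n" "\<sigma> g \<in> carrier_mat m m" using t ta g by auto
  fix v :: "complex vec" assume v: "v \<in> carrier_vec m"
  have Av: "A *\<^sub>v v \<in> carrier_vec n" using A v by auto
  have sv: "\<sigma> g *\<^sub>v v \<in> carrier_vec m" using mult_mat_vec_carrier[OF ta(2)[OF g] v] .
  show "A *\<^sub>v (\<sigma> g *\<^sub>v v) = \<rho> g *\<^sub>v (A *\<^sub>v v)"
  proof (rule inj_mat_eqD[OF T(2) t(1)])
    show "T *\<^sub>v (A *\<^sub>v (\<sigma> g *\<^sub>v v)) = T *\<^sub>v (\<rho> g *\<^sub>v (A *\<^sub>v v))"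
      using intertwiner_act[OF TA g v] intertwiner_act[OF T(1) g Av]
        assoc_mult_mat_vec[OF t(1) A v] assoc_mult_mat_vec[OF t(1) A sv] by simp
  qed (use mult_mat_vec_carrier[OF A sv] mult_mat_vec_carrier[OF t(2)[OF g] Av] in auto)
qed

text \<open>If the images of \<open>T\<close> and \<open>T'\<close> meet in zero only, then \<open>U v = T a + T' b\<close> determines \<open>a\<close> and \<open>b\<close>, and
  they depend linearly and equivariantly on \<open>v\<close>. Otherwise \<open>{a. T a \<in> range T'}\<close> is a nonzero
  invariant subspace, hence everything, so the image of \<open>U\<close> lies in that of \<open>T'\<close> alone.\<close>

lemma intertwiner_into_sum:
  assumes irr: "irreducible_rep G n \<rho>"
    and T: "intertwiner G n \<rho> N \<tau> T" "inj_mat T" and T': "intertwiner G n' \<rho>' N \<tau> T'" "inj_mat T'"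
    and U: "intertwiner G m \<sigma> N \<tau> U"
    and into: "\<And>v. v \<in> carrier_vec m \<Longrightarrow> \<exists>a\<in>carrier_vec n. \<exists>b\<in>carrier_vec n'. U *\<^sub>v v = T *\<^sub>v a + T' *\<^sub>v b"
  obtains A B where "intertwiner G m \<sigma> n \<rho> A" "intertwiner G m \<sigma> n' \<rho>' B" "U = T * A + T' * B"
proof -
  note t = intertwinerD[OF T(1)] and t' = intertwinerD[OF T'(1)] and u = intertwinerD[OF U]
  define V where "V = {a \<in> carrier_vec n. T *\<^sub>v a \<in> mat_range T'}"
  have T'sub: "lin_subspace N (mat_range T')" by (rule lin_subspace_mat_range[OF t'(1)])
  have Vsub: "lin_subspace n V"
  proof -
    have "T *\<^sub>v 0\<^sub>v n = 0\<^sub>v N" using t(1) by (auto intro!: eq_vecI)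
    then show ?thesis
      unfolding lin_subspace_def V_def using lin_subspaceD[OF T'sub]
        mult_add_distrib_mat_vec[OF t(1)] mult_mat_vec[OF t(1)] by auto
  qed
  have Vinv: "invariant_set G \<rho> V"
    unfolding invariant_set_def
  proof (intro ballI)
    fix g a assume g: "g \<in> carrier G" and "a \<in> V"
    then have a: "a \<in> carrier_vec n" "T *\<^sub>v a \<in> mat_range T'" by (auto simp: V_def)
    obtain b where b: "b \<in> carrier_vec n'" "T *\<^sub>v a = T' *\<^sub>v b" using mat_rangeE[OF a(2) t'(1)] by metis
    have "T *\<^sub>v (\<rho> g *\<^sub>v a) = T' *\<^sub>v (\<rho>' g *\<^sub>v b)"
      using intertwiner_act[OF T(1) g a(1)] intertwiner_act[OF T'(1) g b(1)] b by simp
    then show "\<rho> g *\<^sub>v a \<in> V"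
      using mult_mat_vec_carrier[OF t(2)[OF g] a(1)] mat_rangeI[OF t'(1) mult_mat_vec_carrier[OF t'(2)[OF g] b(1)]]
      by (simp add: V_def)
  qed
  consider "V = {0\<^sub>v n}" | "V = carrier_vec n" using irreducible_repD(3)[OF irr Vsub Vinv] by blast
  then show thesis
  proof cases
    case 1
    have "\<forall>j<m. \<exists>a b. a \<in> carrier_vec n \<and> b \<in> carrier_vec n' \<and> col U j = T *\<^sub>v a + T' *\<^sub>v b"
      using into mult_mat_unit_vec[OF u(1)] by (metis unit_vec_carrier)
    then obtain a b where ab: "\<And>j. j < m \<Longrightarrow> a j \<in> carrier_vec n \<and> b j \<in> carrier_vec n' \<and> col U j = T *\<^sub>v a j + T' *\<^sub>v b j"
      by metis
    define A where "A = mat n m (\<lambda>(i, j). a j $ i)"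
    define B where "B = mat n' m (\<lambda>(i, j). b j $ i)"
    have A: "A \<in> carrier_mat n m" and B: "B \<in> carrier_mat n' m" by (simp_all add: A_def B_def)
    have cA: "col A j = a j" and cB: "col B j = b j" if "j < m" for j
      using ab[OF that] that by (auto intro!: eq_vecI simp: A_def B_def)
    have UAB: "U = T * A + T' * B"
    proof (rule mat_col_eqI)
      fix j assume "j < dim_col (T * A + T' * B)"
      then have j: "j < m" using B by simp
      have "col (T * A + T' * B) j = col (T * A) j + col (T' * B) j"
        using t(1) t'(1) A B j by (intro eq_vecI) auto
      then show "col U j = col (T * A + T' * B) j"
        using ab[OF j] cA[OF j] cB[OF j] col_mult2[OF t(1) A j] col_mult2[OF t'(1) B j] by simp
    qed (use u(1) t(1) t'(1) A B in auto)
    have Uv: "U *\<^sub>v v = T *\<^sub>v (A *\<^sub>v v) + T' *\<^sub>v (B *\<^sub>v v)" if v: "v \<in> carrier_vec m" for v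
      unfolding UAB using assoc_mult_mat_vec[OF t(1) A v] assoc_mult_mat_vec[OF t'(1) B v]
        add_mult_distrib_mat_vec[of "T * A" N m "T' * B" v] t(1) t'(1) A B v by simp
    have eqs: "A *\<^sub>v (\<sigma> g *\<^sub>v v) = \<rho> g *\<^sub>v (A *\<^sub>v v) \<and> B *\<^sub>v (\<sigma> g *\<^sub>v v) = \<rho>' g *\<^sub>v (B *\<^sub>v v)"
      if g: "g \<in> carrier G" and v: "v \<in> carrier_vec m" for g v
    proof -
      let ?a = "A *\<^sub>v (\<sigma> g *\<^sub>v v)" and ?a' = "\<rho> g *\<^sub>v (A *\<^sub>v v)"
      let ?b = "B *\<^sub>v (\<sigma> g *\<^sub>v v)" and ?b' = "\<rho>' g *\<^sub>v (B *\<^sub>v v)"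
      have Av: "A *\<^sub>v v \<in> carrier_vec n" and Bv: "B *\<^sub>v v \<in> carrier_vec n'" using A B v by auto
      have sv: "\<sigma> g *\<^sub>v v \<in> carrier_vec m" using mult_mat_vec_carrier[OF u(2)[OF g] v] .
      have c: "?a \<in> carrier_vec n" "?a' \<in> carrier_vec n" "?b \<in> carrier_vec n'" "?b' \<in> carrier_vec n'"
        using mult_mat_vec_carrier[OF A sv] mult_mat_vec_carrier[OF t(2)[OF g] Av]
          mult_mat_vec_carrier[OF B sv] mult_mat_vec_carrier[OF t'(2)[OF g] Bv] by auto
      have cN: "T *\<^sub>v ?a \<in> carrier_vec N" "T *\<^sub>v ?a' \<in> carrier_vec N" "T' *\<^sub>v ?b \<in> carrier_vec N" "T' *\<^sub>v ?b' \<in> carrier_vec N"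
        using c t(1) t'(1) by auto
      have "T *\<^sub>v ?a + T' *\<^sub>v ?b = \<tau> g *\<^sub>v (T *\<^sub>v (A *\<^sub>v v) + T' *\<^sub>v (B *\<^sub>v v))"
        using Uv[OF sv] Uv[OF v] intertwiner_act[OF U g v] by simp
      also have "\<dots> = T *\<^sub>v ?a' + T' *\<^sub>v ?b'"
        using mult_add_distrib_mat_vec[OF t(3)[OF g], of "T *\<^sub>v (A *\<^sub>v v)" "T' *\<^sub>v (B *\<^sub>v v)"]
          intertwiner_act[OF T(1) g Av] intertwiner_act[OF T'(1) g Bv] t(1) t'(1) Av Bv by simp
      finally have sum: "T *\<^sub>v ?a + T' *\<^sub>v ?b = T *\<^sub>v ?a' + T' *\<^sub>v ?b'" .
      have eq: "T *\<^sub>v (?a - ?a') = T' *\<^sub>v (?b' - ?b)"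
        unfolding mult_mat_vec_diff[OF t(1) c(1,2)] mult_mat_vec_diff[OF t'(1) c(4,3)]
        by (rule vec_add_eq_imp_diff_eq[OF cN(1,3,2,4) sum])
      moreover have d: "?b' - ?b \<in> carrier_vec n'" "?a - ?a' \<in> carrier_vec n" using c by auto
      ultimately have "?a - ?a' \<in> V" using mat_rangeI[OF t'(1)] by (simp add: V_def)
      then have z: "?a - ?a' = 0\<^sub>v n" using 1 by simp
      then have aa: "?a = ?a'" using vec_diff_eq_0_iff[OF c(1,2)] by simp
      have "T' *\<^sub>v (?b' - ?b) = 0\<^sub>v N" using eq mult_mat_zero_vec[OF t(1)] unfolding z by simp
      then have "?b' - ?b = 0\<^sub>v n'" by (rule inj_matD[OF T'(2) t'(1) d(1)])
      then have "?b = ?b'" using vec_diff_eq_0_iff[OF c(4,3)] by simp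
      then show ?thesis using aa by simp
    qed
    have "intertwiner G m \<sigma> n \<rho> A" by (rule intertwinerI[OF A u(2) t(2)]) (use eqs in auto)
    moreover have "intertwiner G m \<sigma> n' \<rho>' B" by (rule intertwinerI[OF B u(2) t'(2)]) (use eqs in auto)
    ultimately show ?thesis using that UAB by blast
  next
    case 2
    have "U *\<^sub>v v \<in> mat_range T'" if v: "v \<in> carrier_vec m" for v
    proof -
      obtain a b where ab: "a \<in> carrier_vec n" "b \<in> carrier_vec n'" "U *\<^sub>v v = T *\<^sub>v a + T' *\<^sub>v b"
        using into[OF v] by auto
      have "T *\<^sub>v a \<in> mat_range T'" using 2 ab(1) by (auto simp: V_def)
      then show ?thesis using ab lin_subspaceD(3)[OF T'sub] mat_rangeI[OF t'(1)] by simp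
    qed
    then obtain B where B: "B \<in> carrier_mat n' m" "U = T' * B" using mat_range_factor[OF t'(1) u(1)] by metis
    have z: "intertwiner G m \<sigma> n \<rho> (0\<^sub>m n m)"
      unfolding intertwiner_def
    proof (intro conjI ballI)
      fix g assume g: "g \<in> carrier G"
      show "0\<^sub>m n m * \<sigma> g = \<rho> g * 0\<^sub>m n m"
        using left_mult_zero_mat[OF u(2)[OF g], of n] right_mult_zero_mat[OF t(2)[OF g], of m] by simp
    qed (use u(2) t(2) in auto)
    have "intertwiner G m \<sigma> n' \<rho>' B" using intertwiner_cancel[OF T' _ B(1)] U B(2) by simp
    moreover have "U = T * 0\<^sub>m n m + T' * B" using t(1) t'(1) B by simp
    ultimately show ?thesis using that z by blast
  qed
qed

section \<open>The Laplacian on complex functions\<close>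

text \<open>Both the Laplacian and \<open>D\<^sub>W\<close> have entries of the form \<open>- (\<Sum>s. c\<^sub>s (a\<^sub>s - b\<^sub>s))\<close>; this evaluates their
  product with a vector.\<close>

lemma sum_weighted_difference:
  fixes c :: "'s \<Rightarrow> 'k :: comm_ring_1"
  shows "(\<Sum>j\<in>J. - (\<Sum>s\<in>A. c s * (a s j - b s j)) * f j) =
    - (\<Sum>s\<in>A. c s * ((\<Sum>j\<in>J. a s j * f j) - (\<Sum>j\<in>J. b s j * f j)))"
proof -
  have "(\<Sum>j\<in>J. - (\<Sum>s\<in>A. c s * (a s j - b s j)) * f j) =
    - (\<Sum>j\<in>J. \<Sum>s\<in>A. c s * ((a s j - b s j) * f j))"
    by (simp add: sum_distrib_right mult.assoc sum_negf)
  also have "\<dots> = - (\<Sum>s\<in>A. \<Sum>j\<in>J. c s * ((a s j - b s j) * f j))"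
    by (subst sum.swap) (rule refl)
  also have "\<dots> = - (\<Sum>s\<in>A. c s * ((\<Sum>j\<in>J. a s j * f j) - (\<Sum>j\<in>J. b s j * f j)))"
    unfolding sum_distrib_left[symmetric] left_diff_distrib sum_subtractf ..
  finally show ?thesis .
qed

text \<open>Complex functions on \<open>G\<close> are vectors of length \<open>|G|\<close>, by means of a fixed enumeration \<open>elt\<close> of \<open>G\<close>
  with inverse \<open>idx\<close>. In this way the left regular representation, the Laplacian and the representations
  under study are all matrices.\<close>

locale cayley = group G for G (structure) +
  fixes S :: "'a set"
  assumes finite_carrier: "finite (carrier G)"
    and S_subset: "S \<subseteq> carrier G"
    and S_inv: "s \<in> S \<Longrightarrow> inv s \<in> S"
begin

abbreviation N :: nat where "N \<equiv> card (carrier G)"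

definition elt :: "nat \<Rightarrow> 'a" where "elt = (SOME h. bij_betw h {..<N} (carrier G))"
definition idx :: "'a \<Rightarrow> nat" where "idx = inv_into {..<N} elt"

lemma bij_elt: "bij_betw elt {..<N} (carrier G)"
proof -
  have "\<exists>h. bij_betw h {..<N} (carrier G)"
    using ex_bij_betw_nat_finite[OF finite_carrier] by (simp add: atLeast0LessThan)
  then show ?thesis unfolding elt_def by (rule someI_ex)
qed

lemma elt_image: "elt ` {..<N} = carrier G" and inj_elt: "inj_on elt {..<N}"
  using bij_elt by (auto simp: bij_betw_def)

lemma elt_closed[simp]: "i < N \<Longrightarrow> elt i \<in> carrier G"
  using elt_image by blast

lemma idx_less[simp]: "x \<in> carrier G \<Longrightarrow> idx x < N"
  unfolding idx_def using inv_into_into[of x elt "{..<N}"] elt_image by blast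

lemma elt_idx[simp]: "x \<in> carrier G \<Longrightarrow> elt (idx x) = x"
  unfolding idx_def using f_inv_into_f[of x elt "{..<N}"] elt_image by blast

lemma idx_elt[simp]: "i < N \<Longrightarrow> idx (elt i) = i"
  unfolding idx_def using inv_into_f_f[OF inj_elt, of i] by blast

lemma S_closed[simp]: "s \<in> S \<Longrightarrow> s \<in> carrier G" using S_subset by auto

lemma finite_S: "finite S" using finite_subset[OF S_subset finite_carrier] .

lemma sum_inverses: "(\<Sum>s\<in>S. F (inv s)) = (\<Sum>s\<in>S. F s)"
  by (rule sum.reindex_bij_witness[of S "\<lambda>s. inv s" "\<lambda>s. inv s"]) (auto simp: S_inv)

definition wt :: "('a set \<Rightarrow> real) \<Rightarrow> 'a \<Rightarrow> complex" where "wt w s = complex_of_real (w {s, inv s})"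

lemma wt_inv: "s \<in> S \<Longrightarrow> wt w (inv s) = wt w s"
  by (simp add: wt_def insert_commute)

lemma cnj_wt[simp]: "cnj (wt w s) = wt w s" by (simp add: wt_def)

text \<open>The left regular representation, as permutation matrices.\<close>

definition reg :: "'a \<Rightarrow> complex mat"
  where "reg g = mat N N (\<lambda>(i, j). if elt i = g \<otimes> elt j then 1 else 0)"

lemma reg_carrier[simp]: "reg g \<in> carrier_mat N N" by (simp add: reg_def)

lemma reg_act:
  assumes g: "g \<in> carrier G" and f: "f \<in> carrier_vec N" and i: "i < N"
  shows "(reg g *\<^sub>v f) $ i = f $ idx (inv g \<otimes> elt i)"
proof -
  have eq: "elt i = g \<otimes> elt j \<longleftrightarrow> j = idx (inv g \<otimes> elt i)" if "j < N" for j
  proof -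
    have "elt i = g \<otimes> elt j \<longleftrightarrow> elt j = inv g \<otimes> elt i"
      by (rule inv_solve_left[symmetric]) (use g i that in simp_all)
    also have "\<dots> \<longleftrightarrow> j = idx (inv g \<otimes> elt i)"
    proof -
      have "inv g \<otimes> elt i \<in> carrier G" using g i by simp
      then show ?thesis using idx_elt[OF that] elt_idx[of "inv g \<otimes> elt i"] by metis
    qed
    finally show ?thesis .
  qed
  have "(reg g *\<^sub>v f) $ i = (\<Sum>j\<in>{0..<N}. (if elt i = g \<otimes> elt j then 1 else 0) * f $ j)"
    using i f by (auto simp: reg_def scalar_prod_def)
  also have "\<dots> = (\<Sum>j\<in>{0..<N}. if j = idx (inv g \<otimes> elt i) then f $ j else 0)"
    by (rule sum.cong) (auto simp: eq)
  also have "\<dots> = f $ idx (inv g \<otimes> elt i)" using g i by (simp add: sum.delta)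
  finally show ?thesis .
qed

lemma reg_act_carrier[simp]: "f \<in> carrier_vec N \<Longrightarrow> reg g *\<^sub>v f \<in> carrier_vec N"
  by (rule mult_mat_vec_carrier[OF reg_carrier])

lemma reg_one: "reg \<one> = 1\<^sub>m N"
proof (rule mat_eq_by_action[of _ N N])
  fix v :: "complex vec" assume v: "v \<in> carrier_vec N"
  show "reg \<one> *\<^sub>v v = 1\<^sub>m N *\<^sub>v v"
    using v carrier_matD(1)[OF reg_carrier, of \<one>]
    by (intro eq_vecI) (auto simp: reg_act simp del: index_mult_mat_vec)
qed auto

lemma reg_mult_act:
  assumes "g \<in> carrier G" "k \<in> carrier G" "f \<in> carrier_vec N"
  shows "reg (g \<otimes> k) *\<^sub>v f = reg g *\<^sub>v (reg k *\<^sub>v f)"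
proof (rule eq_vecI)
  fix i assume "i < dim_vec (reg g *\<^sub>v (reg k *\<^sub>v f))"
  then have i: "i < N" by (simp add: reg_def)
  have "inv (g \<otimes> k) \<otimes> elt i = inv k \<otimes> (inv g \<otimes> elt i)"
    using assms i by (simp add: inv_mult_group m_assoc)
  then show "(reg (g \<otimes> k) *\<^sub>v f) $ i = (reg g *\<^sub>v (reg k *\<^sub>v f)) $ i"
    using assms i by (simp add: reg_act del: index_mult_mat_vec)
qed (simp add: reg_def)

lemma mcnj_reg: "mcnj (reg g) = reg g" by (intro eq_matI) (auto simp: reg_def)

lemma conj_rep_reg: "conj_rep reg = reg" by (auto simp: conj_rep_def mcnj_reg)

lemma cadj_reg: assumes "g \<in> carrier G" shows "cadj (reg g) = reg (inv g)"
proof (rule eq_matI)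
  fix i j assume "i < dim_row (reg (inv g))" "j < dim_col (reg (inv g))"
  then have ij: "i < N" "j < N" by (auto simp: reg_def)
  have "elt j = g \<otimes> elt i \<longleftrightarrow> elt i = inv g \<otimes> elt j"
    by (rule inv_solve_left[symmetric]) (use assms ij in simp_all)
  then show "cadj (reg g) $$ (i, j) = reg (inv g) $$ (i, j)" using ij by (simp add: cadj_def reg_def)
qed (auto simp: cadj_def reg_def)

text \<open>The matrix of \<open>\<Delta>\<^sub>w\<close> on complex functions on \<open>G\<close>.\<close>

definition lap :: "('a set \<Rightarrow> real) \<Rightarrow> complex mat"
  where "lap w = mat N N (\<lambda>(i, j). - (\<Sum>s\<in>S. wt w s *
    ((if elt j = elt i \<otimes> s then 1 else 0) - (if i = j then 1 else 0))))"

lemma lap_carrier[simp]: "lap w \<in> carrier_mat N N" unfolding lap_def by (rule mat_carrier)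

lemma lap_dim[simp]: "dim_row (lap w) = N" "dim_col (lap w) = N"
  using carrier_matD[OF lap_carrier] by auto

lemma lap_index:
  assumes "i < N" "j < N"
  shows "lap w $$ (i, j) = - (\<Sum>s\<in>S. wt w s * ((if elt j = elt i \<otimes> s then 1 else 0) - (if i = j then 1 else 0)))"
  unfolding lap_def by (subst index_mat(1)[OF assms]) (rule prod.case)

lemma lap_act_carrier[simp]: "f \<in> carrier_vec N \<Longrightarrow> lap w *\<^sub>v f \<in> carrier_vec N"
  by (rule mult_mat_vec_carrier[OF lap_carrier])

lemma lap_act:
  assumes f: "f \<in> carrier_vec N" and i: "i < N"
  shows "(lap w *\<^sub>v f) $ i = - (\<Sum>s\<in>S. wt w s * (f $ idx (elt i \<otimes> s) - f $ i))"
proof -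
  have "(lap w *\<^sub>v f) $ i = (\<Sum>j\<in>{0..<N}. lap w $$ (i, j) * f $ j)"
    using i f carrier_matD[OF lap_carrier, of w] by (auto simp: scalar_prod_def intro!: sum.cong)
  also have "\<dots> = (\<Sum>j\<in>{0..<N}. - (\<Sum>s\<in>S. wt w s *
    ((if elt j = elt i \<otimes> s then 1 else 0) - (if i = j then 1 else 0))) * f $ j)"
  proof (rule sum.cong[OF refl])
    fix j assume "j \<in> {0..<N}"
    then have "j < N" by simp
    then show "lap w $$ (i, j) * f $ j = - (\<Sum>s\<in>S. wt w s *
      ((if elt j = elt i \<otimes> s then 1 else 0) - (if i = j then 1 else 0))) * f $ j"
      by (simp only: lap_index[OF i])
  qed
  also have "\<dots> = - (\<Sum>s\<in>S. wt w s * ((\<Sum>j\<in>{0..<N}. (if elt j = elt i \<otimes> s then 1 else 0) * f $ j) -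
      (\<Sum>j\<in>{0..<N}. (if i = j then 1 else 0) * f $ j)))"
    by (rule sum_weighted_difference)
  also have "\<dots> = - (\<Sum>s\<in>S. wt w s * (f $ idx (elt i \<otimes> s) - f $ i))"
  proof (rule arg_cong[where f=uminus], rule sum.cong[OF refl])
    fix s assume s: "s \<in> S"
    have es: "elt i \<otimes> s \<in> carrier G" using s i by simp
    have eq: "elt j = elt i \<otimes> s \<longleftrightarrow> j = idx (elt i \<otimes> s)" if "j < N" for j
      using idx_elt[OF that] elt_idx[OF es] by metis
    have "(\<Sum>j\<in>{0..<N}. (if elt j = elt i \<otimes> s then 1 else 0) * f $ j) =
      (\<Sum>j\<in>{0..<N}. if j = idx (elt i \<otimes> s) then f $ j else 0)"
      by (rule sum.cong) (auto simp: eq)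
    also have "\<dots> = f $ idx (elt i \<otimes> s)" using idx_less[OF es] by (simp add: sum.delta)
    finally have a: "(\<Sum>j\<in>{0..<N}. (if elt j = elt i \<otimes> s then 1 else 0) * f $ j) = f $ idx (elt i \<otimes> s)" .
    have "(\<Sum>j\<in>{0..<N}. (if i = j then 1 else 0) * f $ j) = (\<Sum>j\<in>{0..<N}. if i = j then f $ j else 0)"
      by (rule sum.cong) auto
    also have "\<dots> = f $ i" using i by (simp add: sum.delta')
    finally have b: "(\<Sum>j\<in>{0..<N}. (if i = j then 1 else 0) * f $ j) = f $ i" .
    show "wt w s * ((\<Sum>j\<in>{0..<N}. (if elt j = elt i \<otimes> s then 1 else 0) * f $ j) -
      (\<Sum>j\<in>{0..<N}. (if i = j then 1 else 0) * f $ j)) = wt w s * (f $ idx (elt i \<otimes> s) - f $ i)"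
      unfolding a b ..
  qed
  finally show ?thesis .
qed

lemma mcnj_lap: "mcnj (lap w) = lap w"
proof (rule eq_matI)
  fix i j assume "i < dim_row (lap w)" "j < dim_col (lap w)"
  then have ij: "i < N" "j < N" by auto
  have "cnj (wt w s * ((if P then 1 else 0) - (if Q then 1 else 0))) =
    wt w s * ((if P then 1 else 0) - (if Q then 1 else 0))" for s P Q by simp
  then show "mcnj (lap w) $$ (i, j) = lap w $$ (i, j)"
    using ij lap_index[OF ij] by (simp only: index_map_mat lap_dim cnj_sum complex_cnj_minus)
qed auto

text \<open>The \<open>(i, j)\<close> entry collects the weights of those \<open>s\<close> that lead from \<open>i\<close> to \<open>j\<close>; their inverses have the same
  weights and lead back.\<close>

lemma cadj_lap: "cadj (lap w) = lap w"
proof (rule eq_matI)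
  fix i j assume "i < dim_row (lap w)" "j < dim_col (lap w)"
  then have ij: "i < N" "j < N" by auto
  have "(\<Sum>s\<in>S. wt w s * ((if elt i = elt j \<otimes> s then 1 else 0) - (if j = i then 1 else 0))) =
    (\<Sum>s\<in>S. wt w (inv s) * ((if elt i = elt j \<otimes> inv s then 1 else 0) - (if j = i then 1 else 0)))"
    by (rule sum_inverses[symmetric])
  also have "\<dots> = (\<Sum>s\<in>S. wt w s * ((if elt j = elt i \<otimes> s then 1 else 0) - (if i = j then 1 else 0)))"
  proof (rule sum.cong[OF refl])
    fix s assume s: "s \<in> S"
    have "elt i = elt j \<otimes> inv s \<longleftrightarrow> elt j = elt i \<otimes> s"
      by (rule inv_solve_right) (use s ij in simp_all)
    then show "wt w (inv s) * ((if elt i = elt j \<otimes> inv s then 1 else 0) - (if j = i then 1 else 0)) =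
      wt w s * ((if elt j = elt i \<otimes> s then 1 else 0) - (if i = j then 1 else 0))"
      using wt_inv[OF s] by auto
  qed
  finally have "lap w $$ (j, i) = lap w $$ (i, j)" unfolding lap_index[OF ij] lap_index[OF ij(2,1)] by (rule arg_cong)
  moreover have "cnj (lap w $$ (j, i)) = lap w $$ (j, i)"
    using arg_cong[OF mcnj_lap[of w], of "\<lambda>A. A $$ (j, i)"] ij by simp
  ultimately show "cadj (lap w) $$ (i, j) = lap w $$ (i, j)" using ij by (simp add: cadj_def)
qed (auto simp: cadj_def)

lemma reg_lap_commute:
  assumes g: "g \<in> carrier G" and f: "f \<in> carrier_vec N"
  shows "lap w *\<^sub>v (reg g *\<^sub>v f) = reg g *\<^sub>v (lap w *\<^sub>v f)"
proof (rule eq_vecI)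
  fix i assume "i < dim_vec (reg g *\<^sub>v (lap w *\<^sub>v f))"
  then have i: "i < N" by (simp add: reg_def)
  have "inv g \<otimes> (elt i \<otimes> s) = inv g \<otimes> elt i \<otimes> s" if "s \<in> S" for s
    using g i that by (simp add: m_assoc)
  then show "(lap w *\<^sub>v (reg g *\<^sub>v f)) $ i = (reg g *\<^sub>v (lap w *\<^sub>v f)) $ i"
    using g f i by (simp add: reg_act lap_act del: index_mult_mat_vec)
qed (simp add: reg_def)

definition eigenspace :: "('a set \<Rightarrow> real) \<Rightarrow> complex \<Rightarrow> complex vec set"
  where "eigenspace w \<mu> = {f \<in> carrier_vec N. lap w *\<^sub>v f = \<mu> \<cdot>\<^sub>v f}"

lemma eigenspace_subspace: "lin_subspace N (eigenspace w \<mu>)"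
  unfolding eigenspace_def by (rule lin_subspace_eigenvectors[OF lap_carrier])

lemma eigenspace_invariant: "invariant_set G reg (eigenspace w \<mu>)"
  unfolding invariant_set_def eigenspace_def
  using reg_lap_commute mult_mat_vec[OF reg_carrier] by auto

lemma eigenspace_vcnj:
  assumes "\<mu> \<in> \<real>" "f \<in> eigenspace w \<mu>" shows "vcnj f \<in> eigenspace w \<mu>"
proof -
  have f: "f \<in> carrier_vec N" "lap w *\<^sub>v f = \<mu> \<cdot>\<^sub>v f" using assms by (auto simp: eigenspace_def)
  have "lap w *\<^sub>v vcnj f = vcnj (lap w *\<^sub>v f)" using vcnj_mult[OF lap_carrier f(1)] mcnj_lap by simp
  then show ?thesis using f assms by (simp add: eigenspace_def vcnj_smult Reals_cnj_iff)
qed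

lemma eigenvalue_real:
  assumes f: "f \<in> eigenspace w \<mu>" and nz: "f \<noteq> 0\<^sub>v N" shows "\<mu> \<in> \<real>"
proof -
  have fc: "f \<in> carrier_vec N" and ev: "lap w *\<^sub>v f = \<mu> \<cdot>\<^sub>v f" using f by (auto simp: eigenspace_def)
  have "\<mu> * cinner f f = cinner (lap w *\<^sub>v f) f" unfolding ev using fc by simp
  also have "\<dots> = cinner f (lap w *\<^sub>v f)" using cinner_adj_right[OF lap_carrier fc fc] cadj_lap by simp
  also have "\<dots> = cnj \<mu> * cinner f f" unfolding ev vcnj_smult using fc by simp
  finally have "\<mu> = cnj \<mu>" using cinner_self_eq_0[OF fc] nz by auto
  then show ?thesis using Reals_cnj_iff by metis
qed

text \<open>For the symmetric Laplacian and \<open>g = (\<Delta> - \<mu>)f\<close>, the hypothesis gives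
  \<open>\<langle>g, g\<rangle> = \<langle>f, (\<Delta> - \<mu>)g\<rangle> = 0\<close>.\<close>

lemma lap_semisimple:
  assumes "\<mu> \<in> \<real>" and f: "f \<in> carrier_vec N"
    and sq: "lap w *\<^sub>v (lap w *\<^sub>v f - \<mu> \<cdot>\<^sub>v f) = \<mu> \<cdot>\<^sub>v (lap w *\<^sub>v f - \<mu> \<cdot>\<^sub>v f)"
  shows "lap w *\<^sub>v f = \<mu> \<cdot>\<^sub>v f"
proof -
  let ?g = "lap w *\<^sub>v f - \<mu> \<cdot>\<^sub>v f"
  have g: "?g \<in> carrier_vec N" and lf: "lap w *\<^sub>v f \<in> carrier_vec N" using f by auto
  have "cinner ?g ?g = cinner (lap w *\<^sub>v f) ?g - cinner (\<mu> \<cdot>\<^sub>v f) ?g"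
    using minus_scalar_prod_distrib[of "lap w *\<^sub>v f" N "\<mu> \<cdot>\<^sub>v f" "vcnj ?g"] f g lf by simp
  also have "cinner (lap w *\<^sub>v f) ?g = cinner f (lap w *\<^sub>v ?g)"
    using cinner_adj_right[OF lap_carrier f g] cadj_lap by simp
  also have "\<dots> = \<mu> * cinner f ?g" unfolding sq vcnj_smult using assms(1) f g by (simp add: Reals_cnj_iff)
  also have "cinner (\<mu> \<cdot>\<^sub>v f) ?g = \<mu> * cinner f ?g" using f g by simp
  finally have "?g = 0\<^sub>v N" using cinner_self_eq_0[OF g] by simp
  then show ?thesis using vec_diff_eq_0_iff[OF lf, of "\<mu> \<cdot>\<^sub>v f"] f by simp
qed

subsection \<open>Frobenius reciprocity\<close>

lemma rep_operator_carrier[simp]: "rep_operator G S n \<rho> w \<in> carrier_mat n n"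
  by (simp add: rep_operator_def)

lemma rep_operator_act:
  assumes rep: "matrix_rep G n \<rho>" and u: "u \<in> carrier_vec n" and i: "i < n"
  shows "(rep_operator G S n \<rho> w *\<^sub>v u) $ i = - (\<Sum>s\<in>S. wt w s * ((\<rho> s *\<^sub>v u) $ i - u $ i))"
proof -
  have r: "\<rho> s \<in> carrier_mat n n" if "s \<in> S" for s using rep that by (simp add: matrix_rep_def)
  have r1: "\<rho> \<one> = 1\<^sub>m n" using rep by (simp add: matrix_rep_def)
  have "(rep_operator G S n \<rho> w *\<^sub>v u) $ i = (\<Sum>j\<in>{0..<n}. rep_operator G S n \<rho> w $$ (i, j) * u $ j)"
    using i u carrier_matD[OF rep_operator_carrier, of n \<rho> w] by (auto simp: scalar_prod_def intro!: sum.cong)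
  also have "\<dots> = (\<Sum>j\<in>{0..<n}. - (\<Sum>s\<in>S. wt w s * (\<rho> s $$ (i, j) - 1\<^sub>m n $$ (i, j))) * u $ j)"
    using i by (intro sum.cong) (simp_all add: rep_operator_def wt_def r1)
  also have "\<dots> = - (\<Sum>s\<in>S. wt w s * ((\<Sum>j\<in>{0..<n}. \<rho> s $$ (i, j) * u $ j) -
      (\<Sum>j\<in>{0..<n}. 1\<^sub>m n $$ (i, j) * u $ j)))"
    by (rule sum_weighted_difference)
  also have "\<dots> = - (\<Sum>s\<in>S. wt w s * ((\<rho> s *\<^sub>v u) $ i - u $ i))"
  proof (rule arg_cong[where f=uminus], rule sum.cong[OF refl])
    fix s assume s: "s \<in> S"
    have a: "(\<Sum>j\<in>{0..<n}. \<rho> s $$ (i, j) * u $ j) = (\<rho> s *\<^sub>v u) $ i"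
      using r[OF s] i u by (auto simp: scalar_prod_def)
    have "(\<Sum>j\<in>{0..<n}. 1\<^sub>m n $$ (i, j) * u $ j) = (\<Sum>j\<in>{0..<n}. if i = j then u $ j else 0)"
      using i by (intro sum.cong) auto
    also have "\<dots> = u $ i" using i by (simp add: sum.delta')
    finally have b: "(\<Sum>j\<in>{0..<n}. 1\<^sub>m n $$ (i, j) * u $ j) = u $ i" .
    show "wt w s * ((\<Sum>j\<in>{0..<n}. \<rho> s $$ (i, j) * u $ j) - (\<Sum>j\<in>{0..<n}. 1\<^sub>m n $$ (i, j) * u $ j)) =
      wt w s * ((\<rho> s *\<^sub>v u) $ i - u $ i)"
      unfolding a b ..
  qed
  finally show ?thesis .
qed

lemma scalar_prod_rep_operator:
  assumes rep: "matrix_rep G n \<rho>" and u: "u \<in> carrier_vec n"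
  shows "\<psi> \<bullet> (rep_operator G S n \<rho> w *\<^sub>v u) = - (\<Sum>s\<in>S. wt w s * (\<psi> \<bullet> (\<rho> s *\<^sub>v u) - \<psi> \<bullet> u))"
proof -
  have r: "\<rho> s \<in> carrier_mat n n" if "s \<in> S" for s using rep that by (simp add: matrix_rep_def)
  have "\<psi> \<bullet> (rep_operator G S n \<rho> w *\<^sub>v u) =
    (\<Sum>i\<in>{0..<n}. - (\<Sum>s\<in>S. wt w s * ((\<rho> s *\<^sub>v u) $ i - u $ i)) * \<psi> $ i)"
    unfolding scalar_prod_def using rep_operator_act[OF rep u] carrier_matD[OF rep_operator_carrier, of n \<rho> w]
    by (auto simp: mult.commute simp del: index_mult_mat_vec intro!: sum.cong)
  also have "\<dots> = - (\<Sum>s\<in>S. wt w s * ((\<Sum>i\<in>{0..<n}. (\<rho> s *\<^sub>v u) $ i * \<psi> $ i) -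
      (\<Sum>i\<in>{0..<n}. u $ i * \<psi> $ i)))"
    by (rule sum_weighted_difference)
  also have "\<dots> = - (\<Sum>s\<in>S. wt w s * (\<psi> \<bullet> (\<rho> s *\<^sub>v u) - \<psi> \<bullet> u))"
  proof (rule arg_cong[where f=uminus], rule sum.cong[OF refl])
    fix s assume s: "s \<in> S"
    have "\<psi> \<bullet> (\<rho> s *\<^sub>v u) = (\<Sum>i\<in>{0..<n}. (\<rho> s *\<^sub>v u) $ i * \<psi> $ i)"
      unfolding scalar_prod_def using r[OF s] by (intro sum.cong) (auto simp: mult.commute)
    moreover have "\<psi> \<bullet> u = (\<Sum>i\<in>{0..<n}. u $ i * \<psi> $ i)"
      unfolding scalar_prod_def using u by (intro sum.cong) (auto simp: mult.commute)
    ultimately show "wt w s * ((\<Sum>i\<in>{0..<n}. (\<rho> s *\<^sub>v u) $ i * \<psi> $ i) - (\<Sum>i\<in>{0..<n}. u $ i * \<psi> $ i)) =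
      wt w s * (\<psi> \<bullet> (\<rho> s *\<^sub>v u) - \<psi> \<bullet> u)"
      by simp
  qed
  finally show ?thesis .
qed

text \<open>The matrix coefficient map \<open>v \<mapsto> (x \<mapsto> \<psi>(\<rho>(x\<^sup>-\<^sup>1) v))\<close> attached to the linear form
  \<open>\<psi>\<close>.\<close>

definition coef_map :: "nat \<Rightarrow> ('a \<Rightarrow> complex mat) \<Rightarrow> complex vec \<Rightarrow> complex mat"
  where "coef_map n \<rho> \<psi> = mat N n (\<lambda>(i, j). \<psi> \<bullet> col (\<rho> (inv (elt i))) j)"

lemma coef_map_carrier[simp]: "coef_map n \<rho> \<psi> \<in> carrier_mat N n" by (simp add: coef_map_def)

lemma coef_map_act:
  assumes rep: "matrix_rep G n \<rho>" and p: "\<psi> \<in> carrier_vec n" and v: "v \<in> carrier_vec n" and i: "i < N"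
  shows "(coef_map n \<rho> \<psi> *\<^sub>v v) $ i = \<psi> \<bullet> (\<rho> (inv (elt i)) *\<^sub>v v)"
proof -
  have r: "\<rho> (inv (elt i)) \<in> carrier_mat n n" using rep i by (simp add: matrix_rep_def)
  have "row (coef_map n \<rho> \<psi>) i = transpose_mat (\<rho> (inv (elt i))) *\<^sub>v \<psi>"
    using i p r by (intro eq_vecI) (auto simp: coef_map_def comm_scalar_prod[of \<psi> n])
  then have "(coef_map n \<rho> \<psi> *\<^sub>v v) $ i = (transpose_mat (\<rho> (inv (elt i))) *\<^sub>v \<psi>) \<bullet> v"
    using i by (simp add: coef_map_def)
  also have "\<dots> = \<psi> \<bullet> (\<rho> (inv (elt i)) *\<^sub>v v)" by (rule transpose_vec_mult_scalar[OF r v p])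
  finally show ?thesis .
qed

lemma coef_map_act_one:
  assumes rep: "matrix_rep G n \<rho>" and p: "\<psi> \<in> carrier_vec n" and v: "v \<in> carrier_vec n"
  shows "(coef_map n \<rho> \<psi> *\<^sub>v v) $ idx \<one> = \<psi> \<bullet> v"
  using coef_map_act[OF assms, of "idx \<one>"] rep v by (simp add: matrix_rep_def)

lemma coef_map_intertwiner:
  assumes rep: "matrix_rep G n \<rho>" and p: "\<psi> \<in> carrier_vec n"
  shows "intertwiner G n \<rho> N reg (coef_map n \<rho> \<psi>)"
proof (rule intertwinerI)
  show "\<rho> g \<in> carrier_mat n n" if "g \<in> carrier G" for g using rep that by (simp add: matrix_rep_def)
  note r = this
  fix g v assume g: "g \<in> carrier G" and v: "(v :: complex vec) \<in> carrier_vec n"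
  have ev: "coef_map n \<rho> \<psi> *\<^sub>v v \<in> carrier_vec N" using mult_mat_vec_carrier[OF coef_map_carrier v] .
  have gv: "\<rho> g *\<^sub>v v \<in> carrier_vec n" using mult_mat_vec_carrier[OF r[OF g] v] .
  show "coef_map n \<rho> \<psi> *\<^sub>v (\<rho> g *\<^sub>v v) = reg g *\<^sub>v (coef_map n \<rho> \<psi> *\<^sub>v v)"
  proof (rule eq_vecI)
    fix i assume "i < dim_vec (reg g *\<^sub>v (coef_map n \<rho> \<psi> *\<^sub>v v))"
    then have i: "i < N" by (simp add: reg_def)
    have "inv (inv g \<otimes> elt i) = inv (elt i) \<otimes> g" using g i by (simp add: inv_mult_group)
    moreover have "\<rho> (inv (elt i) \<otimes> g) = \<rho> (inv (elt i)) * \<rho> g" using rep g i by (simp add: matrix_rep_def)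
    moreover have "\<rho> (inv (elt i)) * \<rho> g *\<^sub>v v = \<rho> (inv (elt i)) *\<^sub>v (\<rho> g *\<^sub>v v)"
      using assoc_mult_mat_vec[OF r r[OF g] v] i by simp
    ultimately show "(coef_map n \<rho> \<psi> *\<^sub>v (\<rho> g *\<^sub>v v)) $ i = (reg g *\<^sub>v (coef_map n \<rho> \<psi> *\<^sub>v v)) $ i"
      using coef_map_act[OF rep p gv i] reg_act[OF g ev i] coef_map_act[OF rep p v, of "idx (inv g \<otimes> elt i)"] g i by simp
  qed (simp add: coef_map_def reg_def)
qed auto

text \<open>Frobenius reciprocity: a \<open>G\<close>-map \<open>T\<close> into the functions on \<open>G\<close> is determined by the linear form
  \<open>v \<mapsto> (T v)(1)\<close>, because \<open>(T v)(x) = (x\<^sup>-\<^sup>1 \<cdot> T v)(1) = (T (\<rho>(x\<^sup>-\<^sup>1) v))(1)\<close>.\<close>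

lemma intertwiner_eq_coef_map:
  assumes rep: "matrix_rep G n \<rho>" and T: "intertwiner G n \<rho> N reg T"
  shows "T = coef_map n \<rho> (row T (idx \<one>))"
proof (rule mat_eq_by_action[of _ N n])
  note t = intertwinerD[OF T]
  have p: "row T (idx \<one>) \<in> carrier_vec n" using t(1) by auto
  fix v :: "complex vec" assume v: "v \<in> carrier_vec n"
  show "T *\<^sub>v v = coef_map n \<rho> (row T (idx \<one>)) *\<^sub>v v"
  proof (rule eq_vecI)
    fix i assume "i < dim_vec (coef_map n \<rho> (row T (idx \<one>)) *\<^sub>v v)"
    then have i: "i < N" by (simp add: coef_map_def)
    let ?g = "inv (elt i)"
    have g: "?g \<in> carrier G" using i by simp
    have Tv: "T *\<^sub>v v \<in> carrier_vec N" using t(1) v by auto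
    have "row T (idx \<one>) \<bullet> (\<rho> ?g *\<^sub>v v) = (T *\<^sub>v (\<rho> ?g *\<^sub>v v)) $ idx \<one>" using t(1) by simp
    also have "\<dots> = (reg ?g *\<^sub>v (T *\<^sub>v v)) $ idx \<one>" using intertwiner_act[OF T g v] by simp
    also have "\<dots> = (T *\<^sub>v v) $ i" using reg_act[OF g Tv, of "idx \<one>"] i by simp
    finally show "(T *\<^sub>v v) $ i = (coef_map n \<rho> (row T (idx \<one>)) *\<^sub>v v) $ i" using coef_map_act[OF rep p v i] by simp
  qed (use t(1) in \<open>auto simp: coef_map_def\<close>)
qed (use intertwinerD[OF T] in auto)

lemma coef_map_inject:
  assumes rep: "matrix_rep G n \<rho>" and p: "\<psi> \<in> carrier_vec n" "\<phi> \<in> carrier_vec n"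
    and eq: "\<And>v. v \<in> carrier_vec n \<Longrightarrow> coef_map n \<rho> \<psi> *\<^sub>v v = coef_map n \<rho> \<phi> *\<^sub>v v"
  shows "\<psi> = \<phi>"
proof (rule eq_vecI)
  fix j assume "j < dim_vec \<phi>"
  then have j: "j < n" using p by simp
  have "\<psi> \<bullet> unit_vec n j = \<phi> \<bullet> unit_vec n j"
    using coef_map_act_one[OF rep p(1), of "unit_vec n j"] coef_map_act_one[OF rep p(2), of "unit_vec n j"] eq[of "unit_vec n j"] by simp
  then show "\<psi> $ j = \<phi> $ j" using p j by (simp add: scalar_prod_right_unit)
qed (use p in auto)

text \<open>The Laplacian acts on functions from the right, so on matrix coefficients it acts on the form \<open>\<psi>\<close>.
  Since \<open>S\<close> and the weights are symmetric, the action is by the transpose of \<open>D\<^sub>W\<close> itself.\<close>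

lemma lap_coef_map:
  assumes rep: "matrix_rep G n \<rho>" and p: "\<psi> \<in> carrier_vec n" and v: "v \<in> carrier_vec n"
  shows "lap w *\<^sub>v (coef_map n \<rho> \<psi> *\<^sub>v v) = coef_map n \<rho> (transpose_mat (rep_operator G S n \<rho> w) *\<^sub>v \<psi>) *\<^sub>v v"
proof (rule eq_vecI)
  let ?D = "rep_operator G S n \<rho> w"
  have r: "\<rho> g \<in> carrier_mat n n" if "g \<in> carrier G" for g using rep that by (simp add: matrix_rep_def)
  fix i assume "i < dim_vec (coef_map n \<rho> (transpose_mat ?D *\<^sub>v \<psi>) *\<^sub>v v)"
  then have i: "i < N" by (simp add: coef_map_def)
  define u where "u = \<rho> (inv (elt i)) *\<^sub>v v"
  have u: "u \<in> carrier_vec n" using mult_mat_vec_carrier[OF r v] i by (simp add: u_def)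
  have ev: "coef_map n \<rho> \<psi> *\<^sub>v v \<in> carrier_vec N" using mult_mat_vec_carrier[OF coef_map_carrier v] .
  have Dp: "transpose_mat ?D *\<^sub>v \<psi> \<in> carrier_vec n" by (rule mult_mat_vec_carrier[of _ n n]) (use p in auto)
  have step: "(coef_map n \<rho> \<psi> *\<^sub>v v) $ idx (elt i \<otimes> s) = \<psi> \<bullet> (\<rho> (inv s) *\<^sub>v u)" if s: "s \<in> S" for s
  proof -
    have "inv (elt i \<otimes> s) = inv s \<otimes> inv (elt i)" using i s by (simp add: inv_mult_group)
    moreover have "\<rho> (inv s \<otimes> inv (elt i)) = \<rho> (inv s) * \<rho> (inv (elt i))"
      using rep i s by (simp add: matrix_rep_def)
    moreover have "\<rho> (inv s) * \<rho> (inv (elt i)) *\<^sub>v v = \<rho> (inv s) *\<^sub>v u"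
      unfolding u_def by (rule assoc_mult_mat_vec[OF r r v]) (use i s in auto)
    ultimately show ?thesis using coef_map_act[OF rep p v, of "idx (elt i \<otimes> s)"] i s by simp
  qed
  have "(lap w *\<^sub>v (coef_map n \<rho> \<psi> *\<^sub>v v)) $ i = - (\<Sum>s\<in>S. wt w s * (\<psi> \<bullet> (\<rho> (inv s) *\<^sub>v u) - \<psi> \<bullet> u))"
    using lap_act[OF ev i] step coef_map_act[OF rep p v i] by (simp add: u_def)
  also have "(\<Sum>s\<in>S. wt w s * (\<psi> \<bullet> (\<rho> (inv s) *\<^sub>v u) - \<psi> \<bullet> u)) =
    (\<Sum>s\<in>S. wt w (inv s) * (\<psi> \<bullet> (\<rho> (inv s) *\<^sub>v u) - \<psi> \<bullet> u))"
    using wt_inv by simp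
  also have "\<dots> = (\<Sum>s\<in>S. wt w s * (\<psi> \<bullet> (\<rho> s *\<^sub>v u) - \<psi> \<bullet> u))" by (rule sum_inverses)
  also have "- \<dots> = \<psi> \<bullet> (?D *\<^sub>v u)" using scalar_prod_rep_operator[OF rep u] by simp
  also have "\<dots> = (transpose_mat ?D *\<^sub>v \<psi>) \<bullet> u"
    by (rule transpose_vec_mult_scalar[symmetric, OF rep_operator_carrier u p])
  also have "\<dots> = (coef_map n \<rho> (transpose_mat ?D *\<^sub>v \<psi>) *\<^sub>v v) $ i"
    using coef_map_act[OF rep Dp v i] by (simp add: u_def)
  finally show "(lap w *\<^sub>v (coef_map n \<rho> \<psi> *\<^sub>v v)) $ i = (coef_map n \<rho> (transpose_mat ?D *\<^sub>v \<psi>) *\<^sub>v v) $ i" .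
qed (simp add: coef_map_def)

lemma coef_map_diff_smult:
  assumes rep: "matrix_rep G n \<rho>" and p: "\<psi> \<in> carrier_vec n" "\<phi> \<in> carrier_vec n" and v: "v \<in> carrier_vec n"
  shows "coef_map n \<rho> (\<psi> - c \<cdot>\<^sub>v \<phi>) *\<^sub>v v = coef_map n \<rho> \<psi> *\<^sub>v v - c \<cdot>\<^sub>v (coef_map n \<rho> \<phi> *\<^sub>v v)"
proof (rule eq_vecI)
  fix i assume "i < dim_vec (coef_map n \<rho> \<psi> *\<^sub>v v - c \<cdot>\<^sub>v (coef_map n \<rho> \<phi> *\<^sub>v v))"
  then have i: "i < N" by (simp add: coef_map_def)
  let ?u = "\<rho> (inv (elt i)) *\<^sub>v v"
  have u: "?u \<in> carrier_vec n"
    using rep i v by (intro mult_mat_vec_carrier[of _ n n]) (auto simp: matrix_rep_def)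
  have d: "dim_row (coef_map n \<rho> \<psi>) = N" "dim_row (coef_map n \<rho> \<phi>) = N" by (auto simp: coef_map_def)
  have "(coef_map n \<rho> (\<psi> - c \<cdot>\<^sub>v \<phi>) *\<^sub>v v) $ i = \<psi> \<bullet> ?u - c * (\<phi> \<bullet> ?u)"
    using coef_map_act[OF rep _ v i, of "\<psi> - c \<cdot>\<^sub>v \<phi>"] p u
      minus_scalar_prod_distrib[of \<psi> n "c \<cdot>\<^sub>v \<phi>" ?u] by simp
  also have "\<dots> = (coef_map n \<rho> \<psi> *\<^sub>v v - c \<cdot>\<^sub>v (coef_map n \<rho> \<phi> *\<^sub>v v)) $ i"
    using coef_map_act[OF rep p(1) v i] coef_map_act[OF rep p(2) v i] i d by (simp del: index_mult_mat_vec)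
  finally show "(coef_map n \<rho> (\<psi> - c \<cdot>\<^sub>v \<phi>) *\<^sub>v v) $ i = (coef_map n \<rho> \<psi> *\<^sub>v v - c \<cdot>\<^sub>v (coef_map n \<rho> \<phi> *\<^sub>v v)) $ i" .
qed (simp add: coef_map_def)

text \<open>Under the correspondence between linear forms and \<open>G\<close>-maps these are the \<open>G\<close>-maps into the eigenspace
  of the Laplacian.\<close>

definition dual_evecs :: "nat \<Rightarrow> ('a \<Rightarrow> complex mat) \<Rightarrow> ('a set \<Rightarrow> real) \<Rightarrow> complex \<Rightarrow> complex vec set"
  where "dual_evecs n \<rho> w \<mu> = {\<psi> \<in> carrier_vec n. transpose_mat (rep_operator G S n \<rho> w) *\<^sub>v \<psi> = \<mu> \<cdot>\<^sub>v \<psi>}"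

lemma coef_map_smult:
  assumes "matrix_rep G n \<rho>" "\<psi> \<in> carrier_vec n" "v \<in> carrier_vec n"
  shows "coef_map n \<rho> (c \<cdot>\<^sub>v \<psi>) *\<^sub>v v = c \<cdot>\<^sub>v (coef_map n \<rho> \<psi> *\<^sub>v v)"
proof (rule eq_vecI)
  fix i assume "i < dim_vec (c \<cdot>\<^sub>v (coef_map n \<rho> \<psi> *\<^sub>v v))"
  then have i: "i < N" by (simp add: coef_map_def)
  have u: "\<rho> (inv (elt i)) *\<^sub>v v \<in> carrier_vec n"
    using assms i by (intro mult_mat_vec_carrier[of _ n n]) (auto simp: matrix_rep_def)
  have d: "dim_row (coef_map n \<rho> \<psi>) = N" by (auto simp: coef_map_def)
  show "(coef_map n \<rho> (c \<cdot>\<^sub>v \<psi>) *\<^sub>v v) $ i = (c \<cdot>\<^sub>v (coef_map n \<rho> \<psi> *\<^sub>v v)) $ i"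
    using coef_map_act[OF assms i] coef_map_act[OF assms(1) _ assms(3) i, of "c \<cdot>\<^sub>v \<psi>"] assms u i d
    by (simp del: index_mult_mat_vec)
qed (simp add: coef_map_def)

lemma coef_map_range_eigenspace_iff:
  assumes rep: "matrix_rep G n \<rho>" and p: "\<psi> \<in> carrier_vec n"
  shows "mat_range (coef_map n \<rho> \<psi>) \<subseteq> eigenspace w \<mu> \<longleftrightarrow> \<psi> \<in> dual_evecs n \<rho> w \<mu>"
proof -
  let ?D = "transpose_mat (rep_operator G S n \<rho> w)"
  have Dp: "?D *\<^sub>v \<psi> \<in> carrier_vec n" by (rule mult_mat_vec_carrier[of _ n n]) (use p in auto)
  have "mat_range (coef_map n \<rho> \<psi>) \<subseteq> eigenspace w \<mu> \<longleftrightarrow>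
    (\<forall>v\<in>carrier_vec n. coef_map n \<rho> \<psi> *\<^sub>v v \<in> eigenspace w \<mu>)"
    by (auto simp: mat_range_def coef_map_def)
  also have "\<dots> \<longleftrightarrow> (\<forall>v\<in>carrier_vec n. coef_map n \<rho> (?D *\<^sub>v \<psi>) *\<^sub>v v = coef_map n \<rho> (\<mu> \<cdot>\<^sub>v \<psi>) *\<^sub>v v)"
    using lap_coef_map[OF rep p] coef_map_smult[OF rep p] mult_mat_vec_carrier[OF coef_map_carrier]
    by (auto simp: eigenspace_def)
  also have "\<dots> \<longleftrightarrow> ?D *\<^sub>v \<psi> = \<mu> \<cdot>\<^sub>v \<psi>"
    using coef_map_inject[OF rep Dp, of "\<mu> \<cdot>\<^sub>v \<psi>"] p by auto
  finally show ?thesis using p by (simp add: dual_evecs_def)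
qed

text \<open>The dimension of the space of \<open>G\<close>-maps into the eigenspace is the multiplicity of \<open>\<mu>\<close> as a root of
  \<open>P\<^sub>W(w)\<close>: as \<open>coef_map\<close> is injective and carries the transpose of \<open>D\<^sub>W\<close> to the Laplacian, the former
  inherits semisimplicity from the latter, and it has the same characteristic polynomial as \<open>D\<^sub>W\<close>.\<close>

lemma dual_evecs_basis:
  assumes rep: "matrix_rep G n \<rho>" and real: "\<mu> \<in> \<real>"
  obtains C where "C \<in> carrier_mat n (Polynomial.order \<mu> (rep_char_poly G S n \<rho> w))" "inj_mat C"
    "mat_range C = dual_evecs n \<rho> w \<mu>"
proof -
  let ?D = "transpose_mat (rep_operator G S n \<rho> w)"
  have D: "?D \<in> carrier_mat n n" by simp
  have ss: "char_matrix ?D \<mu> *\<^sub>v \<psi> = 0\<^sub>v n"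
    if p: "\<psi> \<in> carrier_vec n" and sq: "char_matrix ?D \<mu> *\<^sub>v (char_matrix ?D \<mu> *\<^sub>v \<psi>) = 0\<^sub>v n" for \<psi>
  proof -
    have Dp: "?D *\<^sub>v \<psi> \<in> carrier_vec n" using mult_mat_vec_carrier[OF D p] .
    define \<phi> where "\<phi> = ?D *\<^sub>v \<psi> - \<mu> \<cdot>\<^sub>v \<psi>"
    have ph: "\<phi> \<in> carrier_vec n" using Dp p by (simp add: \<phi>_def)
    have e1: "char_matrix ?D \<mu> *\<^sub>v \<psi> = \<phi>" unfolding \<phi>_def by (rule char_matrix_mult_vec[OF D p])
    have Dph: "?D *\<^sub>v \<phi> = \<mu> \<cdot>\<^sub>v \<phi>"
      using sq unfolding e1 char_matrix_mult_vec[OF D ph]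
      using vec_diff_eq_0_iff[OF mult_mat_vec_carrier[OF D ph], of "\<mu> \<cdot>\<^sub>v \<phi>"] ph by simp
    have "coef_map n \<rho> (?D *\<^sub>v \<psi>) *\<^sub>v v = coef_map n \<rho> (\<mu> \<cdot>\<^sub>v \<psi>) *\<^sub>v v" if v: "v \<in> carrier_vec n" for v
    proof -
      let ?f = "coef_map n \<rho> \<psi> *\<^sub>v v"
      have f: "?f \<in> carrier_vec N" using mult_mat_vec_carrier[OF coef_map_carrier v] .
      have g: "lap w *\<^sub>v ?f - \<mu> \<cdot>\<^sub>v ?f = coef_map n \<rho> \<phi> *\<^sub>v v"
        unfolding \<phi>_def lap_coef_map[OF rep p v] by (rule coef_map_diff_smult[OF rep Dp p v, symmetric])
      have "lap w *\<^sub>v (coef_map n \<rho> \<phi> *\<^sub>v v) = \<mu> \<cdot>\<^sub>v (coef_map n \<rho> \<phi> *\<^sub>v v)"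
        unfolding lap_coef_map[OF rep ph v] Dph by (rule coef_map_smult[OF rep ph v])
      then have "lap w *\<^sub>v ?f = \<mu> \<cdot>\<^sub>v ?f" using lap_semisimple[OF real f] g by simp
      then show ?thesis unfolding lap_coef_map[OF rep p v] coef_map_smult[OF rep p v] .
    qed
    then have "?D *\<^sub>v \<psi> = \<mu> \<cdot>\<^sub>v \<psi>" using coef_map_inject[OF rep Dp, of "\<mu> \<cdot>\<^sub>v \<psi>"] p by simp
    then show ?thesis unfolding e1 \<phi>_def using vec_diff_eq_0_iff[OF Dp, of "\<mu> \<cdot>\<^sub>v \<psi>"] p by simp
  qed
  obtain C where "C \<in> carrier_mat n (Polynomial.order \<mu> (char_poly ?D))" "inj_mat C"
    "mat_range C = {v \<in> carrier_vec n. ?D *\<^sub>v v = \<mu> \<cdot>\<^sub>v v}"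
    using semisimple_order_eigenspace[OF D ss] by metis
  moreover have "char_poly ?D = rep_char_poly G S n \<rho> w"
    unfolding rep_char_poly_def by (rule char_poly_transpose_mat[of _ n]) simp
  ultimately show thesis using that by (simp add: dual_evecs_def)
qed

end

lemma mat_range_append_col:
  assumes C: "C \<in> carrier_mat n m" and v: "v \<in> carrier_vec n"
  shows "mat_range (append_col C v) = {c + a \<cdot>\<^sub>v v | c a. c \<in> mat_range C}"
proof
  have car: "append_col C v \<in> carrier_mat n (Suc m)" using C by simp
  show "mat_range (append_col C v) \<subseteq> {c + a \<cdot>\<^sub>v v | c a. c \<in> mat_range C}"
  proof
    fix x assume "x \<in> mat_range (append_col C v)"
    then obtain u where u: "u \<in> carrier_vec (Suc m)" "x = append_col C v *\<^sub>v u" using mat_rangeE car by blast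
    have "C *\<^sub>v vec m (($) u) \<in> mat_range C" by (rule mat_rangeI[OF C]) simp
    then show "x \<in> {c + a \<cdot>\<^sub>v v | c a. c \<in> mat_range C}"
      using append_col_mult[OF C v u(1)] u(2) by blast
  qed
  show "{c + a \<cdot>\<^sub>v v | c a. c \<in> mat_range C} \<subseteq> mat_range (append_col C v)"
  proof
    fix x assume "x \<in> {c + a \<cdot>\<^sub>v v | c a. c \<in> mat_range C}"
    then obtain c a where ca: "c \<in> mat_range C" "x = c + a \<cdot>\<^sub>v v" by blast
    obtain u where u: "u \<in> carrier_vec m" "c = C *\<^sub>v u" using mat_rangeE[OF ca(1) C] by metis
    define u' where "u' = vec (Suc m) (\<lambda>i. if i < m then u $ i else a)"
    have u': "u' \<in> carrier_vec (Suc m)" by (simp add: u'_def)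
    have "vec m (($) u') = u" using u(1) by (intro eq_vecI) (auto simp: u'_def)
    moreover have "u' $ m = a" by (simp add: u'_def)
    ultimately have "append_col C v *\<^sub>v u' = x" using append_col_mult[OF C v u'] ca u by simp
    then show "x \<in> mat_range (append_col C v)" using mat_rangeI[OF car u'] by simp
  qed
qed

lemma mat_range_empty: "mat_range (0\<^sub>m n 0 :: 'a :: field mat) = {0\<^sub>v n}"
proof -
  have "0\<^sub>m n 0 *\<^sub>v u = 0\<^sub>v n" if "u \<in> carrier_vec 0" for u :: "'a vec"
    using that by (intro eq_vecI) (auto simp: scalar_prod_def)
  then have "x = 0\<^sub>v n" if "x \<in> mat_range (0\<^sub>m n 0)" for x :: "'a vec"
    using mat_rangeE[OF that zero_carrier_mat] by metis
  moreover have "0\<^sub>v n \<in> mat_range (0\<^sub>m n 0 :: 'a mat)"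
    using lin_subspaceD(2)[OF lin_subspace_mat_range[OF zero_carrier_mat]] .
  ultimately show ?thesis by blast
qed

lemma inj_empty: "inj_mat (0\<^sub>m n 0 :: 'a :: field mat)" by (auto simp: inj_mat_def)

definition single_col :: "nat \<Rightarrow> 'a :: field vec \<Rightarrow> 'a mat" where "single_col n v = append_col (0\<^sub>m n 0) v"

lemma single_col:
  fixes v :: "'a :: field vec"
  assumes v: "v \<in> carrier_vec n"
  shows "single_col n v \<in> carrier_mat n 1" "mat_range (single_col n v) = {a \<cdot>\<^sub>v v | a. True}"
    "v \<noteq> 0\<^sub>v n \<Longrightarrow> inj_mat (single_col n v)"
proof -
  show "single_col n v \<in> carrier_mat n 1" unfolding single_col_def using append_col_carrier[of "0\<^sub>m n 0" n 0 v] by simp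
  have "0\<^sub>v n + a \<cdot>\<^sub>v v = a \<cdot>\<^sub>v v" for a using v by simp
  then show "mat_range (single_col n v) = {a \<cdot>\<^sub>v v | a. True}"
    unfolding single_col_def mat_range_append_col[OF zero_carrier_mat v] mat_range_empty by auto
  assume "v \<noteq> 0\<^sub>v n"
  then show "inj_mat (single_col n v)" unfolding single_col_def
    by (intro inj_append_col[OF inj_empty zero_carrier_mat v]) (simp add: mat_range_empty)
qed

lemma two_cols:
  fixes v :: "'a :: field vec"
  assumes v: "v \<in> carrier_vec n" "u \<in> carrier_vec n"
  shows "append_col (single_col n v) u \<in> carrier_mat n 2"
    "mat_range (append_col (single_col n v) u) = {a \<cdot>\<^sub>v v + b \<cdot>\<^sub>v u | a b. True}"
  using append_col_carrier[OF single_col(1)[OF v(1)], of u]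
  by (auto simp: mat_range_append_col[OF single_col(1)[OF v(1)] v(2)] single_col(2)[OF v(1)] numeral_2_eq_2)

context cayley
begin

subsection \<open>Multiplicities\<close>

lemma order_ge_of_inj:
  assumes rep: "matrix_rep G n \<rho>" and real: "\<mu> \<in> \<real>"
    and W: "W \<in> carrier_mat n r" "inj_mat W" "mat_range W \<subseteq> dual_evecs n \<rho> w \<mu>"
  shows "r \<le> Polynomial.order \<mu> (rep_char_poly G S n \<rho> w)"
proof -
  obtain C where C: "C \<in> carrier_mat n (Polynomial.order \<mu> (rep_char_poly G S n \<rho> w))" "mat_range C = dual_evecs n \<rho> w \<mu>"
    using dual_evecs_basis[OF rep real] by metis
  obtain Y where Y: "Y \<in> carrier_mat (Polynomial.order \<mu> (rep_char_poly G S n \<rho> w)) r" "W = C * Y"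
    using mat_range_factor[OF C(1) W(1)] W(3) mat_rangeI[OF W(1)] C(2) by blast
  have "inj_mat Y" using inj_mat_right_factor[OF _ C(1) Y(1)] W(2) Y(2) by simp
  then show ?thesis using inj_mat_dim_le Y(1) by blast
qed

lemma order_le_of_range:
  assumes rep: "matrix_rep G n \<rho>" and real: "\<mu> \<in> \<real>"
    and W: "W \<in> carrier_mat n r" "dual_evecs n \<rho> w \<mu> \<subseteq> mat_range W"
  shows "Polynomial.order \<mu> (rep_char_poly G S n \<rho> w) \<le> r"
proof -
  obtain C where C: "C \<in> carrier_mat n (Polynomial.order \<mu> (rep_char_poly G S n \<rho> w))" "inj_mat C"
    "mat_range C = dual_evecs n \<rho> w \<mu>"
    using dual_evecs_basis[OF rep real] by metis
  obtain Y where Y: "Y \<in> carrier_mat r (Polynomial.order \<mu> (rep_char_poly G S n \<rho> w))" "C = W * Y"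
    using mat_range_factor[OF W(1) C(1)] W(2) mat_rangeI[OF C(1)] C(3) by blast
  have "inj_mat Y" using inj_mat_right_factor[OF _ W(1) Y(1)] C(2) Y(2) by simp
  then show ?thesis using inj_mat_dim_le Y(1) by blast
qed

lemma dual_evecs_subspace: "lin_subspace n (dual_evecs n \<rho> w \<mu>)"
  unfolding dual_evecs_def by (rule lin_subspace_eigenvectors) simp

definition homs :: "nat \<Rightarrow> ('a \<Rightarrow> complex mat) \<Rightarrow> complex vec set \<Rightarrow> complex mat set"
  where "homs n \<rho> X = {T. intertwiner G n \<rho> N reg T \<and> mat_range T \<subseteq> X}"

lemma homsD:
  assumes "T \<in> homs n \<rho> X"
  shows "intertwiner G n \<rho> N reg T" "mat_range T \<subseteq> X" "T \<in> carrier_mat N n" "v \<in> carrier_vec n \<Longrightarrow> T *\<^sub>v v \<in> X"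
  using assms mat_rangeI[of T N n v] by (auto simp: homs_def intertwiner_def)

lemma homsI:
  assumes "intertwiner G n \<rho> N reg T" "\<And>v. v \<in> carrier_vec n \<Longrightarrow> T *\<^sub>v v \<in> X"
  shows "T \<in> homs n \<rho> X"
  using assms by (auto simp: homs_def intertwiner_def mat_range_def)

lemma homs_mult:
  assumes T: "T \<in> homs n \<rho> X" and A: "intertwiner G m \<sigma> n \<rho> A" shows "T * A \<in> homs m \<sigma> X"
proof (rule homsI)
  show "intertwiner G m \<sigma> N reg (T * A)" by (rule intertwiner_mult[OF A homsD(1)[OF T]])
  fix v :: "complex vec" assume v: "v \<in> carrier_vec m"
  have "A *\<^sub>v v \<in> carrier_vec n" using mult_mat_vec_carrier[OF intertwinerD(1)[OF A] v] .
  then show "T * A *\<^sub>v v \<in> X"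
    using homsD(4)[OF T] assoc_mult_mat_vec[OF homsD(3)[OF T] intertwinerD(1)[OF A] v] by simp
qed

lemma homs_add:
  assumes X: "lin_subspace N X" and T: "T \<in> homs n \<rho> X" and U: "U \<in> homs n \<rho> X" shows "T + U \<in> homs n \<rho> X"
proof (rule homsI)
  show "intertwiner G n \<rho> N reg (T + U)" by (rule intertwiner_add[OF homsD(1)[OF T] homsD(1)[OF U]])
  fix v :: "complex vec" assume v: "v \<in> carrier_vec n"
  show "(T + U) *\<^sub>v v \<in> X"
    using add_mult_distrib_mat_vec[OF homsD(3)[OF T] homsD(3)[OF U] v] lin_subspaceD(3)[OF X]
      homsD(4)[OF T v] homsD(4)[OF U v] by simp
qed

lemma scalar_mat_mult_vec: "A \<in> carrier_mat m n \<Longrightarrow> v \<in> carrier_vec n \<Longrightarrow> (c \<cdot>\<^sub>m A) *\<^sub>v v = c \<cdot>\<^sub>v (A *\<^sub>v (v :: complex vec))"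
  by (intro eq_vecI) auto

lemma homs_smult:
  assumes X: "lin_subspace N X" and T: "T \<in> homs n \<rho> X" shows "c \<cdot>\<^sub>m T \<in> homs n \<rho> X"
proof (rule homsI)
  show "intertwiner G n \<rho> N reg (c \<cdot>\<^sub>m T)" by (rule intertwiner_smult[OF homsD(1)[OF T]])
  fix v :: "complex vec" assume v: "v \<in> carrier_vec n"
  show "(c \<cdot>\<^sub>m T) *\<^sub>v v \<in> X"
    unfolding scalar_mat_mult_vec[OF homsD(3)[OF T] v] using lin_subspaceD(4)[OF X] homsD(4)[OF T v] by simp
qed

lemma homs_mcnj:
  assumes T: "T \<in> homs n \<rho> X" and X: "\<And>f. f \<in> X \<Longrightarrow> vcnj f \<in> X"
  shows "mcnj T \<in> homs n (conj_rep \<rho>) X"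
proof (rule homsI)
  show "intertwiner G n (conj_rep \<rho>) N reg (mcnj T)"
    using intertwiner_mcnj[OF homsD(1)[OF T]] by (simp add: conj_rep_reg)
  fix v :: "complex vec" assume v: "v \<in> carrier_vec n"
  have "mcnj T *\<^sub>v v = vcnj (T *\<^sub>v vcnj v)" using vcnj_mult[OF homsD(3)[OF T], of "vcnj v"] v by simp
  then show "mcnj T *\<^sub>v v \<in> X" using X homsD(4)[OF T, of "vcnj v"] v by simp
qed

lemma row_coef_map:
  assumes rep: "matrix_rep G n \<rho>" and p: "\<psi> \<in> carrier_vec n"
  shows "row (coef_map n \<rho> \<psi>) (idx \<one>) = \<psi>"
proof -
  have "\<rho> (inv (elt (idx \<one>))) = 1\<^sub>m n" using rep by (simp add: matrix_rep_def)
  then show ?thesis using p by (intro eq_vecI) (auto simp: coef_map_def scalar_prod_right_unit)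
qed

lemma coef_map_lincomb:
  assumes rep: "matrix_rep G n \<rho>" and p: "\<psi> \<in> carrier_vec n" "\<phi> \<in> carrier_vec n"
  shows "coef_map n \<rho> (a \<cdot>\<^sub>v \<psi> + b \<cdot>\<^sub>v \<phi>) = a \<cdot>\<^sub>m coef_map n \<rho> \<psi> + b \<cdot>\<^sub>m coef_map n \<rho> \<phi>"
proof (rule eq_matI)
  fix i j assume "i < dim_row (a \<cdot>\<^sub>m coef_map n \<rho> \<psi> + b \<cdot>\<^sub>m coef_map n \<rho> \<phi>)" "j < dim_col (a \<cdot>\<^sub>m coef_map n \<rho> \<psi> + b \<cdot>\<^sub>m coef_map n \<rho> \<phi>)"
  then have ij: "i < N" "j < n" by (auto simp: coef_map_def)
  have c: "col (\<rho> (inv (elt i))) j \<in> carrier_vec n" using rep ij by (auto simp: matrix_rep_def intro!: col_carrier_vec)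
  show "coef_map n \<rho> (a \<cdot>\<^sub>v \<psi> + b \<cdot>\<^sub>v \<phi>) $$ (i, j) = (a \<cdot>\<^sub>m coef_map n \<rho> \<psi> + b \<cdot>\<^sub>m coef_map n \<rho> \<phi>) $$ (i, j)"
    using ij p c add_scalar_prod_distrib[of "a \<cdot>\<^sub>v \<psi>" n "b \<cdot>\<^sub>v \<phi>" "col (\<rho> (inv (elt i))) j"]
    by (simp add: coef_map_def)
qed (auto simp: coef_map_def)

lemma homs_eq_coef_map:
  assumes rep: "matrix_rep G n \<rho>"
  shows "T \<in> homs n \<rho> (eigenspace w \<mu>) \<Longrightarrow> row T (idx \<one>) \<in> dual_evecs n \<rho> w \<mu> \<and> T = coef_map n \<rho> (row T (idx \<one>))"
    and "\<psi> \<in> dual_evecs n \<rho> w \<mu> \<Longrightarrow> coef_map n \<rho> \<psi> \<in> homs n \<rho> (eigenspace w \<mu>)"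
proof -
  assume T: "T \<in> homs n \<rho> (eigenspace w \<mu>)"
  have e: "T = coef_map n \<rho> (row T (idx \<one>))" by (rule intertwiner_eq_coef_map[OF rep homsD(1)[OF T]])
  have c: "row T (idx \<one>) \<in> carrier_vec n" using homsD(3)[OF T] by auto
  have "mat_range (coef_map n \<rho> (row T (idx \<one>))) \<subseteq> eigenspace w \<mu>" using homsD(2)[OF T] e by simp
  then show "row T (idx \<one>) \<in> dual_evecs n \<rho> w \<mu> \<and> T = coef_map n \<rho> (row T (idx \<one>))"
    using coef_map_range_eigenspace_iff[OF rep c] e by simp
next
  assume p: "\<psi> \<in> dual_evecs n \<rho> w \<mu>"
  then have c: "\<psi> \<in> carrier_vec n" by (simp add: dual_evecs_def)
  then show "coef_map n \<rho> \<psi> \<in> homs n \<rho> (eigenspace w \<mu>)"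
    unfolding homs_def using coef_map_intertwiner[OF rep c] coef_map_range_eigenspace_iff[OF rep c] p by simp
qed

lemma coef_map_zero: assumes rep: "matrix_rep G n \<rho>" shows "coef_map n \<rho> (0\<^sub>v n) = 0\<^sub>m N n"
proof (rule eq_matI)
  fix i j assume "i < dim_row (0\<^sub>m N n :: complex mat)" "j < dim_col (0\<^sub>m N n :: complex mat)"
  then have ij: "i < N" "j < n" by auto
  have "col (\<rho> (inv (elt i))) j \<in> carrier_vec n" using rep ij by (auto simp: matrix_rep_def intro!: col_carrier_vec)
  then show "coef_map n \<rho> (0\<^sub>v n) $$ (i, j) = 0\<^sub>m N n $$ (i, j)" using ij by (simp add: coef_map_def)
qed (auto simp: coef_map_def)

text \<open>By \<open>dual_evecs_basis\<close>, independent \<open>G\<close>-maps into the eigenspace bound the multiplicity from below. Only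
  dimensions up to three occur, so independence is spelled out.\<close>

lemma order_ge_if_independent_homs:
  assumes rep: "matrix_rep G n \<rho>" and real: "\<mu> \<in> \<real>"
    and T: "T \<in> homs n \<rho> (eigenspace w \<mu>)" "T \<noteq> 0\<^sub>m N n"
    and U: "U \<in> homs n \<rho> (eigenspace w \<mu>)" "\<And>a. U \<noteq> a \<cdot>\<^sub>m T"
  shows "2 \<le> Polynomial.order \<mu> (rep_char_poly G S n \<rho> w)"
    and "V \<in> homs n \<rho> (eigenspace w \<mu>) \<Longrightarrow> (\<And>a b. V \<noteq> a \<cdot>\<^sub>m T + b \<cdot>\<^sub>m U) \<Longrightarrow>
      3 \<le> Polynomial.order \<mu> (rep_char_poly G S n \<rho> w)"
proof -
  let ?t = "row T (idx \<one>)" and ?u = "row U (idx \<one>)"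
  note t = homs_eq_coef_map(1)[OF rep T(1)] and u = homs_eq_coef_map(1)[OF rep U(1)]
  have tc: "?t \<in> carrier_vec n" and uc: "?u \<in> carrier_vec n" using t u by (auto simp: dual_evecs_def)
  have t0: "?t \<noteq> 0\<^sub>v n" using t T(2) coef_map_zero[OF rep] by metis
  have smult: "coef_map n \<rho> (a \<cdot>\<^sub>v \<psi>) = a \<cdot>\<^sub>m coef_map n \<rho> \<psi>" if "\<psi> \<in> carrier_vec n" for a \<psi>
  proof (rule mat_eq_by_action[of _ N n])
    fix v :: "complex vec" assume v: "v \<in> carrier_vec n"
    show "coef_map n \<rho> (a \<cdot>\<^sub>v \<psi>) *\<^sub>v v = (a \<cdot>\<^sub>m coef_map n \<rho> \<psi>) *\<^sub>v v"
      unfolding scalar_mat_mult_vec[OF coef_map_carrier v] by (rule coef_map_smult[OF rep that v])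
  qed auto
  have "?u \<noteq> a \<cdot>\<^sub>v ?t" for a using u t U(2)[of a] smult[OF tc] by metis
  then have notin: "?u \<notin> mat_range (single_col n ?t)" unfolding single_col(2)[OF tc] by blast
  have inj: "inj_mat (append_col (single_col n ?t) ?u)"
    by (rule inj_append_col[OF single_col(3)[OF tc t0] single_col(1)[OF tc] uc notin])
  have sub: "mat_range (append_col (single_col n ?t) ?u) \<subseteq> dual_evecs n \<rho> w \<mu>"
    unfolding two_cols(2)[OF tc uc] using lin_subspaceD(3,4)[OF dual_evecs_subspace] t u by blast
  show "2 \<le> Polynomial.order \<mu> (rep_char_poly G S n \<rho> w)"
    by (rule order_ge_of_inj[OF rep real two_cols(1)[OF tc uc] inj sub])
  assume V: "V \<in> homs n \<rho> (eigenspace w \<mu>)" and ind: "\<And>a b. V \<noteq> a \<cdot>\<^sub>m T + b \<cdot>\<^sub>m U"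
  let ?v = "row V (idx \<one>)"
  note v = homs_eq_coef_map(1)[OF rep V]
  have vc: "?v \<in> carrier_vec n" using v by (auto simp: dual_evecs_def)
  have "?v \<noteq> a \<cdot>\<^sub>v ?t + b \<cdot>\<^sub>v ?u" for a b
    using ind[of a b] coef_map_lincomb[OF rep tc uc, of a b] t u v by metis
  then have notin: "?v \<notin> mat_range (append_col (single_col n ?t) ?u)" unfolding two_cols(2)[OF tc uc] by blast
  have car: "append_col (append_col (single_col n ?t) ?u) ?v \<in> carrier_mat n (Suc 2)"
    by (rule append_col_carrier[OF two_cols(1)[OF tc uc]])
  have inj3: "inj_mat (append_col (append_col (single_col n ?t) ?u) ?v)"
    by (rule inj_append_col[OF inj two_cols(1)[OF tc uc] vc notin])
  have "mat_range (append_col (append_col (single_col n ?t) ?u) ?v) \<subseteq> dual_evecs n \<rho> w \<mu>"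
    unfolding mat_range_append_col[OF two_cols(1)[OF tc uc] vc]
    using lin_subspaceD(3,4)[OF dual_evecs_subspace] sub v by blast
  then show "3 \<le> Polynomial.order \<mu> (rep_char_poly G S n \<rho> w)"
    using order_ge_of_inj[OF rep real car inj3] by simp
qed

lemma order_ge_1_if_hom:
  assumes rep: "matrix_rep G n \<rho>" and real: "\<mu> \<in> \<real>"
    and T: "T \<in> homs n \<rho> (eigenspace w \<mu>)" "T \<noteq> 0\<^sub>m N n"
  shows "1 \<le> Polynomial.order \<mu> (rep_char_poly G S n \<rho> w)"
proof -
  let ?t = "row T (idx \<one>)"
  note t = homs_eq_coef_map(1)[OF rep T(1)]
  have tc: "?t \<in> carrier_vec n" using t by (auto simp: dual_evecs_def)
  have t0: "?t \<noteq> 0\<^sub>v n" using t T(2) coef_map_zero[OF rep] by metis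
  show ?thesis
    by (rule order_ge_of_inj[OF rep real single_col(1)[OF tc] single_col(3)[OF tc t0]])
      (use lin_subspaceD(4)[OF dual_evecs_subspace] t in \<open>auto simp: single_col(2)[OF tc]\<close>)
qed

lemma order_le_2_if_homs_spanned:
  assumes rep: "matrix_rep G n \<rho>" and real: "\<mu> \<in> \<real>" and T: "T \<in> carrier_mat N n" and U: "U \<in> carrier_mat N n"
    and span: "\<And>V. V \<in> homs n \<rho> (eigenspace w \<mu>) \<Longrightarrow> \<exists>a b. V = a \<cdot>\<^sub>m T + b \<cdot>\<^sub>m U"
  shows "Polynomial.order \<mu> (rep_char_poly G S n \<rho> w) \<le> 2"
proof -
  let ?t = "row T (idx \<one>)" and ?u = "row U (idx \<one>)"
  have tc: "?t \<in> carrier_vec n" and uc: "?u \<in> carrier_vec n" using T U by auto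
  have "dual_evecs n \<rho> w \<mu> \<subseteq> mat_range (append_col (single_col n ?t) ?u)"
  proof
    fix \<psi> assume p: "\<psi> \<in> dual_evecs n \<rho> w \<mu>"
    then have pc: "\<psi> \<in> carrier_vec n" by (simp add: dual_evecs_def)
    obtain a b where ab: "coef_map n \<rho> \<psi> = a \<cdot>\<^sub>m T + b \<cdot>\<^sub>m U" using span[OF homs_eq_coef_map(2)[OF rep p]] by blast
    have "\<psi> = row (a \<cdot>\<^sub>m T + b \<cdot>\<^sub>m U) (idx \<one>)" using row_coef_map[OF rep pc] ab by simp
    also have "\<dots> = a \<cdot>\<^sub>v ?t + b \<cdot>\<^sub>v ?u" using T U by (intro eq_vecI) auto
    finally show "\<psi> \<in> mat_range (append_col (single_col n ?t) ?u)" unfolding two_cols(2)[OF tc uc] by blast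
  qed
  then show ?thesis by (rule order_le_of_range[OF rep real two_cols(1)[OF tc uc]])
qed

lemma order_le_1_if_homs_spanned:
  assumes rep: "matrix_rep G n \<rho>" and real: "\<mu> \<in> \<real>" and T: "T \<in> carrier_mat N n"
    and span: "\<And>V. V \<in> homs n \<rho> (eigenspace w \<mu>) \<Longrightarrow> \<exists>a. V = a \<cdot>\<^sub>m T"
  shows "Polynomial.order \<mu> (rep_char_poly G S n \<rho> w) \<le> 1"
proof -
  let ?t = "row T (idx \<one>)"
  have tc: "?t \<in> carrier_vec n" using T by auto
  have "dual_evecs n \<rho> w \<mu> \<subseteq> mat_range (single_col n ?t)"
  proof
    fix \<psi> assume p: "\<psi> \<in> dual_evecs n \<rho> w \<mu>"
    then have pc: "\<psi> \<in> carrier_vec n" by (simp add: dual_evecs_def)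
    obtain a where a: "coef_map n \<rho> \<psi> = a \<cdot>\<^sub>m T" using span[OF homs_eq_coef_map(2)[OF rep p]] by blast
    have "\<psi> = row (a \<cdot>\<^sub>m T) (idx \<one>)" using row_coef_map[OF rep pc] a by simp
    also have "\<dots> = a \<cdot>\<^sub>v ?t" using T by (intro eq_vecI) auto
    finally show "\<psi> \<in> mat_range (single_col n ?t)" unfolding single_col(2)[OF tc] by blast
  qed
  then show ?thesis by (rule order_le_of_range[OF rep real single_col(1)[OF tc]])
qed

lemma rep_char_poly_nonzero: "rep_char_poly G S n \<rho> w \<noteq> 0"
  unfolding rep_char_poly_def using degree_monic_char_poly[OF rep_operator_carrier, of n \<rho> w] by auto

text \<open>The root \<open>\<mu>\<close> yields an eigenfunction of the symmetric Laplacian, so it is real.\<close>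

lemma root_imp_hom:
  assumes rep: "matrix_rep G n \<rho>" and root: "poly (rep_char_poly G S n \<rho> w) \<mu> = 0"
  obtains T where "T \<in> homs n \<rho> (eigenspace w \<mu>)" "T \<noteq> 0\<^sub>m N n" "\<mu> \<in> \<real>"
proof -
  let ?D = "transpose_mat (rep_operator G S n \<rho> w)"
  have D: "?D \<in> carrier_mat n n" by simp
  have "char_poly ?D = rep_char_poly G S n \<rho> w"
    unfolding rep_char_poly_def by (rule char_poly_transpose_mat[of _ n]) simp
  then have "eigenvalue ?D \<mu>" using eigenvalue_root_char_poly[OF D] root by simp
  then obtain \<psi> where p: "\<psi> \<in> carrier_vec n" "\<psi> \<noteq> 0\<^sub>v n" "?D *\<^sub>v \<psi> = \<mu> \<cdot>\<^sub>v \<psi>"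
    by (auto simp: eigenvalue_def eigenvector_def rep_operator_def)
  have T: "coef_map n \<rho> \<psi> \<in> homs n \<rho> (eigenspace w \<mu>)"
    by (rule homs_eq_coef_map(2)[OF rep]) (use p in \<open>simp add: dual_evecs_def\<close>)
  have nz: "coef_map n \<rho> \<psi> \<noteq> 0\<^sub>m N n"
  proof
    assume "coef_map n \<rho> \<psi> = 0\<^sub>m N n"
    then have "\<psi> = row (0\<^sub>m N n) (idx \<one>)" using row_coef_map[OF rep p(1)] by simp
    also have "\<dots> = 0\<^sub>v n" by (intro eq_vecI) auto
    finally show False using p(2) by simp
  qed
  obtain v where v: "v \<in> carrier_vec n" "coef_map n \<rho> \<psi> *\<^sub>v v \<noteq> 0\<^sub>v N" using mat_nonzero_action[OF homsD(3)[OF T] nz] by metis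
  have "\<mu> \<in> \<real>" using eigenvalue_real[OF homsD(4)[OF T v(1)] v(2)] .
  then show thesis using that T nz by blast
qed

subsection \<open>The dual representation\<close>

text \<open>The inner product of functions on \<open>G\<close> is invariant. Pulled back along \<open>T\<close> and \<open>U\<close> it becomes a pairing of
  representations, that is, a \<open>G\<close>-map from the conjugate of the first to the dual of the second.\<close>

lemma gram_intertwiner:
  assumes T: "intertwiner G n \<rho> N reg T" and U: "intertwiner G m \<sigma> N reg U"
  shows "intertwiner G n (conj_rep \<rho>) m (dual_rep G \<sigma>) (mcnj (cadj U * T))"
proof -
  note t = intertwinerD[OF T] and u = intertwinerD[OF U]
  have cU: "cadj U \<in> carrier_mat m N" using u(1) by simp
  have "intertwiner G n \<rho> m (\<lambda>g. cadj (\<sigma> (inv g))) (cadj U * T)"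
    unfolding intertwiner_def
  proof (intro conjI ballI)
    show "cadj U * T \<in> carrier_mat m n" using cU t(1) by simp
    fix g assume g: "g \<in> carrier G"
    have ig: "inv g \<in> carrier G" using g by simp
    show "\<rho> g \<in> carrier_mat n n" using t(2)[OF g] .
    show cs: "cadj (\<sigma> (inv g)) \<in> carrier_mat m m" using u(2)[OF ig] by simp
    have "cadj U * T * \<rho> g = cadj U * (T * \<rho> g)" by (rule assoc_mult_mat[OF cU t(1) t(2)[OF g]])
    also have "\<dots> = cadj U * (reg g * T)" using t(4)[OF g] by simp
    also have "\<dots> = cadj U * reg g * T" by (rule assoc_mult_mat[OF cU reg_carrier t(1), symmetric])
    also have "cadj U * reg g = cadj (reg (inv g) * U)"
      using cadj_mult[OF reg_carrier u(1)] cadj_reg[OF ig] g by simp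
    also have "reg (inv g) * U = U * \<sigma> (inv g)" using u(4)[OF ig] by simp
    also have "cadj (U * \<sigma> (inv g)) = cadj (\<sigma> (inv g)) * cadj U" by (rule cadj_mult[OF u(1) u(2)[OF ig]])
    also have "cadj (\<sigma> (inv g)) * cadj U * T = cadj (\<sigma> (inv g)) * (cadj U * T)"
      by (rule assoc_mult_mat[OF cs cU t(1)])
    finally show "cadj U * T * \<rho> g = cadj (\<sigma> (inv g)) * (cadj U * T)" .
  qed
  from intertwiner_mcnj[OF this] show ?thesis
    unfolding conj_rep_def dual_rep_def cadj_def mcnj_mcnj .
qed

text \<open>An embedding into the functions on \<open>G\<close> makes \<open>W\<close> unitary: its Gram matrix is invertible.\<close>

lemma conj_rep_iso_dual_rep:
  assumes irr: "irreducible_rep G n \<rho>"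
  obtains Q Q' where "intertwiner G n (conj_rep \<rho>) n (dual_rep G \<rho>) Q" "intertwiner G n (dual_rep G \<rho>) n (conj_rep \<rho>) Q'"
    "Q * Q' = 1\<^sub>m n" "Q' * Q = 1\<^sub>m n"
proof -
  have rep: "matrix_rep G n \<rho>" and n: "0 < n" using irreducible_repD[OF irr] by auto
  let ?T = "coef_map n \<rho> (unit_vec n 0)"
  have T: "intertwiner G n \<rho> N reg ?T" by (rule coef_map_intertwiner[OF rep]) simp
  have nz: "?T \<noteq> 0\<^sub>m N n"
  proof
    assume "?T = 0\<^sub>m N n"
    then have "unit_vec n 0 = row (0\<^sub>m N n :: complex mat) (idx \<one>)" using row_coef_map[OF rep, of "unit_vec n 0"] by simp
    then have "unit_vec n 0 $ 0 = row (0\<^sub>m N n :: complex mat) (idx \<one>) $ 0" by simp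
    then show False using n by simp
  qed
  have inj: "inj_mat ?T" by (rule schur_inj[OF irr T nz])
  let ?Q = "mcnj (cadj ?T * ?T)"
  have Q: "intertwiner G n (conj_rep \<rho>) n (dual_rep G \<rho>) ?Q" by (rule gram_intertwiner[OF T T])
  have M: "cadj ?T * ?T \<in> carrier_mat n n" by (rule mult_carrier_mat[OF cadj_carrier[OF coef_map_carrier] coef_map_carrier])
  have iQ: "inj_mat ?Q" by (rule inj_mcnj[OF gram_inj[OF inj coef_map_carrier] M])
  obtain Q' where Q': "Q' \<in> carrier_mat n n" "?Q * Q' = 1\<^sub>m n" "Q' * ?Q = 1\<^sub>m n"
    using inj_mat_square_inverse[OF iQ intertwinerD(1)[OF Q]] by metis
  show thesis using that[OF Q intertwiner_inverse[OF Q Q'] Q'(2,3)] .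
qed

subsection \<open>Simplicity forces the resultants to be nonzero\<close>

text \<open>The complexified form of real \<open>G\<close>-simplicity.\<close>

definition simple_at :: "('a set \<Rightarrow> real) \<Rightarrow> bool"
  where "simple_at w \<longleftrightarrow> (\<forall>\<mu>\<in>\<real>. \<forall>X. lin_subspace N X \<and> invariant_set G reg X \<and> (\<forall>f\<in>X. vcnj f \<in> X) \<and>
    X \<subseteq> eigenspace w \<mu> \<longrightarrow> X = {0\<^sub>v N} \<or> X = eigenspace w \<mu>)"

text \<open>The image of \<open>T\<close> and its conjugate together span a nonzero invariant subspace that is closed under
  conjugation.\<close>

lemma simple_eigenspace_sum:
  assumes simple: "simple_at w" and real: "\<mu> \<in> \<real>"
    and T: "T \<in> homs n \<rho> (eigenspace w \<mu>)" "T \<noteq> 0\<^sub>m N n" and f: "f \<in> eigenspace w \<mu>"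
  shows "\<exists>a\<in>carrier_vec n. \<exists>b\<in>carrier_vec n. f = T *\<^sub>v a + mcnj T *\<^sub>v b"
proof -
  note t = homsD[OF T(1)]
  have cT: "mcnj T \<in> homs n (conj_rep \<rho>) (eigenspace w \<mu>)" using homs_mcnj[OF T(1)] eigenspace_vcnj[OF real] by blast
  note ct = homsD[OF cT]
  define X where "X = {T *\<^sub>v a + mcnj T *\<^sub>v b | a b. a \<in> carrier_vec n \<and> b \<in> carrier_vec n}"
  have car: "T *\<^sub>v a \<in> carrier_vec N" "mcnj T *\<^sub>v a \<in> carrier_vec N" if "a \<in> carrier_vec n" for a
    using that mult_mat_vec_carrier[OF t(3)] mult_mat_vec_carrier[OF ct(3)] by auto
  have memI: "T *\<^sub>v a + mcnj T *\<^sub>v b \<in> X" if "a \<in> carrier_vec n" "b \<in> carrier_vec n" for a b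
    using that by (auto simp: X_def)
  have XE: "\<exists>a b. a \<in> carrier_vec n \<and> b \<in> carrier_vec n \<and> x = T *\<^sub>v a + mcnj T *\<^sub>v b" if "x \<in> X" for x
    using that by (auto simp: X_def)
  have sub: "X \<subseteq> eigenspace w \<mu>"
    using lin_subspaceD(3)[OF eigenspace_subspace] t(4) ct(4) by (auto simp: X_def)
  have Xsub: "lin_subspace N X"
    unfolding lin_subspace_def
  proof (intro conjI ballI allI)
    show "X \<subseteq> carrier_vec N" using sub by (auto simp: eigenspace_def)
    show "0\<^sub>v N \<in> X" using memI[of "0\<^sub>v n" "0\<^sub>v n"] mult_mat_zero_vec[OF t(3)] mult_mat_zero_vec[OF ct(3)] by simp
    fix x y assume "x \<in> X" "y \<in> X"
    then obtain a b c d where abcd: "a \<in> carrier_vec n" "b \<in> carrier_vec n" "c \<in> carrier_vec n" "d \<in> carrier_vec n"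
      and xy: "x = T *\<^sub>v a + mcnj T *\<^sub>v b" "y = T *\<^sub>v c + mcnj T *\<^sub>v d" using XE by metis
    have "x + y = T *\<^sub>v (a + c) + mcnj T *\<^sub>v (b + d)"
      unfolding xy mult_add_distrib_mat_vec[OF t(3) abcd(1,3)] mult_add_distrib_mat_vec[OF ct(3) abcd(2,4)]
      using car abcd t(3) by (intro eq_vecI) (auto simp del: index_mult_mat_vec)
    then show "x + y \<in> X" using memI abcd by simp
  next
    fix c x assume "x \<in> X"
    then obtain a b where ab: "a \<in> carrier_vec n" "b \<in> carrier_vec n" "x = T *\<^sub>v a + mcnj T *\<^sub>v b" using XE by metis
    have "c \<cdot>\<^sub>v x = T *\<^sub>v (c \<cdot>\<^sub>v a) + mcnj T *\<^sub>v (c \<cdot>\<^sub>v b)"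
      unfolding ab(3) mult_mat_vec[OF t(3) ab(1)] mult_mat_vec[OF ct(3) ab(2)]
      by (rule smult_add_distrib_vec) (use car ab in auto)
    then show "c \<cdot>\<^sub>v x \<in> X" using memI ab by simp
  qed
  have Xinv: "invariant_set G reg X"
    unfolding invariant_set_def
  proof (intro ballI)
    fix g x assume g: "g \<in> carrier G" and "x \<in> X"
    then obtain a b where ab: "a \<in> carrier_vec n" "b \<in> carrier_vec n" "x = T *\<^sub>v a + mcnj T *\<^sub>v b" using XE by metis
    have "reg g *\<^sub>v x = T *\<^sub>v (\<rho> g *\<^sub>v a) + mcnj T *\<^sub>v (conj_rep \<rho> g *\<^sub>v b)"
      unfolding ab(3) mult_add_distrib_mat_vec[OF reg_carrier car(1)[OF ab(1)] car(2)[OF ab(2)]]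
      using intertwiner_act[OF t(1) g ab(1)] intertwiner_act[OF ct(1) g ab(2)] by simp
    then show "reg g *\<^sub>v x \<in> X"
      using memI mult_mat_vec_carrier[OF intertwinerD(2)[OF t(1) g] ab(1)]
        mult_mat_vec_carrier[OF intertwinerD(2)[OF ct(1) g] ab(2)] by simp
  qed
  have Xcnj: "\<forall>x\<in>X. vcnj x \<in> X"
  proof
    fix x assume "x \<in> X"
    then obtain a b where ab: "a \<in> carrier_vec n" "b \<in> carrier_vec n" "x = T *\<^sub>v a + mcnj T *\<^sub>v b" using XE by metis
    have "vcnj x = mcnj T *\<^sub>v vcnj a + T *\<^sub>v vcnj b"
      unfolding ab(3) vcnj_add[OF car(1)[OF ab(1)] car(2)[OF ab(2)]] vcnj_mult[OF t(3) ab(1)] vcnj_mult[OF ct(3) ab(2)] by simp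
    also have "\<dots> = T *\<^sub>v vcnj b + mcnj T *\<^sub>v vcnj a" using car ab by (intro comm_add_vec[of _ N]) auto
    finally show "vcnj x \<in> X" using memI ab by simp
  qed
  have "X \<noteq> {0\<^sub>v N}"
  proof -
    obtain v where v: "v \<in> carrier_vec n" "T *\<^sub>v v \<noteq> 0\<^sub>v N" using mat_nonzero_action[OF t(3) T(2)] by metis
    have "T *\<^sub>v v + mcnj T *\<^sub>v 0\<^sub>v n = T *\<^sub>v v" using mult_mat_zero_vec[OF ct(3)] car(1)[OF v(1)] by simp
    then have "T *\<^sub>v v \<in> X" using memI[OF v(1), of "0\<^sub>v n"] by simp
    then show ?thesis using v(2) by blast
  qed
  then have "X = eigenspace w \<mu>" using simple real Xsub Xinv Xcnj sub unfolding simple_at_def by blast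
  then show ?thesis using f XE by blast
qed

lemma simple_hom_decomposition:
  assumes simple: "simple_at w" and real: "\<mu> \<in> \<real>" and irr: "irreducible_rep G n \<rho>"
    and T: "T \<in> homs n \<rho> (eigenspace w \<mu>)" "T \<noteq> 0\<^sub>m N n" and U: "U \<in> homs m \<sigma> (eigenspace w \<mu>)"
  obtains A B where "intertwiner G m \<sigma> n \<rho> A" "intertwiner G m \<sigma> n (conj_rep \<rho>) B" "U = T * A + mcnj T * B"
proof -
  have cT: "mcnj T \<in> homs n (conj_rep \<rho>) (eigenspace w \<mu>)" using homs_mcnj[OF T(1)] eigenspace_vcnj[OF real] by blast
  have inj: "inj_mat T" by (rule schur_inj[OF irr homsD(1)[OF T(1)] T(2)])
  have cinj: "inj_mat (mcnj T)" by (rule inj_mcnj[OF inj homsD(3)[OF T(1)]])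
  show thesis
    using intertwiner_into_sum[OF irr homsD(1)[OF T(1)] inj homsD(1)[OF cT] cinj homsD(1)[OF U]]
      simple_eigenspace_sum[OF simple real T homsD(4)[OF U]] that by blast
qed

text \<open>At a common root both representations embed into the same eigenspace. Decomposing the embedding of \<open>\<sigma>\<close> by that
  of \<open>\<rho>\<close> yields a nonzero \<open>G\<close>-map from \<open>\<sigma>\<close> to \<open>\<rho>\<close> or to the conjugate of \<open>\<rho>\<close>, which is its dual.\<close>

lemma simple_imp_a_res:
  assumes simple: "simple_at w" and irr: "irreducible_rep G n \<rho>" "irreducible_rep G m \<sigma>"
    and noniso: "\<not> isomorphic_reps G m \<sigma> n \<rho>" "\<not> isomorphic_reps G m \<sigma> n (dual_rep G \<rho>)"
  shows "a_res G S n \<rho> m \<sigma> w \<noteq> 0"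
proof
  assume "a_res G S n \<rho> m \<sigma> w = 0"
  then obtain \<mu> where mu: "poly (rep_char_poly G S n \<rho> w) \<mu> = 0" "poly (rep_char_poly G S m \<sigma> w) \<mu> = 0"
    unfolding a_res_def resultant_eq_0_iff_common_root[OF rep_char_poly_nonzero] by blast
  obtain T where T: "T \<in> homs n \<rho> (eigenspace w \<mu>)" "T \<noteq> 0\<^sub>m N n" and real: "\<mu> \<in> \<real>"
    using root_imp_hom[OF irreducible_repD(1)[OF irr(1)] mu(1)] by metis
  obtain U where U: "U \<in> homs m \<sigma> (eigenspace w \<mu>)" "U \<noteq> 0\<^sub>m N m"
    using root_imp_hom[OF irreducible_repD(1)[OF irr(2)] mu(2)] by metis
  obtain A B where A: "intertwiner G m \<sigma> n \<rho> A" and B: "intertwiner G m \<sigma> n (conj_rep \<rho>) B"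
    and eq: "U = T * A + mcnj T * B"
    using simple_hom_decomposition[OF simple real irr(1) T U(1)] by metis
  have A0: "A = 0\<^sub>m n m" using schur_iso(3)[OF irr(2,1) A] noniso(1) by blast
  have B0: "B = 0\<^sub>m n m"
  proof (rule ccontr)
    assume nz: "B \<noteq> 0\<^sub>m n m"
    note s = schur_iso[OF irr(2) irreducible_conj_rep[OF irr(1)] B nz]
    obtain Q Q' where Q: "intertwiner G n (conj_rep \<rho>) n (dual_rep G \<rho>) Q"
      "intertwiner G n (dual_rep G \<rho>) n (conj_rep \<rho>) Q'" "Q' * Q = 1\<^sub>m n"
      using conj_rep_iso_dual_rep[OF irr(1)] by metis
    note q = intertwinerD[OF Q(1)] and q' = intertwinerD[OF Q(2)] and b = intertwinerD[OF B]
    have QB: "intertwiner G m \<sigma> n (dual_rep G \<rho>) (Q * B)" by (rule intertwiner_mult[OF B Q(1)])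
    have iQ: "inj_mat Q" by (rule inverse_imp_inj_mat[OF q(1) q'(1) Q(3)])
    have iB: "inj_mat B" by (rule schur_inj[OF irr(2) B nz])
    have "inj_mat (Q * B)" by (rule inj_mat_mult[OF iQ q(1) iB b(1)])
    then have "invertible_mat (Q * B)" using invertible_mat_inj intertwinerD(1)[OF QB] s(1) by blast
    then show False using noniso(2) QB unfolding isomorphic_reps_def intertwiner_def by blast
  qed
  have "U = 0\<^sub>m N m"
    unfolding eq A0 B0 using right_mult_zero_mat[OF homsD(3)[OF T(1)], of m]
      right_mult_zero_mat[of "mcnj T" N n m] homsD(3)[OF T(1)] by simp
  then show False using U(2) by simp
qed

lemma conj_structure_equation:
  assumes K: "K \<in> carrier_mat n n" and eq: "K * mcnj K = c \<cdot>\<^sub>m 1\<^sub>m n"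
  shows "mcnj K * K = cnj c \<cdot>\<^sub>m 1\<^sub>m n"
proof -
  have "mcnj (K * mcnj K) = mcnj K * K" using mcnj_mult[OF K, of "mcnj K"] K by simp
  moreover have "mcnj (c \<cdot>\<^sub>m 1\<^sub>m n) = cnj c \<cdot>\<^sub>m 1\<^sub>m n" by (intro eq_matI) auto
  ultimately show ?thesis using eq by simp
qed

text \<open>If \<open>K\<close> belongs to the conjugate-linear equivariant map \<open>J\<close>, the product is the matrix of \<open>J\<close> followed by \<open>T\<close> and
  complex conjugation. This twisted conjugate of \<open>T\<close> is linear, as two of the three maps are conjugate-linear.\<close>

lemma homs_twisted_conj:
  assumes K: "intertwiner G n (conj_rep \<rho>) n \<rho> K"
    and X: "\<And>f. f \<in> X \<Longrightarrow> vcnj f \<in> X" and T: "T \<in> homs n \<rho> X"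
  shows "mcnj T * mcnj K \<in> homs n \<rho> X"
  using homs_mult[OF homs_mcnj[OF T X], of n \<rho> "mcnj K"] intertwiner_mcnj[OF K] by simp

lemma mult_scalar_mat_right:
  "A \<in> carrier_mat m n \<Longrightarrow> A * (c \<cdot>\<^sub>m 1\<^sub>m n) = c \<cdot>\<^sub>m (A :: complex mat)"
  by (simp add: mult_smult_distrib[of _ m n _ n])

text \<open>For real type the twisted conjugation is an involution on the \<open>G\<close>-maps into the eigenspace. It has a nonzero
  fixed point \<open>R\<close>. The image of \<open>R\<close> is closed under conjugation, so it is the whole eigenspace, and by
  Schur's lemma all \<open>G\<close>-maps into it are multiples of \<open>R\<close>.\<close>

lemma real_type_order_le_1:
  assumes simple: "simple_at w" and real: "\<mu> \<in> \<real>" and irr: "irreducible_rep G n \<rho>" and rt: "real_type G n \<rho>"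
    and T: "T \<in> homs n \<rho> (eigenspace w \<mu>)" "T \<noteq> 0\<^sub>m N n"
  shows "Polynomial.order \<mu> (rep_char_poly G S n \<rho> w) \<le> 1"
proof -
  have rep: "matrix_rep G n \<rho>" using irreducible_repD(1)[OF irr] .
  obtain K where K: "intertwiner G n (conj_rep \<rho>) n \<rho> K" "K * mcnj K = 1\<^sub>m n"
    using rt real_type_iff[OF rep] by blast
  note k = intertwinerD[OF K(1)]
  have cK: "mcnj K \<in> carrier_mat n n" using k(1) by simp
  have "K * mcnj K = 1 \<cdot>\<^sub>m 1\<^sub>m n" using K(2) by (simp add: smult_mat_1)
  then have KK: "mcnj K * K = 1\<^sub>m n" using conj_structure_equation[OF k(1), of 1] by (simp add: smult_mat_1)
  note t = homsD[OF T(1)]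
  have cT: "mcnj T \<in> carrier_mat N n" using t(3) by simp
  \<comment> \<open>The sum of \<open>T\<close> and its twisted conjugate is fixed by twisting; if it vanishes, \<open>\<i> T\<close> is fixed.\<close>
  obtain R where R: "R \<in> homs n \<rho> (eigenspace w \<mu>)" "R \<noteq> 0\<^sub>m N n" "mcnj R * mcnj K = R"
  proof (cases "T + mcnj T * mcnj K = 0\<^sub>m N n")
    case False
    let ?R = "T + mcnj T * mcnj K"
    have P: "mcnj T * mcnj K \<in> carrier_mat N n" using cT cK by simp
    have "mcnj ?R = mcnj T + mcnj (mcnj T * mcnj K)" using t(3) P by (intro eq_matI) auto
    also have "mcnj (mcnj T * mcnj K) = T * K" using mcnj_mult[OF cT cK] by simp
    finally have "mcnj ?R * mcnj K = mcnj T * mcnj K + T * K * mcnj K"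
      using add_mult_distrib_mat[OF cT _ cK, of "T * K"] t(3) k(1) by simp
    also have "T * K * mcnj K = T" using assoc_mult_mat[OF t(3) k(1) cK] K(2) t(3) by simp
    also have "mcnj T * mcnj K + T = ?R" using P t(3) by (rule comm_add_mat)
    finally show thesis
      using that[of ?R] False homs_add[OF eigenspace_subspace T(1) homs_twisted_conj[OF K(1) eigenspace_vcnj[OF real] T(1)]] by blast
  next
    case True
    have P: "mcnj T * mcnj K \<in> carrier_mat N n" using cT cK by simp
    have neg: "mcnj T * mcnj K = (-1) \<cdot>\<^sub>m T"
    proof (rule eq_matI)
      fix i j assume "i < dim_row ((-1) \<cdot>\<^sub>m T)" "j < dim_col ((-1) \<cdot>\<^sub>m T)"
      then have ij: "i < N" "j < n" using t(3) by auto
      have "(T + mcnj T * mcnj K) $$ (i, j) = 0" using True ij by simp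
      then have "T $$ (i, j) + (mcnj T * mcnj K) $$ (i, j) = 0"
        using ij P t(3) by (simp only: index_add_mat carrier_matD)
      then show "(mcnj T * mcnj K) $$ (i, j) = ((-1) \<cdot>\<^sub>m T) $$ (i, j)"
        using ij t(3) by (simp add: eq_neg_iff_add_eq_0 add.commute del: index_mult_mat)
    qed (use t(3) cK in auto)
    have "mcnj (\<i> \<cdot>\<^sub>m T) = (-\<i>) \<cdot>\<^sub>m mcnj T" by (intro eq_matI) auto
    then have "mcnj (\<i> \<cdot>\<^sub>m T) * mcnj K = (-\<i>) \<cdot>\<^sub>m (mcnj T * mcnj K)" using mult_smult_assoc_mat[OF cT cK] by simp
    also have "\<dots> = \<i> \<cdot>\<^sub>m T" unfolding neg by (simp add: smult_mat_assoc)
    finally have eq: "mcnj (\<i> \<cdot>\<^sub>m T) * mcnj K = \<i> \<cdot>\<^sub>m T" .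
    have "\<i> \<cdot>\<^sub>m T \<noteq> 0\<^sub>m N n"
    proof
      assume "\<i> \<cdot>\<^sub>m T = 0\<^sub>m N n"
      then have "(-\<i>) \<cdot>\<^sub>m (\<i> \<cdot>\<^sub>m T) = (-\<i>) \<cdot>\<^sub>m 0\<^sub>m N n" by simp
      then have "T = (-\<i>) \<cdot>\<^sub>m 0\<^sub>m N n" by (simp add: smult_mat_assoc smult_mat_1)
      also have "\<dots> = 0\<^sub>m N n" by (intro eq_matI) auto
      finally show False using T(2) by simp
    qed
    then show thesis using that[OF homs_smult[OF eigenspace_subspace T(1)] _ eq] by blast
  qed
  note r = homsD[OF R(1)]
  have cR: "mcnj R \<in> carrier_mat N n" using r(3) by simp
  have RK: "mcnj R = R * K"
    using assoc_mult_mat[OF cR cK k(1)] KK R(3) cR by simp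
  show ?thesis
  proof (rule order_le_1_if_homs_spanned[OF rep real r(3)])
    fix U assume U: "U \<in> homs n \<rho> (eigenspace w \<mu>)"
    obtain A B where A: "intertwiner G n \<rho> n \<rho> A" and B: "intertwiner G n \<rho> n (conj_rep \<rho>) B"
      and eq: "U = R * A + mcnj R * B"
      using simple_hom_decomposition[OF simple real irr R(1,2) U] by metis
    note a = intertwinerD(1)[OF A] and b = intertwinerD(1)[OF B]
    have "U = R * A + R * (K * B)" unfolding eq using RK assoc_mult_mat[OF r(3) k(1) b] by simp
    also have "\<dots> = R * (A + K * B)" using mult_add_distrib_mat[OF r(3) a, of "K * B"] k(1) b by simp
    finally have UR: "U = R * (A + K * B)" .
    have "intertwiner G n \<rho> n \<rho> (A + K * B)" by (intro intertwiner_add A intertwiner_mult[OF B K(1)])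
    then obtain c where "A + K * B = c \<cdot>\<^sub>m 1\<^sub>m n" using schur_scalar[OF irr] by metis
    then have "U = c \<cdot>\<^sub>m R" using UR mult_scalar_mat_right[OF r(3)] by simp
    then show "\<exists>c. U = c \<cdot>\<^sub>m R" by blast
  qed
qed

text \<open>For complex type there is no nonzero \<open>G\<close>-map from \<open>W\<close> to its conjugate, so only multiples of \<open>T\<close> are left.\<close>

lemma complex_type_order_le_1:
  assumes simple: "simple_at w" and real: "\<mu> \<in> \<real>" and irr: "irreducible_rep G n \<rho>" and ct: "complex_type G n \<rho>"
    and T: "T \<in> homs n \<rho> (eigenspace w \<mu>)" "T \<noteq> 0\<^sub>m N n"
  shows "Polynomial.order \<mu> (rep_char_poly G S n \<rho> w) \<le> 1"
proof (rule order_le_1_if_homs_spanned[OF irreducible_repD(1)[OF irr] real homsD(3)[OF T(1)]])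
  fix U assume U: "U \<in> homs n \<rho> (eigenspace w \<mu>)"
  note t = homsD[OF T(1)]
  obtain A B where A: "intertwiner G n \<rho> n \<rho> A" and B: "intertwiner G n \<rho> n (conj_rep \<rho>) B"
    and eq: "U = T * A + mcnj T * B"
    using simple_hom_decomposition[OF simple real irr T U] by metis
  have cB: "intertwiner G n (conj_rep \<rho>) n \<rho> (mcnj B)" using intertwiner_mcnj[OF B] by simp
  have "mcnj B = 0\<^sub>m n n" using self_conjugate_real_or_quaternionic[OF irr cB] ct by (auto simp: complex_type_def)
  then have "mcnj (mcnj B) = mcnj (0\<^sub>m n n)" by simp
  then have B0: "B = 0\<^sub>m n n" by (simp add: mat_eq_iff)
  obtain c where c: "A = c \<cdot>\<^sub>m 1\<^sub>m n" using schur_scalar[OF irr A] by metis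
  have "U = c \<cdot>\<^sub>m T"
    unfolding eq c B0 mult_scalar_mat_right[OF t(3)] using right_mult_zero_mat[of "mcnj T" N n n] t(3) by simp
  then show "\<exists>c. U = c \<cdot>\<^sub>m T" by blast
qed

text \<open>For quaternionic type twisting twice gives \<open>-T\<close>, while it would give \<open>|c|\<^sup>2 T\<close> if the twisted map were
  \<open>c T\<close>.\<close>

lemma quaternionic_independent:
  assumes K: "K \<in> carrier_mat n n" "K * mcnj K = (-1) \<cdot>\<^sub>m 1\<^sub>m n"
    and T: "T \<in> carrier_mat N n" "T \<noteq> 0\<^sub>m N n"
  shows "mcnj T * mcnj K \<noteq> c \<cdot>\<^sub>m T"
proof
  assume eq: "mcnj T * mcnj K = c \<cdot>\<^sub>m T"
  have cT: "mcnj T \<in> carrier_mat N n" and cK: "mcnj K \<in> carrier_mat n n" using T K by auto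
  have "mcnj (mcnj T * mcnj K) = T * K" using mcnj_mult[OF cT cK] by simp
  then have TK: "T * K = mcnj (c \<cdot>\<^sub>m T)" using eq by simp
  also have "\<dots> = cnj c \<cdot>\<^sub>m mcnj T" by (intro eq_matI) auto
  finally have "T * K * mcnj K = cnj c \<cdot>\<^sub>m (mcnj T * mcnj K)" using mult_smult_assoc_mat[OF cT cK] by simp
  also have "\<dots> = (cnj c * c) \<cdot>\<^sub>m T" unfolding eq by (simp add: smult_mat_assoc)
  finally have "(-1) \<cdot>\<^sub>m T = (cnj c * c) \<cdot>\<^sub>m T"
    using assoc_mult_mat[OF T(1) K(1) cK] K(2) mult_scalar_mat_right[OF T(1)] by simp
  moreover obtain i j where ij: "i < N" "j < n" "T $$ (i, j) \<noteq> 0" using T by (auto simp: mat_eq_iff)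
  ultimately have "((-1) \<cdot>\<^sub>m T) $$ (i, j) = ((cnj c * c) \<cdot>\<^sub>m T) $$ (i, j)" by simp
  then have "(-1) * T $$ (i, j) = (cnj c * c) * T $$ (i, j)" using ij T(1) by simp
  then have "-1 = cnj c * c" using ij(3) by (metis mult_right_cancel)
  then have "-1 = Re (cnj c * c)" by (metis complex_Re_numeral one_complex.simps(1) uminus_complex.simps(1))
  moreover have "Re (cnj c * c) \<ge> 0" by simp
  ultimately show False by linarith
qed

text \<open>All \<open>G\<close>-maps from \<open>W\<close> to its conjugate are multiples of the structure map, so \<open>T\<close> and its twisted
  conjugate span the \<open>G\<close>-maps into the eigenspace.\<close>

lemma quaternionic_type_order:
  assumes simple: "simple_at w" and real: "\<mu> \<in> \<real>" and irr: "irreducible_rep G n \<rho>" and qt: "quaternionic_type G n \<rho>"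
    and T: "T \<in> homs n \<rho> (eigenspace w \<mu>)" "T \<noteq> 0\<^sub>m N n"
  shows "Polynomial.order \<mu> (rep_char_poly G S n \<rho> w) = 2"
proof (rule antisym)
  have rep: "matrix_rep G n \<rho>" using irreducible_repD(1)[OF irr] .
  obtain K where K: "intertwiner G n (conj_rep \<rho>) n \<rho> K" "K * mcnj K = (-1) \<cdot>\<^sub>m 1\<^sub>m n"
    using qt quaternionic_type_iff[OF rep] by blast
  note k = intertwinerD[OF K(1)]
  have cK: "mcnj K \<in> carrier_mat n n" using k(1) by simp
  have KK: "mcnj K * K = (-1) \<cdot>\<^sub>m 1\<^sub>m n" using conj_structure_equation[OF k(1) K(2)] by simp
  note t = homsD[OF T(1)]
  have cT: "mcnj T \<in> carrier_mat N n" using t(3) by simp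
  have TT: "mcnj T * mcnj K \<in> homs n \<rho> (eigenspace w \<mu>)"
    by (rule homs_twisted_conj[OF K(1) eigenspace_vcnj[OF real] T(1)])
  show "2 \<le> Polynomial.order \<mu> (rep_char_poly G S n \<rho> w)"
    by (rule order_ge_if_independent_homs(1)[OF rep real T TT quaternionic_independent[OF k(1) K(2) t(3) T(2)]])
  show "Polynomial.order \<mu> (rep_char_poly G S n \<rho> w) \<le> 2"
  proof (rule order_le_2_if_homs_spanned[OF rep real t(3) homsD(3)[OF TT]])
    fix U assume U: "U \<in> homs n \<rho> (eigenspace w \<mu>)"
    obtain A B where A: "intertwiner G n \<rho> n \<rho> A" and B: "intertwiner G n \<rho> n (conj_rep \<rho>) B"
      and eq: "U = T * A + mcnj T * B"
      using simple_hom_decomposition[OF simple real irr T U] by metis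
    note b = intertwinerD(1)[OF B]
    obtain a where a: "A = a \<cdot>\<^sub>m 1\<^sub>m n" using schur_scalar[OF irr A] by metis
    obtain c where c: "K * B = c \<cdot>\<^sub>m 1\<^sub>m n" using schur_scalar[OF irr intertwiner_mult[OF B K(1)]] by metis
    have "(-1) \<cdot>\<^sub>m B = mcnj K * K * B"
      unfolding KK using b by (simp add: mult_smult_assoc_mat[of _ n n _ n])
    also have "\<dots> = c \<cdot>\<^sub>m mcnj K" using assoc_mult_mat[OF cK k(1) b] c mult_scalar_mat_right[OF cK] by simp
    finally have "(-1) \<cdot>\<^sub>m ((-1) \<cdot>\<^sub>m B) = (-1) \<cdot>\<^sub>m (c \<cdot>\<^sub>m mcnj K)" by simp
    then have B': "B = (-c) \<cdot>\<^sub>m mcnj K" by (simp add: smult_mat_assoc smult_mat_1)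
    have "U = a \<cdot>\<^sub>m T + (-c) \<cdot>\<^sub>m (mcnj T * mcnj K)"
      unfolding eq a B' mult_scalar_mat_right[OF t(3)] using mult_smult_distrib[OF cT cK] by simp
    then show "\<exists>a b. U = a \<cdot>\<^sub>m T + b \<cdot>\<^sub>m (mcnj T * mcnj K)" by blast
  qed
qed

lemma simple_imp_b_res:
  assumes simple: "simple_at w" and irr: "irreducible_rep G n \<rho>" and ty: "real_type G n \<rho> \<or> complex_type G n \<rho>"
  shows "b_res G S n \<rho> w \<noteq> 0"
proof
  let ?P = "rep_char_poly G S n \<rho> w"
  assume "b_res G S n \<rho> w = 0"
  then obtain \<mu> where mu: "poly ?P \<mu> = 0" "poly (pderiv ?P) \<mu> = 0"
    unfolding b_res_def resultant_eq_0_iff_common_root[OF rep_char_poly_nonzero] by blast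
  obtain T where T: "T \<in> homs n \<rho> (eigenspace w \<mu>)" "T \<noteq> 0\<^sub>m N n" and real: "\<mu> \<in> \<real>"
    using root_imp_hom[OF irreducible_repD(1)[OF irr] mu(1)] by metis
  have "Polynomial.order \<mu> ?P \<le> 1"
    using ty real_type_order_le_1[OF simple real irr _ T] complex_type_order_le_1[OF simple real irr _ T] by blast
  then show False using order_ge_2_iff[OF rep_char_poly_nonzero, of n \<rho> w \<mu>] mu by simp
qed

lemma simple_imp_c_res:
  assumes simple: "simple_at w" and irr: "irreducible_rep G n \<rho>" and ty: "quaternionic_type G n \<rho>"
  shows "c_res G S n \<rho> w \<noteq> 0"
proof
  let ?P = "rep_char_poly G S n \<rho> w"
  assume "c_res G S n \<rho> w = 0"
  then obtain \<mu> where mu: "poly ?P \<mu> = 0" "poly (pderiv (pderiv ?P)) \<mu> = 0"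
    unfolding c_res_def resultant_eq_0_iff_common_root[OF rep_char_poly_nonzero] by blast
  obtain T where T: "T \<in> homs n \<rho> (eigenspace w \<mu>)" "T \<noteq> 0\<^sub>m N n" and real: "\<mu> \<in> \<real>"
    using root_imp_hom[OF irreducible_repD(1)[OF irr] mu(1)] by metis
  have "Polynomial.order \<mu> ?P = 2" by (rule quaternionic_type_order[OF simple real irr ty T])
  then show False using order_not_1_second_deriv[OF rep_char_poly_nonzero mu(1)] mu(2) by simp
qed

end

lemma inj_mat_nonzero:
  assumes "inj_mat A" "A \<in> carrier_mat m n" "0 < n" shows "A \<noteq> 0\<^sub>m m n"
proof
  assume "A = 0\<^sub>m m n"
  then have "A *\<^sub>v unit_vec n 0 = 0\<^sub>v m" by (intro eq_vecI) auto
  then have "unit_vec n 0 = (0\<^sub>v n :: 'a vec)" using inj_matD[OF assms(1,2), of "unit_vec n 0"] by simp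
  then have "unit_vec n 0 $ 0 = (0\<^sub>v n :: 'a vec) $ 0" by simp
  then show False using assms(3) by simp
qed

lemma mcnj_eq_0: assumes "mcnj A = 0\<^sub>m m n" shows "A = 0\<^sub>m m n"
proof -
  have "A = mcnj (0\<^sub>m m n)" using assms mcnj_mcnj by metis
  also have "\<dots> = 0\<^sub>m m n" by (intro eq_matI) auto
  finally show ?thesis .
qed

text \<open>The vectors are collected as the columns of an injective matrix. The clause on
  \<open>h\<close> expresses that its range lies in their span.\<close>

lemma orthogonal_family_card_le:
  assumes "finite F"
    and "\<And>p. p \<in> F \<Longrightarrow> f p \<in> carrier_vec n" "\<And>p. p \<in> F \<Longrightarrow> f p \<noteq> 0\<^sub>v n"
    and "\<And>p q. p \<in> F \<Longrightarrow> q \<in> F \<Longrightarrow> p \<noteq> q \<Longrightarrow> cinner (f p) (f q) = 0"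
  shows "card F \<le> n"
proof -
  have "\<exists>W. W \<in> carrier_mat n (card F) \<and> inj_mat W \<and>
    (\<forall>h\<in>carrier_vec n. (\<forall>p\<in>F. cinner (f p) h = 0) \<longrightarrow> (\<forall>x\<in>mat_range W. cinner x h = 0))"
    using assms
  proof (induction F rule: finite_induct)
    case empty
    show ?case by (rule exI[of _ "0\<^sub>m n 0"]) (auto simp: inj_empty mat_range_empty)
  next
    case (insert p F)
    have pc: "f p \<in> carrier_vec n" using insert.prems by simp
    have "\<exists>W. W \<in> carrier_mat n (card F) \<and> inj_mat W \<and>
      (\<forall>h\<in>carrier_vec n. (\<forall>p\<in>F. cinner (f p) h = 0) \<longrightarrow> (\<forall>x\<in>mat_range W. cinner x h = 0))"
      by (rule insert.IH) (use insert.prems in auto)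
    then obtain W where W: "W \<in> carrier_mat n (card F)" "inj_mat W"
      "\<forall>h\<in>carrier_vec n. (\<forall>p\<in>F. cinner (f p) h = 0) \<longrightarrow> (\<forall>x\<in>mat_range W. cinner x h = 0)"
      by blast
    have "cinner (f q) (f p) = 0" if "q \<in> F" for q
      by (rule insert.prems(3)) (use that insert.hyps in auto)
    then have "\<forall>x\<in>mat_range W. cinner x (f p) = 0" using W(3) pc by blast
    moreover have "cinner (f p) (f p) \<noteq> 0" using cinner_self_eq_0[OF pc] insert.prems(2)[of p] by auto
    ultimately have notin: "f p \<notin> mat_range W" by blast
    let ?W = "append_col W (f p)"
    have "cinner x h = 0" if h: "h \<in> carrier_vec n" "\<forall>q\<in>insert p F. cinner (f q) h = 0" and x: "x \<in> mat_range ?W" for h x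
    proof -
      obtain c a where ca: "c \<in> mat_range W" "x = c + a \<cdot>\<^sub>v f p" using x mat_range_append_col[OF W(1) pc] by auto
      have cc: "c \<in> carrier_vec n" using lin_subspaceD(5)[OF lin_subspace_mat_range[OF W(1)] ca(1)] .
      have "cinner c h = 0" using W(3) h ca(1) by blast
      moreover have "cinner x h = cinner c h + a * cinner (f p) h"
        unfolding ca(2) using add_scalar_prod_distrib[OF cc, of "a \<cdot>\<^sub>v f p" "vcnj h"] pc h(1) by simp
      ultimately show ?thesis using h(2) by simp
    qed
    moreover have "?W \<in> carrier_mat n (card (insert p F))"
      using append_col_carrier[OF W(1)] insert.hyps by simp
    moreover have "inj_mat ?W" by (rule inj_append_col[OF W(2,1) pc notin])
    ultimately show ?case by blast
  qed
  then show ?thesis using inj_mat_dim_le by blast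
qed

context cayley
begin

subsection \<open>Nonzero resultants force simplicity\<close>

text \<open>Take an injective matrix \<open>B\<close> with the least positive number \<open>n\<close> of columns whose range is an invariant
  subspace of \<open>X\<close>. The regular representation restricted to this range, written in the basis \<open>B\<close>, is
  irreducible by minimality.\<close>

lemma irreducible_in_subspace:
  assumes X: "lin_subspace N X" "invariant_set G reg X" "X \<noteq> {0\<^sub>v N}"
  obtains n \<rho> T where "irreducible_rep G n \<rho>" "T \<in> homs n \<rho> X" "T \<noteq> 0\<^sub>m N n"
proof -
  define P where "P n \<longleftrightarrow> 0 < n \<and> (\<exists>B. B \<in> carrier_mat N n \<and> inj_mat B \<and> mat_range B \<subseteq> X \<and>
    invariant_set G reg (mat_range B))" for n :: nat
  obtain n0 B0 where B0: "B0 \<in> carrier_mat N n0" "inj_mat B0" "mat_range B0 = X"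
    using subspace_basis[OF X(1)] by metis
  have "n0 \<noteq> 0"
  proof
    assume "n0 = 0"
    then have "B0 = 0\<^sub>m N 0" using B0(1) by (intro eq_matI) auto
    then show False using B0(3) mat_range_empty X(3) by blast
  qed
  then have "P n0" unfolding P_def using B0 X(2) by blast
  define n where "n = (LEAST n. P n)"
  have Pn: "P n" unfolding n_def by (rule LeastI[of P, OF \<open>P n0\<close>])
  have least: "n \<le> m" if "P m" for m unfolding n_def by (rule Least_le[of P, OF that])
  obtain B where n: "0 < n" and B: "B \<in> carrier_mat N n" "inj_mat B" "mat_range B \<subseteq> X" "invariant_set G reg (mat_range B)"
    using Pn unfolding P_def by blast
  have "\<exists>Y. Y \<in> carrier_mat n n \<and> reg g * B = B * Y" if g: "g \<in> carrier G" for g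
  proof -
    have "reg g * B *\<^sub>v v \<in> mat_range B" if v: "v \<in> carrier_vec n" for v
      using assoc_mult_mat_vec[OF reg_carrier B(1) v] B(4) g mat_rangeI[OF B(1) v] by (simp add: invariant_set_def)
    then show ?thesis using mat_range_factor[OF B(1) mult_carrier_mat[OF reg_carrier B(1)]] by metis
  qed
  then obtain \<rho> where \<rho>: "\<And>g. g \<in> carrier G \<Longrightarrow> \<rho> g \<in> carrier_mat n n \<and> reg g * B = B * \<rho> g" by metis
  have Bint: "intertwiner G n \<rho> N reg B" unfolding intertwiner_def using B(1) \<rho> by auto
  have rep: "matrix_rep G n \<rho>"
    unfolding matrix_rep_def
  proof (intro conjI ballI)
    show "\<rho> \<one> = 1\<^sub>m n"
      by (rule inj_mat_cancel[OF B(2,1)]) (use \<rho>[OF one_closed] B(1) in \<open>auto simp: reg_one\<close>)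
    fix g h assume g: "g \<in> carrier G" and h: "h \<in> carrier G"
    show "\<rho> (g \<otimes> h) = \<rho> g * \<rho> h"
    proof (rule mat_eq_by_action[of _ n n])
      fix v :: "complex vec" assume v: "v \<in> carrier_vec n"
      have gh: "g \<otimes> h \<in> carrier G" using g h by simp
      have hv: "\<rho> h *\<^sub>v v \<in> carrier_vec n" using \<rho>[OF h] v by auto
      show "\<rho> (g \<otimes> h) *\<^sub>v v = \<rho> g * \<rho> h *\<^sub>v v"
      proof (rule inj_mat_eqD[OF B(2,1)])
        have Bv: "B *\<^sub>v v \<in> carrier_vec N" using mult_mat_vec_carrier[OF B(1) v] .
        have "B *\<^sub>v (\<rho> (g \<otimes> h) *\<^sub>v v) = reg (g \<otimes> h) *\<^sub>v (B *\<^sub>v v)" by (rule intertwiner_act[OF Bint gh v])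
        also have "\<dots> = reg g *\<^sub>v (reg h *\<^sub>v (B *\<^sub>v v))" by (rule reg_mult_act[OF g h Bv])
        also have "\<dots> = B *\<^sub>v (\<rho> g *\<^sub>v (\<rho> h *\<^sub>v v))"
          using intertwiner_act[OF Bint h v] intertwiner_act[OF Bint g hv] by simp
        also have "\<rho> g *\<^sub>v (\<rho> h *\<^sub>v v) = \<rho> g * \<rho> h *\<^sub>v v"
          using assoc_mult_mat_vec[of "\<rho> g" n n "\<rho> h" n v] \<rho>[OF g] \<rho>[OF h] v by simp
        finally show "B *\<^sub>v (\<rho> (g \<otimes> h) *\<^sub>v v) = B *\<^sub>v (\<rho> g * \<rho> h *\<^sub>v v)" .
      qed (use \<rho>[OF gh] \<rho>[OF g] \<rho>[OF h] v in \<open>auto intro!: mult_mat_vec_carrier\<close>)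
    qed (use \<rho>[OF g] \<rho>[OF h] \<rho>[of "g \<otimes> h"] g h in \<open>auto intro!: mult_carrier_mat[of _ n n _ n]\<close>)
  qed (use \<rho> in auto)
  have irr: "irreducible_rep G n \<rho>"
    unfolding irreducible_rep_iff
  proof (intro conjI allI impI rep n)
    fix V assume V: "lin_subspace n V \<and> invariant_set G \<rho> V"
    obtain m C where C: "m \<le> n" "C \<in> carrier_mat n m" "inj_mat C" "mat_range C = V" using subspace_basis V by metis
    show "V = {0\<^sub>v n} \<or> V = carrier_vec n"
    proof (cases "m = 0")
      case True
      then have "C = 0\<^sub>m n 0" using C(2) by (intro eq_matI) auto
      then show ?thesis using C(4) mat_range_empty by blast
    next
      case False
      have BC: "B * C \<in> carrier_mat N m" using B(1) C(2) by simp
      have BCv: "B * C *\<^sub>v v = B *\<^sub>v (C *\<^sub>v v)" if "v \<in> carrier_vec m" for v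
        by (rule assoc_mult_mat_vec[OF B(1) C(2) that])
      have "mat_range (B * C) \<subseteq> X"
      proof
        fix x assume "x \<in> mat_range (B * C)"
        then obtain v where v: "v \<in> carrier_vec m" "x = B * C *\<^sub>v v" using mat_rangeE[OF _ BC] by metis
        then show "x \<in> X" using BCv[OF v(1)] mat_rangeI[OF B(1) mult_mat_vec_carrier[OF C(2) v(1)]] B(3) by auto
      qed
      moreover have "invariant_set G reg (mat_range (B * C))"
        unfolding invariant_set_def
      proof (intro ballI)
        fix g x assume g: "g \<in> carrier G" and "x \<in> mat_range (B * C)"
        then obtain v where v: "v \<in> carrier_vec m" "x = B * C *\<^sub>v v" using mat_rangeE[OF _ BC] by metis
        have Cv: "C *\<^sub>v v \<in> carrier_vec n" using mult_mat_vec_carrier[OF C(2) v(1)] .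
        have "\<rho> g *\<^sub>v (C *\<^sub>v v) \<in> V" using V g mat_rangeI[OF C(2) v(1)] C(4) by (auto simp: invariant_set_def)
        then obtain u where u: "u \<in> carrier_vec m" "\<rho> g *\<^sub>v (C *\<^sub>v v) = C *\<^sub>v u" using C mat_rangeE by metis
        have "reg g *\<^sub>v x = B *\<^sub>v (C *\<^sub>v u)" using v BCv[OF v(1)] intertwiner_act[OF Bint g Cv] u(2) by simp
        then show "reg g *\<^sub>v x \<in> mat_range (B * C)" using BCv[OF u(1)] mat_rangeI[OF BC u(1)] by simp
      qed
      ultimately have "P m" unfolding P_def using False BC inj_mat_mult[OF B(2,1) C(3,2)] by blast
      then have "m = n" using least C(1) by force
      then show ?thesis using inj_mat_square_range C by blast
    qed
  qed
  have "B \<in> homs n \<rho> X" using Bint B(3) by (simp add: homs_def)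
  then show thesis using that irr inj_mat_nonzero[OF B(2,1) n] by blast
qed

text \<open>The inner product is invariant under \<open>G\<close> and compatible with conjugation, so the orthogonal complement of
  \<open>X\<close> in the eigenspace inherits the two kinds of invariance.\<close>

lemma orthogonal_complement_in_eigenspace:
  assumes real: "\<mu> \<in> \<real>" and X: "lin_subspace N X" "invariant_set G reg X" "\<And>f. f \<in> X \<Longrightarrow> vcnj f \<in> X"
    "X \<subseteq> eigenspace w \<mu>" "X \<noteq> eigenspace w \<mu>"
  obtains Y where "lin_subspace N Y" "invariant_set G reg Y" "\<And>f. f \<in> Y \<Longrightarrow> vcnj f \<in> Y" "Y \<subseteq> eigenspace w \<mu>"
    "Y \<noteq> {0\<^sub>v N}" "X \<inter> Y \<subseteq> {0\<^sub>v N}"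
proof -
  define Y where "Y = {h \<in> eigenspace w \<mu>. \<forall>u\<in>X. cinner h u = 0}"
  note E = lin_subspaceD[OF eigenspace_subspace[of w \<mu>]] and x = lin_subspaceD[OF X(1)]
  have "lin_subspace N Y"
    unfolding lin_subspace_def
  proof (intro conjI ballI allI)
    show "Y \<subseteq> carrier_vec N" using E(1) by (auto simp: Y_def)
    show "0\<^sub>v N \<in> Y" using E(2) x(5) by (auto simp: Y_def)
    fix a b assume ab: "a \<in> Y" "b \<in> Y"
    have c: "a \<in> carrier_vec N" "b \<in> carrier_vec N" using ab E(5) by (auto simp: Y_def)
    have "cinner (a + b) u = 0" if "u \<in> X" for u
      using add_scalar_prod_distrib[OF c, of "vcnj u"] x(5)[OF that] ab that by (simp add: Y_def)
    then show "a + b \<in> Y" using E(3) ab by (simp add: Y_def)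
  next
    fix c a assume a: "a \<in> Y"
    have "a \<in> carrier_vec N" using a E(5) by (auto simp: Y_def)
    then have "cinner (c \<cdot>\<^sub>v a) u = 0" if "u \<in> X" for u using x(5)[OF that] a that by (simp add: Y_def)
    then show "c \<cdot>\<^sub>v a \<in> Y" using E(4) a by (simp add: Y_def)
  qed
  moreover have "invariant_set G reg Y"
    unfolding invariant_set_def
  proof (intro ballI)
    fix g h assume g: "g \<in> carrier G" and h: "h \<in> Y"
    have hc: "h \<in> carrier_vec N" using h E(5) by (auto simp: Y_def)
    have "cinner (reg g *\<^sub>v h) u = 0" if u: "u \<in> X" for u
    proof -
      have "cinner (reg g *\<^sub>v h) u = cinner h (reg (inv g) *\<^sub>v u)"
        using cinner_adj_right[OF reg_carrier hc x(5)[OF u]] cadj_reg[OF g] by simp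
      moreover have "reg (inv g) *\<^sub>v u \<in> X" using X(2) g u by (simp add: invariant_set_def)
      ultimately show ?thesis using h by (simp add: Y_def)
    qed
    moreover have "reg g *\<^sub>v h \<in> eigenspace w \<mu>"
      using eigenspace_invariant g h by (auto simp: Y_def invariant_set_def)
    ultimately show "reg g *\<^sub>v h \<in> Y" by (simp add: Y_def)
  qed
  moreover have "vcnj h \<in> Y" if h: "h \<in> Y" for h
  proof -
    have hc: "h \<in> carrier_vec N" using h E(5) by (auto simp: Y_def)
    have "cinner (vcnj h) u = 0" if u: "u \<in> X" for u
    proof -
      have "cinner (vcnj h) u = cnj (cinner h (vcnj u))"
        using hc x(5)[OF u] by (simp add: scalar_prod_def)
      moreover have "cinner h (vcnj u) = 0" using h X(3)[OF u] unfolding Y_def by blast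
      ultimately show ?thesis by simp
    qed
    then show ?thesis using h eigenspace_vcnj[OF real] by (simp add: Y_def)
  qed
  moreover have "Y \<noteq> {0\<^sub>v N}"
  proof -
    obtain f where f: "f \<in> eigenspace w \<mu>" "f \<notin> X" using X(4,5) by blast
    obtain p where p: "p \<in> X" "\<And>u. u \<in> X \<Longrightarrow> cinner (f - p) u = 0"
      using orthogonal_projection[OF X(1) E(5)[OF f(1)]] by metis
    have "f - p \<in> eigenspace w \<mu>" using lin_subspace_diff[OF eigenspace_subspace f(1)] p(1) X(4) by blast
    then have "f - p \<in> Y" using p(2) by (simp add: Y_def)
    moreover have "f - p \<noteq> 0\<^sub>v N" using vec_diff_eq_0_iff[OF E(5)[OF f(1)] x(5)[OF p(1)]] f p by auto
    ultimately show ?thesis by blast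
  qed
  moreover have "X \<inter> Y \<subseteq> {0\<^sub>v N}" using cinner_self_eq_0 x(5) by (auto simp: Y_def)
  moreover have "Y \<subseteq> eigenspace w \<mu>" by (auto simp: Y_def)
  ultimately show thesis using that by blast
qed

lemma homs_mono: "T \<in> homs n \<rho> X \<Longrightarrow> X \<subseteq> Y \<Longrightarrow> T \<in> homs n \<rho> Y"
  by (auto simp: homs_def)

lemma order_root_poly: "1 \<le> Polynomial.order \<mu> (rep_char_poly G S n \<rho> w) \<Longrightarrow> poly (rep_char_poly G S n \<rho> w) \<mu> = 0"
  using order_ge_1_iff[OF rep_char_poly_nonzero] by blast

lemma resultants_imp_simple:
  assumes a: "\<And>n \<rho> m \<sigma>. irreducible_rep G n \<rho> \<Longrightarrow> irreducible_rep G m \<sigma> \<Longrightarrow> \<not> isomorphic_reps G m \<sigma> n \<rho> \<Longrightarrow>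
      \<not> isomorphic_reps G m \<sigma> n (dual_rep G \<rho>) \<Longrightarrow> a_res G S n \<rho> m \<sigma> w \<noteq> 0"
    and b: "\<And>n \<rho>. irreducible_rep G n \<rho> \<Longrightarrow> real_type G n \<rho> \<or> complex_type G n \<rho> \<Longrightarrow> b_res G S n \<rho> w \<noteq> 0"
    and c: "\<And>n \<rho>. irreducible_rep G n \<rho> \<Longrightarrow> quaternionic_type G n \<rho> \<Longrightarrow> c_res G S n \<rho> w \<noteq> 0"
  shows "simple_at w"
  unfolding simple_at_def
proof (intro ballI allI impI, rule ccontr)
  fix \<mu> :: complex and X
  assume real: "\<mu> \<in> \<real>"
    and X: "lin_subspace N X \<and> invariant_set G reg X \<and> (\<forall>f\<in>X. vcnj f \<in> X) \<and> X \<subseteq> eigenspace w \<mu>"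
    and proper: "\<not> (X = {0\<^sub>v N} \<or> X = eigenspace w \<mu>)"
  obtain Y where Y: "lin_subspace N Y" "invariant_set G reg Y" "\<And>f. f \<in> Y \<Longrightarrow> vcnj f \<in> Y" "Y \<subseteq> eigenspace w \<mu>"
    "Y \<noteq> {0\<^sub>v N}" "X \<inter> Y \<subseteq> {0\<^sub>v N}"
    using orthogonal_complement_in_eigenspace[OF real, of X w] X proper by metis
  obtain n \<rho> T where irr: "irreducible_rep G n \<rho>" and T: "T \<in> homs n \<rho> X" "T \<noteq> 0\<^sub>m N n"
    using irreducible_in_subspace[of X] X proper by metis
  obtain m \<sigma> U where irr': "irreducible_rep G m \<sigma>" and U: "U \<in> homs m \<sigma> Y" "U \<noteq> 0\<^sub>m N m"
    using irreducible_in_subspace[OF Y(1,2,5)] by metis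
  have rep: "matrix_rep G n \<rho>" and n: "0 < n" using irreducible_repD[OF irr] by auto
  have TE: "T \<in> homs n \<rho> (eigenspace w \<mu>)" using homs_mono[OF T(1)] X by blast
  have UE: "U \<in> homs m \<sigma> (eigenspace w \<mu>)" using homs_mono[OF U(1) Y(4)] .
  let ?P = "rep_char_poly G S n \<rho> w"
  have root: "poly ?P \<mu> = 0" using order_root_poly order_ge_1_if_hom[OF rep real TE T(2)] by blast
  have "poly (rep_char_poly G S m \<sigma> w) \<mu> = 0"
    using order_root_poly order_ge_1_if_hom[OF irreducible_repD(1)[OF irr'] real UE U(2)] by blast
  then have "a_res G S m \<sigma> n \<rho> w = 0"
    unfolding a_res_def resultant_eq_0_iff_common_root[OF rep_char_poly_nonzero] using root by blast
  then consider "isomorphic_reps G n \<rho> m \<sigma>" | "isomorphic_reps G n \<rho> m (dual_rep G \<sigma>)" using a[OF irr' irr] by blast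
  \<comment> \<open>A copy of \<open>\<rho>\<close> in the complement \<open>Y\<close> as well: \<open>\<sigma>\<close> embeds into \<open>Y\<close>, and so does its conjugate,
    since \<open>Y\<close> is closed under conjugation.\<close>
  then obtain V where V: "V \<in> homs n \<rho> Y" "V \<noteq> 0\<^sub>m N n"
  proof cases
    case 1
    then obtain A where A: "A \<in> carrier_mat m n" "invertible_mat A" "\<forall>g\<in>carrier G. A * \<rho> g = \<sigma> g * A"
      by (auto simp: isomorphic_reps_def)
    have mn: "m = n" using A(1,2) by (auto simp: invertible_mat_def)
    have Aint: "intertwiner G n \<rho> m \<sigma> A"
      unfolding intertwiner_def using A irreducible_repD(4)[OF irr] irreducible_repD(4)[OF irr'] by blast
    have iA: "inj_mat A" using inj_mat_of_inverse A mn by blast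
    have iU: "inj_mat U" by (rule schur_inj[OF irr' homsD(1)[OF U(1)] U(2)])
    have UA: "U * A \<in> homs n \<rho> Y" by (rule homs_mult[OF U(1) Aint])
    show thesis
      using that[OF UA] inj_mat_nonzero[OF inj_mat_mult[OF iU homsD(3)[OF U(1)] iA A(1)] homsD(3)[OF UA] n] by blast
  next
    case 2
    then obtain A where A: "A \<in> carrier_mat m n" "invertible_mat A" "\<forall>g\<in>carrier G. A * \<rho> g = dual_rep G \<sigma> g * A"
      by (auto simp: isomorphic_reps_def)
    have mn: "m = n" using A(1,2) by (auto simp: invertible_mat_def)
    obtain Q Q' where Q: "intertwiner G m (conj_rep \<sigma>) m (dual_rep G \<sigma>) Q"
      "intertwiner G m (dual_rep G \<sigma>) m (conj_rep \<sigma>) Q'" "Q * Q' = 1\<^sub>m m"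
      using conj_rep_iso_dual_rep[OF irr'] by metis
    note q' = intertwinerD[OF Q(2)]
    have Aint: "intertwiner G n \<rho> m (dual_rep G \<sigma>) A"
      unfolding intertwiner_def using A irreducible_repD(4)[OF irr] q'(2) by blast
    have iA: "inj_mat A" using inj_mat_of_inverse A mn by blast
    have iQ: "inj_mat Q'" by (rule inverse_imp_inj_mat[OF q'(1) intertwinerD(1)[OF Q(1)] Q(3)])
    have QA: "intertwiner G n \<rho> m (conj_rep \<sigma>) (Q' * A)" by (rule intertwiner_mult[OF Aint Q(2)])
    have iQA: "inj_mat (Q' * A)" by (rule inj_mat_mult[OF iQ q'(1) iA A(1)])
    have iU: "inj_mat (mcnj U)" using inj_mcnj[OF schur_inj[OF irr' homsD(1)[OF U(1)] U(2)] homsD(3)[OF U(1)]] .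
    have cU: "mcnj U \<in> homs m (conj_rep \<sigma>) Y" using homs_mcnj[OF U(1) Y(3)] .
    have UA: "mcnj U * (Q' * A) \<in> homs n \<rho> Y" by (rule homs_mult[OF cU QA])
    show thesis
      using that[OF UA] inj_mat_nonzero[OF inj_mat_mult[OF iU homsD(3)[OF cU] iQA intertwinerD(1)[OF QA]] homsD(3)[OF UA] n] by blast
  qed
  have VE: "V \<in> homs n \<rho> (eigenspace w \<mu>)" using homs_mono[OF V(1) Y(4)] .
  have notX: "V \<notin> homs n \<rho> X"
  proof
    assume VX: "V \<in> homs n \<rho> X"
    obtain v where v: "v \<in> carrier_vec n" "V *\<^sub>v v \<noteq> 0\<^sub>v N" using mat_nonzero_action[OF homsD(3)[OF V(1)] V(2)] by metis
    show False using homsD(4)[OF VX v(1)] homsD(4)[OF V(1) v(1)] Y(6) v(2) by blast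
  qed
  have Xs: "lin_subspace N X" and Xc: "\<And>f. f \<in> X \<Longrightarrow> vcnj f \<in> X" using X by auto
  have "V \<noteq> x \<cdot>\<^sub>m T" for x using notX homs_smult[OF Xs T(1)] by blast
  then have "2 \<le> Polynomial.order \<mu> ?P" by (rule order_ge_if_independent_homs(1)[OF rep real TE T(2) VE])
  then have "b_res G S n \<rho> w = 0"
    unfolding b_res_def resultant_eq_0_iff_common_root[OF rep_char_poly_nonzero]
    using order_ge_2_iff[OF rep_char_poly_nonzero, of n \<rho> w \<mu>] by blast
  then have "\<not> real_type G n \<rho> \<and> \<not> complex_type G n \<rho>" using b[OF irr] by blast
  then have qt: "quaternionic_type G n \<rho>" by (auto simp: complex_type_def)
  then obtain K where K: "intertwiner G n (conj_rep \<rho>) n \<rho> K" "K * mcnj K = (-1) \<cdot>\<^sub>m 1\<^sub>m n"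
    using quaternionic_type_iff[OF rep] by blast
  let ?T' = "mcnj T * mcnj K"
  have T': "?T' \<in> homs n \<rho> X" by (rule homs_twisted_conj[OF K(1) Xc T(1)])
  have T'E: "?T' \<in> homs n \<rho> (eigenspace w \<mu>)" using homs_mono[OF T'] X by blast
  have ind: "?T' \<noteq> x \<cdot>\<^sub>m T" for x
    by (rule quaternionic_independent[OF intertwinerD(1)[OF K(1)] K(2) homsD(3)[OF T(1)] T(2)])
  have "V \<noteq> x \<cdot>\<^sub>m T + y \<cdot>\<^sub>m ?T'" for x y
    using notX homs_add[OF Xs homs_smult[OF Xs T(1)] homs_smult[OF Xs T']] by blast
  then have o3: "3 \<le> Polynomial.order \<mu> ?P" by (rule order_ge_if_independent_homs(2)[OF rep real TE T(2) T'E ind VE])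
  then have "poly (pderiv (pderiv ?P)) \<mu> = 0"
    using order_not_1_second_deriv[OF rep_char_poly_nonzero root] by simp
  then have "c_res G S n \<rho> w = 0"
    unfolding c_res_def resultant_eq_0_iff_common_root[OF rep_char_poly_nonzero] using root by blast
  then show False using c[OF irr qt] by blast
qed

subsection \<open>Finitely many characteristic polynomials\<close>

lemma rep_char_poly_isomorphic:
  assumes reps: "matrix_rep G n \<rho>" "matrix_rep G m \<sigma>" and iso: "isomorphic_reps G n \<rho> m \<sigma>"
  shows "rep_char_poly G S n \<rho> = rep_char_poly G S m \<sigma>"
proof
  fix w
  obtain A where A: "A \<in> carrier_mat m n" "invertible_mat A" "\<forall>g\<in>carrier G. A * \<rho> g = \<sigma> g * A"
    using iso by (auto simp: isomorphic_reps_def)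
  have mn: "m = n" using A(1,2) by (auto simp: invertible_mat_def)
  have A1: "A \<in> carrier_mat n n" using A mn by simp
  have Aint: "intertwiner G n \<rho> n \<sigma> A"
    unfolding intertwiner_def using A reps mn by (auto simp: matrix_rep_def)
  have rep': "matrix_rep G n \<sigma>" using reps mn by simp
  let ?D = "rep_operator G S n \<rho> w" and ?E = "rep_operator G S n \<sigma> w"
  have comm: "A * ?D = ?E * A"
  proof (rule mat_eq_by_action[of _ n n])
    fix u :: "complex vec" assume u: "u \<in> carrier_vec n"
    have Au: "A *\<^sub>v u \<in> carrier_vec n" using mult_mat_vec_carrier[OF A1 u] .
    have "A *\<^sub>v (?D *\<^sub>v u) = ?E *\<^sub>v (A *\<^sub>v u)"
    proof (rule eq_vecI)
      fix i assume "i < dim_vec (?E *\<^sub>v (A *\<^sub>v u))"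
      then have i: "i < n" using carrier_matD[OF rep_operator_carrier, of n \<sigma> w] by simp
      have idx: "(A *\<^sub>v x) $ i = row A i \<bullet> x" for x using A1 i by simp
      have "(A *\<^sub>v (?D *\<^sub>v u)) $ i = - (\<Sum>s\<in>S. wt w s * ((A *\<^sub>v (\<rho> s *\<^sub>v u)) $ i - (A *\<^sub>v u) $ i))"
        unfolding idx by (rule scalar_prod_rep_operator[OF reps(1) u])
      also have "\<dots> = - (\<Sum>s\<in>S. wt w s * ((\<sigma> s *\<^sub>v (A *\<^sub>v u)) $ i - (A *\<^sub>v u) $ i))"
        using intertwiner_act[OF Aint S_closed u] by simp
      also have "\<dots> = (?E *\<^sub>v (A *\<^sub>v u)) $ i" by (rule rep_operator_act[OF rep' Au i, symmetric])
      finally show "(A *\<^sub>v (?D *\<^sub>v u)) $ i = (?E *\<^sub>v (A *\<^sub>v u)) $ i" .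
    qed (use A1 carrier_matD[OF rep_operator_carrier, of n \<sigma> w] in simp)
    then show "A * ?D *\<^sub>v u = ?E * A *\<^sub>v u"
      using assoc_mult_mat_vec[OF A1 rep_operator_carrier u] assoc_mult_mat_vec[OF rep_operator_carrier A1 u] by simp
  qed (use A1 in \<open>auto intro!: mult_carrier_mat[of _ n n _ n]\<close>)
  obtain B where B: "B \<in> carrier_mat n n" "A * B = 1\<^sub>m n" "B * A = 1\<^sub>m n"
    using inj_mat_square_inverse[OF inj_mat_of_inverse[OF A1 A(2)] A1] by metis
  have "?D = B * A * ?D" unfolding B(3) by (rule left_mult_one_mat[OF rep_operator_carrier, symmetric])
  also have "\<dots> = B * (?E * A)" using assoc_mult_mat[OF B(1) A1 rep_operator_carrier] comm by simp
  also have "\<dots> = B * ?E * A" by (rule assoc_mult_mat[OF B(1) rep_operator_carrier A1, symmetric])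
  finally have "similar_mat ?D ?E" by (intro similar_matI[of _ _ B A n]) (use A1 B in auto)
  then show "rep_char_poly G S n \<rho> w = rep_char_poly G S m \<sigma> w"
    unfolding rep_char_poly_def mn by (rule char_poly_similar)
qed

text \<open>The pairing of the two images is a \<open>G\<close>-map between the conjugates of \<open>\<rho>\<close> and \<open>\<sigma>\<close>, up to the isomorphism of
  conjugate and dual, and so it vanishes by Schur's lemma.\<close>

lemma nonisomorphic_orthogonal:
  assumes irr: "irreducible_rep G n \<rho>" "irreducible_rep G m \<sigma>" and noniso: "\<not> isomorphic_reps G n \<rho> m \<sigma>"
    and T: "intertwiner G n \<rho> N reg T" and U: "intertwiner G m \<sigma> N reg U"
    and v: "v \<in> carrier_vec n" and u: "u \<in> carrier_vec m"
  shows "cinner (U *\<^sub>v u) (T *\<^sub>v v) = 0"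
proof -
  note t = intertwinerD[OF T] and u' = intertwinerD[OF U]
  let ?M = "cadj U * T"
  have cU: "cadj U \<in> carrier_mat m N" using u'(1) by simp
  have M: "?M \<in> carrier_mat m n" using cU t(1) by simp
  obtain Q Q' where Q: "intertwiner G m (conj_rep \<sigma>) m (dual_rep G \<sigma>) Q"
    "intertwiner G m (dual_rep G \<sigma>) m (conj_rep \<sigma>) Q'" "Q * Q' = 1\<^sub>m m"
    using conj_rep_iso_dual_rep[OF irr(2)] by metis
  note q = intertwinerD[OF Q(1)] and q' = intertwinerD[OF Q(2)]
  have int: "intertwiner G n (conj_rep \<rho>) m (conj_rep \<sigma>) (Q' * mcnj ?M)"
    by (rule intertwiner_mult[OF gram_intertwiner[OF T U] Q(2)])
  have "mcnj (Q' * mcnj ?M) = 0\<^sub>m m n"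
    using schur_iso(3)[OF irr] intertwiner_mcnj[OF int] noniso by auto
  then have z: "Q' * mcnj ?M = 0\<^sub>m m n" by (rule mcnj_eq_0)
  have cM: "mcnj ?M \<in> carrier_mat m n" using M by simp
  have "mcnj ?M = Q * (Q' * mcnj ?M)"
    using assoc_mult_mat[OF q(1) q'(1) cM] Q(3) left_mult_one_mat[OF cM] by simp
  also have "\<dots> = 0\<^sub>m m n" unfolding z by (rule right_mult_zero_mat[OF q(1)])
  finally have M0: "?M = 0\<^sub>m m n" by (rule mcnj_eq_0)
  have Tv: "T *\<^sub>v v \<in> carrier_vec N" using mult_mat_vec_carrier[OF t(1) v] .
  have "cinner (U *\<^sub>v u) (T *\<^sub>v v) = cinner u (cadj U *\<^sub>v (T *\<^sub>v v))" by (rule cinner_adj_right[OF u'(1) u Tv])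
  also have "cadj U *\<^sub>v (T *\<^sub>v v) = ?M *\<^sub>v v" by (rule assoc_mult_mat_vec[OF cU t(1) v, symmetric])
  also have "\<dots> = 0\<^sub>v m" unfolding M0 using v by (intro eq_vecI) auto
  finally show ?thesis using u by (simp add: vcnj_zero)
qed

text \<open>Different polynomials come from inequivalent representations. Each contributes a nonzero vector to the
  space of functions on \<open>G\<close>, and these vectors are orthogonal.\<close>

lemma finite_rep_char_polys: "finite {rep_char_poly G S n \<rho> | n \<rho>. irreducible_rep G n \<rho>}" (is "finite ?F")
proof (rule finite_if_finite_subsets_card_bdd[THEN conjunct1])
  fix F assume F: "F \<subseteq> ?F" "finite F"
  have "\<exists>n \<rho> f. irreducible_rep G n \<rho> \<and> p = rep_char_poly G S n \<rho> \<and> f \<noteq> 0\<^sub>v N \<and>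
      (\<exists>T v. intertwiner G n \<rho> N reg T \<and> v \<in> carrier_vec n \<and> f = T *\<^sub>v v)" if "p \<in> F" for p
  proof -
    obtain n \<rho> where irr: "irreducible_rep G n \<rho>" and p: "p = rep_char_poly G S n \<rho>" using F(1) \<open>p \<in> F\<close> by blast
    have rep: "matrix_rep G n \<rho>" and n: "0 < n" using irreducible_repD[OF irr] by auto
    have e: "unit_vec n 0 \<in> carrier_vec n" by simp
    have T: "intertwiner G n \<rho> N reg (coef_map n \<rho> (unit_vec n 0))" by (rule coef_map_intertwiner[OF rep e])
    have "(coef_map n \<rho> (unit_vec n 0) *\<^sub>v unit_vec n 0) $ idx \<one> \<noteq> 0\<^sub>v N $ idx \<one>"
      using coef_map_act_one[OF rep e e] n by simp
    then have "coef_map n \<rho> (unit_vec n 0) *\<^sub>v unit_vec n 0 \<noteq> 0\<^sub>v N" by metis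
    then show ?thesis using irr p T e by blast
  qed
  then obtain n \<rho> f where f: "\<And>p. p \<in> F \<Longrightarrow> irreducible_rep G (n p) (\<rho> p) \<and> p = rep_char_poly G S (n p) (\<rho> p) \<and>
      f p \<noteq> 0\<^sub>v N \<and> (\<exists>T v. intertwiner G (n p) (\<rho> p) N reg T \<and> v \<in> carrier_vec (n p) \<and> f p = T *\<^sub>v v)"
    by metis
  show "card F \<le> N"
  proof (rule orthogonal_family_card_le[OF F(2), of f])
    fix p assume p: "p \<in> F"
    show "f p \<noteq> 0\<^sub>v N" using f[OF p] by simp
    obtain T v where "intertwiner G (n p) (\<rho> p) N reg T" "v \<in> carrier_vec (n p)" "f p = T *\<^sub>v v" using f[OF p] by blast
    then show "f p \<in> carrier_vec N" using intertwinerD(1) mult_mat_vec_carrier by metis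
    fix q assume q: "q \<in> F" "p \<noteq> q"
    obtain T v where T: "intertwiner G (n p) (\<rho> p) N reg T" "v \<in> carrier_vec (n p)" "f p = T *\<^sub>v v" using f[OF p] by blast
    obtain U u where U: "intertwiner G (n q) (\<rho> q) N reg U" "u \<in> carrier_vec (n q)" "f q = U *\<^sub>v u" using f[OF q(1)] by blast
    have "\<not> isomorphic_reps G (n q) (\<rho> q) (n p) (\<rho> p)"
      using rep_char_poly_isomorphic[of "n q" "\<rho> q" "n p" "\<rho> p"] f[OF p] f[OF q(1)] q(2) irreducible_repD(1) by metis
    then show "cinner (f p) (f q) = 0"
      using nonisomorphic_orthogonal[of "n q" "\<rho> q" "n p" "\<rho> p" U T u v] f[OF p] f[OF q(1)] T U by simp
  qed
qed

subsection \<open>Real and complex functions\<close>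

definition to_vec :: "('a \<Rightarrow> real) \<Rightarrow> complex vec" where "to_vec f = vec N (\<lambda>i. complex_of_real (f (elt i)))"
definition re_fun :: "complex vec \<Rightarrow> 'a \<Rightarrow> real" where "re_fun v = (\<lambda>x\<in>carrier G. Re (v $ idx x))"

abbreviation real_funs :: "('a \<Rightarrow> real) set" where "real_funs \<equiv> carrier G \<rightarrow>\<^sub>E UNIV"

lemma to_vec_carrier[simp]: "to_vec f \<in> carrier_vec N" by (simp add: to_vec_def)
lemma re_fun_closed[simp]: "re_fun v \<in> real_funs" by (simp add: re_fun_def)
lemma re_fun_to_vec: "f \<in> real_funs \<Longrightarrow> re_fun (to_vec f) = f"
  by (auto simp: re_fun_def to_vec_def fun_eq_iff PiE_iff extensional_def)
lemma vcnj_to_vec[simp]: "vcnj (to_vec f) = to_vec f" by (intro eq_vecI) (auto simp: to_vec_def)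

lemma to_vec_zero: "to_vec (\<lambda>x\<in>carrier G. 0) = 0\<^sub>v N" by (intro eq_vecI) (auto simp: to_vec_def)
lemma to_vec_add: "to_vec (\<lambda>x\<in>carrier G. f x + g x) = to_vec f + to_vec g"
  by (intro eq_vecI) (auto simp: to_vec_def)
lemma to_vec_smult: "to_vec (\<lambda>x\<in>carrier G. c * f x) = complex_of_real c \<cdot>\<^sub>v to_vec f"
  by (intro eq_vecI) (auto simp: to_vec_def)

lemma to_vec_inject: "f \<in> real_funs \<Longrightarrow> g \<in> real_funs \<Longrightarrow> to_vec f = to_vec g \<longleftrightarrow> f = g"
  using re_fun_to_vec by metis

lemma to_vec_left_regular:
  assumes g: "g \<in> carrier G" shows "to_vec (left_regular G g f) = reg g *\<^sub>v to_vec f"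
proof (rule eq_vecI)
  fix i assume "i < dim_vec (reg g *\<^sub>v to_vec f)"
  then have i: "i < N" using carrier_matD(1)[OF reg_carrier, of g] by simp
  have c: "inv g \<otimes> elt i \<in> carrier G" using g i by simp
  show "to_vec (left_regular G g f) $ i = (reg g *\<^sub>v to_vec f) $ i"
    unfolding reg_act[OF g to_vec_carrier i] using i idx_less[OF c] elt_idx[OF c]
    by (simp add: to_vec_def left_regular_def)
qed (use carrier_matD(1)[OF reg_carrier, of g] in \<open>simp add: to_vec_def\<close>)

lemma left_regular_closed: "left_regular G g f \<in> real_funs" by (simp add: left_regular_def)

lemma to_vec_laplacian: "to_vec (laplacian G S w f) = lap w *\<^sub>v to_vec f"
proof (rule eq_vecI)
  fix i assume "i < dim_vec (lap w *\<^sub>v to_vec f)"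
  then have i: "i < N" by simp
  have "to_vec f $ idx (elt i \<otimes> s) = complex_of_real (f (elt i \<otimes> s))" if "s \<in> S" for s
  proof -
    have c: "elt i \<otimes> s \<in> carrier G" using i that by simp
    show ?thesis using idx_less[OF c] elt_idx[OF c] by (simp add: to_vec_def)
  qed
  moreover have "to_vec f $ i = complex_of_real (f (elt i))" using i by (simp add: to_vec_def)
  ultimately have "(lap w *\<^sub>v to_vec f) $ i =
      - (\<Sum>s\<in>S. wt w s * (complex_of_real (f (elt i \<otimes> s)) - complex_of_real (f (elt i))))"
    unfolding lap_act[OF to_vec_carrier i] by simp
  also have "\<dots> = complex_of_real (laplacian G S w f (elt i))"
    using i by (simp add: laplacian_def wt_def)
  also have "\<dots> = to_vec (laplacian G S w f) $ i" using i by (simp add: to_vec_def)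
  finally show "to_vec (laplacian G S w f) $ i = (lap w *\<^sub>v to_vec f) $ i" by (rule sym)
qed (simp add: to_vec_def)

lemma laplacian_eigenspace_iff:
  "f \<in> laplacian_eigenspace G S w \<mu> \<longleftrightarrow> f \<in> real_funs \<and> to_vec f \<in> eigenspace w (complex_of_real \<mu>)"
proof -
  have "laplacian G S w f \<in> real_funs" by (simp add: laplacian_def)
  moreover have "(\<lambda>x\<in>carrier G. \<mu> * f x) \<in> real_funs" by simp
  ultimately have "laplacian G S w f = (\<lambda>x\<in>carrier G. \<mu> * f x) \<longleftrightarrow>
      lap w *\<^sub>v to_vec f = complex_of_real \<mu> \<cdot>\<^sub>v to_vec f"
    using to_vec_inject to_vec_laplacian to_vec_smult by metis
  then show ?thesis by (auto simp: laplacian_eigenspace_def eigenspace_def real_functions_def)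
qed

lemma subrep_real_functions_iff:
  "subrep G (real_functions (carrier G)) (left_regular G) U \<longleftrightarrow>
    U \<subseteq> real_funs \<and> (\<lambda>x\<in>carrier G. 0) \<in> U \<and> (\<forall>f\<in>U. \<forall>g\<in>U. (\<lambda>x\<in>carrier G. f x + g x) \<in> U) \<and>
    (\<forall>c. \<forall>f\<in>U. (\<lambda>x\<in>carrier G. c * f x) \<in> U) \<and> (\<forall>g\<in>carrier G. \<forall>f\<in>U. left_regular G g f \<in> U)"
proof -
  have m: "Module.module (class_ring :: real ring) (real_functions (carrier G))"
    using vectorspace_real_functions[of "carrier G"] by (simp add: vectorspace_def)
  have "VectorSpace.subspace class_ring U (real_functions (carrier G)) \<longleftrightarrow>
    U \<subseteq> real_funs \<and> (\<lambda>x\<in>carrier G. 0) \<in> U \<and> (\<forall>f\<in>U. \<forall>g\<in>U. (\<lambda>x\<in>carrier G. f x + g x) \<in> U) \<and>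
    (\<forall>c. \<forall>f\<in>U. (\<lambda>x\<in>carrier G. c * f x) \<in> U)"
    unfolding VectorSpace.subspace_def LinearCombinations.submodule_def
    using m vectorspace_real_functions[of "carrier G"] by (auto simp: real_functions_def)
  then show ?thesis unfolding subrep_def by blast
qed

text \<open>The real part of \<open>v\<close> is the mean of \<open>v\<close> and its conjugate.\<close>

lemma real_part_mem:
  assumes X: "lin_subspace N X" "\<And>f. f \<in> X \<Longrightarrow> vcnj f \<in> X" and v: "v \<in> X"
  shows "to_vec (re_fun v) \<in> X"
proof -
  have vc: "v \<in> carrier_vec N" using lin_subspaceD(5)[OF X(1) v] .
  have "complex_of_real (Re z) = 1 / 2 * (z + cnj z)" for z by (simp add: complex_add_cnj)
  then have "to_vec (re_fun v) = (1 / 2) \<cdot>\<^sub>v (v + vcnj v)"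
    using vc by (intro eq_vecI) (auto simp: to_vec_def re_fun_def)
  then show ?thesis using lin_subspaceD(3,4)[OF X(1)] X(2) v by simp
qed

lemma real_imaginary_decomposition:
  assumes "v \<in> carrier_vec N"
  shows "v = to_vec (re_fun v) + \<i> \<cdot>\<^sub>v to_vec (re_fun ((-\<i>) \<cdot>\<^sub>v v))"
proof (rule eq_vecI)
  fix i assume "i < dim_vec (to_vec (re_fun v) + \<i> \<cdot>\<^sub>v to_vec (re_fun ((-\<i>) \<cdot>\<^sub>v v)))"
  then have i: "i < N" by (simp add: to_vec_def)
  then show "v $ i = (to_vec (re_fun v) + \<i> \<cdot>\<^sub>v to_vec (re_fun ((-\<i>) \<cdot>\<^sub>v v))) $ i"
    using assms by (simp add: to_vec_def re_fun_def complex_eq_iff)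
qed (use assms in \<open>simp add: to_vec_def\<close>)

lemma eigenspace_real_parts:
  assumes "v \<in> eigenspace w (complex_of_real \<mu>)" shows "re_fun v \<in> laplacian_eigenspace G S w \<mu>"
  unfolding laplacian_eigenspace_iff using real_part_mem[OF eigenspace_subspace _ assms] eigenspace_vcnj by auto

lemma subrep_laplacian_eigenspace:
  "subrep G (real_functions (carrier G)) (left_regular G) (laplacian_eigenspace G S w \<mu>)"
proof -
  note e = lin_subspaceD[OF eigenspace_subspace[of w "complex_of_real \<mu>"]]
  show ?thesis
    unfolding subrep_real_functions_iff
    using e eigenspace_invariant[of w "complex_of_real \<mu>"]
    by (auto simp: laplacian_eigenspace_iff to_vec_zero to_vec_add to_vec_smult to_vec_left_regular invariant_set_def
        left_regular_closed)
qed

text \<open>The passage from a real subrepresentation to a complex subspace; the way back is to take the real functions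
  in the subspace.\<close>

lemma complexification:
  assumes U: "subrep G (real_functions (carrier G)) (left_regular G) U"
  defines "X \<equiv> {to_vec f + \<i> \<cdot>\<^sub>v to_vec g | f g. f \<in> U \<and> g \<in> U}"
  shows "lin_subspace N X" "invariant_set G reg X" "\<And>v. v \<in> X \<Longrightarrow> vcnj v \<in> X"
proof -
  have u: "U \<subseteq> real_funs" "(\<lambda>x\<in>carrier G. 0) \<in> U" "\<And>f g. f \<in> U \<Longrightarrow> g \<in> U \<Longrightarrow> (\<lambda>x\<in>carrier G. f x + g x) \<in> U"
    "\<And>c f. f \<in> U \<Longrightarrow> (\<lambda>x\<in>carrier G. c * f x) \<in> U" "\<And>g f. g \<in> carrier G \<Longrightarrow> f \<in> U \<Longrightarrow> left_regular G g f \<in> U"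
    using U unfolding subrep_real_functions_iff by auto
  have XI: "to_vec f + \<i> \<cdot>\<^sub>v to_vec g \<in> X" if "f \<in> U" "g \<in> U" for f g using that by (auto simp: X_def)
  have XE: "\<exists>f g. f \<in> U \<and> g \<in> U \<and> v = to_vec f + \<i> \<cdot>\<^sub>v to_vec g" if "v \<in> X" for v using that by (auto simp: X_def)
  show "lin_subspace N X"
    unfolding lin_subspace_def
  proof (intro conjI ballI allI)
    show "X \<subseteq> carrier_vec N" by (auto simp: X_def)
    have "0\<^sub>v N = to_vec (\<lambda>x\<in>carrier G. 0) + \<i> \<cdot>\<^sub>v to_vec (\<lambda>x\<in>carrier G. 0)"
      unfolding to_vec_zero by (intro eq_vecI) auto
    then show "0\<^sub>v N \<in> X" using XI[OF u(2) u(2)] by simp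
    fix x y assume "x \<in> X" "y \<in> X"
    then obtain a b c d where m: "a \<in> U" "b \<in> U" "c \<in> U" "d \<in> U" and xy: "x = to_vec a + \<i> \<cdot>\<^sub>v to_vec b" "y = to_vec c + \<i> \<cdot>\<^sub>v to_vec d"
      using XE by metis
    have "x + y = to_vec (\<lambda>x\<in>carrier G. a x + c x) + \<i> \<cdot>\<^sub>v to_vec (\<lambda>x\<in>carrier G. b x + d x)"
      unfolding xy by (intro eq_vecI) (auto simp: to_vec_def algebra_simps)
    then show "x + y \<in> X" using XI u(3) m by simp
  next
    fix c x assume "x \<in> X"
    then obtain a b where m: "a \<in> U" "b \<in> U" and x: "x = to_vec a + \<i> \<cdot>\<^sub>v to_vec b" using XE by metis
    let ?re = "\<lambda>x\<in>carrier G. (\<lambda>x\<in>carrier G. Re c * a x) x + (\<lambda>x\<in>carrier G. (- Im c) * b x) x"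
    let ?im = "\<lambda>x\<in>carrier G. (\<lambda>x\<in>carrier G. Im c * a x) x + (\<lambda>x\<in>carrier G. Re c * b x) x"
    have "c \<cdot>\<^sub>v x = to_vec ?re + \<i> \<cdot>\<^sub>v to_vec ?im"
      unfolding x by (intro eq_vecI) (auto simp: to_vec_def complex_eq_iff algebra_simps)
    moreover have "?re \<in> U" "?im \<in> U" by (intro u(3) u(4) m)+
    ultimately show "c \<cdot>\<^sub>v x \<in> X" using XI by simp
  qed
  show "invariant_set G reg X"
    unfolding invariant_set_def
  proof (intro ballI)
    fix g x assume g: "g \<in> carrier G" and "x \<in> X"
    then obtain a b where m: "a \<in> U" "b \<in> U" and x: "x = to_vec a + \<i> \<cdot>\<^sub>v to_vec b" using XE by metis
    have "reg g *\<^sub>v x = to_vec (left_regular G g a) + \<i> \<cdot>\<^sub>v to_vec (left_regular G g b)"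
      unfolding x to_vec_left_regular[OF g]
      using mult_add_distrib_mat_vec[OF reg_carrier to_vec_carrier, of "\<i> \<cdot>\<^sub>v to_vec b" g a]
        mult_mat_vec[OF reg_carrier to_vec_carrier] by simp
    then show "reg g *\<^sub>v x \<in> X" using XI u(5)[OF g] m by simp
  qed
  show "vcnj v \<in> X" if v: "v \<in> X" for v
  proof -
    obtain a b where m: "a \<in> U" "b \<in> U" and x: "v = to_vec a + \<i> \<cdot>\<^sub>v to_vec b" using XE[OF v] by metis
    have "vcnj v = to_vec a + \<i> \<cdot>\<^sub>v to_vec (\<lambda>x\<in>carrier G. (-1) * b x)"
      unfolding x by (intro eq_vecI) (auto simp: to_vec_def)
    also have "\<dots> \<in> X" by (rule XI[OF m(1) u(4)[OF m(2)]])
    finally show ?thesis .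
  qed
qed

lemma simple_at_imp_real_G_simple:
  assumes simple: "simple_at w" shows "real_G_simple G S w"
  unfolding real_G_simple_def irreducible_subrep_def
proof (intro allI impI conjI)
  fix \<mu>
  have z: "\<zero>\<^bsub>real_functions (carrier G)\<^esub> = (\<lambda>x\<in>carrier G. 0)" by (simp add: real_functions_def)
  let ?E = "laplacian_eigenspace G S w \<mu>"
  assume "?E \<noteq> {\<zero>\<^bsub>real_functions (carrier G)\<^esub>}"
  then show "?E \<noteq> {\<zero>\<^bsub>real_functions (carrier G)\<^esub>}" .
  show "subrep G (real_functions (carrier G)) (left_regular G) ?E" by (rule subrep_laplacian_eigenspace)
  fix U assume U: "subrep G (real_functions (carrier G)) (left_regular G) U \<and> U \<subseteq> ?E"
  have u: "U \<subseteq> real_funs" "(\<lambda>x\<in>carrier G. 0) \<in> U" using U unfolding subrep_real_functions_iff by auto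
  define X where "X = {to_vec f + \<i> \<cdot>\<^sub>v to_vec g | f g. f \<in> U \<and> g \<in> U}"
  note X = complexification[of U, folded X_def]
  note E = lin_subspaceD[OF eigenspace_subspace[of w "complex_of_real \<mu>"]]
  have sub: "X \<subseteq> eigenspace w (complex_of_real \<mu>)"
  proof
    fix x assume "x \<in> X"
    then obtain a b where ab: "a \<in> U" "b \<in> U" "x = to_vec a + \<i> \<cdot>\<^sub>v to_vec b" unfolding X_def by blast
    then have "to_vec a \<in> eigenspace w (complex_of_real \<mu>)" "to_vec b \<in> eigenspace w (complex_of_real \<mu>)"
      using U laplacian_eigenspace_iff by blast+
    then show "x \<in> eigenspace w (complex_of_real \<mu>)" unfolding ab(3) using E(3,4) by blast
  qed
  have mem: "to_vec f \<in> X" if "f \<in> U" for f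
  proof -
    have "to_vec f = to_vec f + \<i> \<cdot>\<^sub>v to_vec (\<lambda>x\<in>carrier G. 0)"
      unfolding to_vec_zero by (intro eq_vecI) (auto simp: to_vec_def)
    then show ?thesis using that u(2) unfolding X_def by blast
  qed
  have "X = {0\<^sub>v N} \<or> X = eigenspace w (complex_of_real \<mu>)"
    using simple X U sub unfolding simple_at_def by (metis Reals_of_real)
  then show "U = {\<zero>\<^bsub>real_functions (carrier G)\<^esub>} \<or> U = ?E"
  proof
    assume X0: "X = {0\<^sub>v N}"
    have "f = (\<lambda>x\<in>carrier G. 0)" if "f \<in> U" for f
      using mem[OF that] X0 to_vec_inject[of f "\<lambda>x\<in>carrier G. 0"] u(1) that by (auto simp: to_vec_zero)
    then have "U = {\<lambda>x\<in>carrier G. 0}" using u(2) by blast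
    then show ?thesis unfolding z by (rule disjI1)
  next
    assume XE: "X = eigenspace w (complex_of_real \<mu>)"
    have "f \<in> U" if f: "f \<in> ?E" for f
    proof -
      have fr: "f \<in> real_funs" "to_vec f \<in> X" using f XE by (auto simp: laplacian_eigenspace_iff)
      then obtain a b where ab: "a \<in> U" "b \<in> U" "to_vec f = to_vec a + \<i> \<cdot>\<^sub>v to_vec b" unfolding X_def by blast
      have "re_fun (to_vec f) = re_fun (to_vec a)"
        unfolding ab(3) by (auto simp: re_fun_def to_vec_def fun_eq_iff)
      then have "f = a" using re_fun_to_vec fr(1) ab(1) u(1) by auto
      then show ?thesis using ab by simp
    qed
    then show ?thesis using U by blast
  qed
qed

lemma real_G_simple_imp_simple_at:
  assumes simple: "real_G_simple G S w" shows "simple_at w"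
  unfolding simple_at_def
proof (intro ballI allI impI)
  fix m :: complex and X
  assume "m \<in> \<real>" and X: "lin_subspace N X \<and> invariant_set G reg X \<and> (\<forall>f\<in>X. vcnj f \<in> X) \<and> X \<subseteq> eigenspace w m"
  then obtain \<mu> where m: "m = complex_of_real \<mu>" by (auto elim: Reals_cases)
  have z: "\<zero>\<^bsub>real_functions (carrier G)\<^esub> = (\<lambda>x\<in>carrier G. 0)" by (simp add: real_functions_def)
  let ?E = "laplacian_eigenspace G S w \<mu>"
  define U where "U = {f \<in> real_funs. to_vec f \<in> X}"
  note x = lin_subspaceD[OF X[THEN conjunct1]]
  have Xc: "\<And>f. f \<in> X \<Longrightarrow> vcnj f \<in> X" using X by blast
  have sub: "subrep G (real_functions (carrier G)) (left_regular G) U"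
    unfolding subrep_real_functions_iff
    using x X by (auto simp: U_def to_vec_zero to_vec_add to_vec_smult to_vec_left_regular invariant_set_def
        left_regular_closed)
  have UE: "U \<subseteq> ?E" using X by (auto simp: U_def laplacian_eigenspace_iff m)
  have parts: "v \<in> X" if "re_fun v \<in> U" "re_fun ((-\<i>) \<cdot>\<^sub>v v) \<in> U" "v \<in> carrier_vec N" for v
  proof -
    have "to_vec (re_fun v) + \<i> \<cdot>\<^sub>v to_vec (re_fun ((-\<i>) \<cdot>\<^sub>v v)) \<in> X"
      using that(1,2) x(3,4) unfolding U_def by blast
    then show ?thesis by (rule ssubst[OF real_imaginary_decomposition[OF that(3)]])
  qed
  have reU: "re_fun v \<in> U" if "v \<in> X" for v using real_part_mem[OF X[THEN conjunct1] Xc that] by (simp add: U_def)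
  consider "U = {\<lambda>x\<in>carrier G. 0}" | "U = ?E"
  proof (cases "?E = {\<lambda>x\<in>carrier G. 0}")
    case True
    have "(\<lambda>x\<in>carrier G. 0) \<in> U" using sub unfolding subrep_real_functions_iff by blast
    then show thesis using that True UE by blast
  next
    case False
    then show thesis using simple sub UE that unfolding real_G_simple_def irreducible_subrep_def z by blast
  qed
  then show "X = {0\<^sub>v N} \<or> X = eigenspace w m"
  proof cases
    case 1
    have "v = 0\<^sub>v N" if v: "v \<in> X" for v
    proof -
      have "re_fun v = (\<lambda>x\<in>carrier G. 0)" "re_fun ((-\<i>) \<cdot>\<^sub>v v) = (\<lambda>x\<in>carrier G. 0)"
        using reU[OF v] reU[OF x(4)[OF v, of "-\<i>"]] 1 by auto
      then have "v = 0\<^sub>v N + \<i> \<cdot>\<^sub>v 0\<^sub>v N" using real_imaginary_decomposition[OF x(5)[OF v]] by (simp add: to_vec_zero)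
      then show ?thesis by (simp add: smult_vec_zero)
    qed
    then show ?thesis using x(2) by blast
  next
    case 2
    note E = lin_subspaceD[OF eigenspace_subspace[of w m]]
    have "v \<in> X" if v: "v \<in> eigenspace w m" for v
      using parts[of v] eigenspace_real_parts[of v w \<mu>] eigenspace_real_parts[of "(-\<i>) \<cdot>\<^sub>v v" w \<mu>] v E(4)[OF v] E(5)[OF v] 2 m by simp
    then show ?thesis using X by blast
  qed
qed

end

section \<open>Polynomial functions of the weights\<close>

text \<open>Polynomial functions of real variables that are indexed by \<open>I\<close>. Two facts about them are needed: they are continuous,
  and their restriction to a line is a polynomial in one variable. Both follow by induction.\<close>

inductive polyfun :: "'i set \<Rightarrow> (('i \<Rightarrow> real) \<Rightarrow> complex) \<Rightarrow> bool" for I where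
  const: "polyfun I (\<lambda>\<alpha>. c)"
| coord: "i \<in> I \<Longrightarrow> polyfun I (\<lambda>\<alpha>. complex_of_real (\<alpha> i))"
| add: "polyfun I F \<Longrightarrow> polyfun I H \<Longrightarrow> polyfun I (\<lambda>\<alpha>. F \<alpha> + H \<alpha>)"
| mult: "polyfun I F \<Longrightarrow> polyfun I H \<Longrightarrow> polyfun I (\<lambda>\<alpha>. F \<alpha> * H \<alpha>)"

lemma polyfun_uminus: "polyfun I F \<Longrightarrow> polyfun I (\<lambda>\<alpha>. - F \<alpha>)"
  using polyfun.mult[OF polyfun.const[of I "-1"]] by simp

lemma polyfun_if: "polyfun I F \<Longrightarrow> polyfun I H \<Longrightarrow> polyfun I (\<lambda>\<alpha>. if b then F \<alpha> else H \<alpha>)"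
  by (cases b) simp_all

lemma polyfun_sum: "(\<And>x. x \<in> A \<Longrightarrow> polyfun I (F x)) \<Longrightarrow> polyfun I (\<lambda>\<alpha>. \<Sum>x\<in>A. F x \<alpha>)"
  by (induction A rule: infinite_finite_induct) (auto intro: polyfun.intros)

lemma polyfun_prod: "(\<And>x. x \<in> A \<Longrightarrow> polyfun I (F x)) \<Longrightarrow> polyfun I (\<lambda>\<alpha>. \<Prod>x\<in>A. F x \<alpha>)"
  by (induction A rule: infinite_finite_induct) (auto intro: polyfun.intros)

lemma polyfun_det:
  assumes A: "\<And>\<alpha>. A \<alpha> \<in> carrier_mat n n"
    and entries: "\<And>i j. i < n \<Longrightarrow> j < n \<Longrightarrow> polyfun I (\<lambda>\<alpha>. A \<alpha> $$ (i, j))"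
  shows "polyfun I (\<lambda>\<alpha>. det (A \<alpha>))"
  unfolding det_def'[OF A]
proof (rule polyfun_sum)
  fix p assume "p \<in> {p. p permutes {0..<n}}"
  then have "p i < n" if "i < n" for i using that permutes_in_image[of p "{0..<n}" i] by simp
  then show "polyfun I (\<lambda>\<alpha>. signof p * (\<Prod>i = 0..<n. A \<alpha> $$ (i, p i)))"
    by (intro polyfun.mult polyfun.const polyfun_prod entries) auto
qed

text \<open>Polynomials in \<open>x\<close> whose coefficients are polynomial functions of the weights.\<close>

definition poly_coeffs_polyfun :: "'i set \<Rightarrow> (('i \<Rightarrow> real) \<Rightarrow> complex poly) \<Rightarrow> bool"
  where "poly_coeffs_polyfun I P \<longleftrightarrow> (\<forall>k. polyfun I (\<lambda>\<alpha>. coeff (P \<alpha>) k))"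

lemma poly_coeffs_const: "poly_coeffs_polyfun I (\<lambda>\<alpha>. p)"
  by (simp add: poly_coeffs_polyfun_def polyfun.const)

lemma poly_coeffs_constant: "polyfun I F \<Longrightarrow> poly_coeffs_polyfun I (\<lambda>\<alpha>. [:F \<alpha>:])"
  unfolding poly_coeffs_polyfun_def
proof (intro allI)
  fix k assume "polyfun I F"
  then show "polyfun I (\<lambda>\<alpha>. coeff [:F \<alpha>:] k)" by (cases k) (simp_all add: polyfun.const)
qed

lemma poly_coeffs_add: "poly_coeffs_polyfun I P \<Longrightarrow> poly_coeffs_polyfun I Q \<Longrightarrow> poly_coeffs_polyfun I (\<lambda>\<alpha>. P \<alpha> + Q \<alpha>)"
  by (simp add: poly_coeffs_polyfun_def polyfun.add)

lemma poly_coeffs_mult: "poly_coeffs_polyfun I P \<Longrightarrow> poly_coeffs_polyfun I Q \<Longrightarrow> poly_coeffs_polyfun I (\<lambda>\<alpha>. P \<alpha> * Q \<alpha>)"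
  unfolding poly_coeffs_polyfun_def coeff_mult by (intro allI polyfun_sum polyfun.mult) auto

lemma poly_coeffs_sum: "(\<And>x. x \<in> A \<Longrightarrow> poly_coeffs_polyfun I (F x)) \<Longrightarrow> poly_coeffs_polyfun I (\<lambda>\<alpha>. \<Sum>x\<in>A. F x \<alpha>)"
  by (induction A rule: infinite_finite_induct) (auto intro: poly_coeffs_const poly_coeffs_add)

lemma poly_coeffs_prod: "(\<And>x. x \<in> A \<Longrightarrow> poly_coeffs_polyfun I (F x)) \<Longrightarrow> poly_coeffs_polyfun I (\<lambda>\<alpha>. \<Prod>x\<in>A. F x \<alpha>)"
  by (induction A rule: infinite_finite_induct) (auto intro: poly_coeffs_const poly_coeffs_mult)

lemma poly_coeffs_pderiv: "poly_coeffs_polyfun I P \<Longrightarrow> poly_coeffs_polyfun I (\<lambda>\<alpha>. pderiv (P \<alpha>))"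
  unfolding poly_coeffs_polyfun_def coeff_pderiv by (intro allI polyfun.mult polyfun.const) auto

lemma poly_coeffs_det:
  assumes A: "\<And>\<alpha>. A \<alpha> \<in> carrier_mat n n"
    and entries: "\<And>i j. i < n \<Longrightarrow> j < n \<Longrightarrow> poly_coeffs_polyfun I (\<lambda>\<alpha>. A \<alpha> $$ (i, j))"
  shows "poly_coeffs_polyfun I (\<lambda>\<alpha>. det (A \<alpha>))"
  unfolding det_def'[OF A]
proof (rule poly_coeffs_sum)
  fix p assume "p \<in> {p. p permutes {0..<n}}"
  then have "p i < n" if "i < n" for i using that permutes_in_image[of p "{0..<n}" i] by simp
  then show "poly_coeffs_polyfun I (\<lambda>\<alpha>. signof p * (\<Prod>i = 0..<n. A \<alpha> $$ (i, p i)))"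
    by (intro poly_coeffs_mult poly_coeffs_const poly_coeffs_prod entries) auto
qed

lemma poly_coeffs_char_poly:
  assumes A: "\<And>\<alpha>. A \<alpha> \<in> carrier_mat n n"
    and entries: "\<And>i j. i < n \<Longrightarrow> j < n \<Longrightarrow> polyfun I (\<lambda>\<alpha>. A \<alpha> $$ (i, j))"
  shows "poly_coeffs_polyfun I (\<lambda>\<alpha>. char_poly (A \<alpha>))"
  unfolding char_poly_def
proof (rule poly_coeffs_det)
  show "char_poly_matrix (A \<alpha>) \<in> carrier_mat n n" for \<alpha> using A by simp
  fix i j assume ij: "i < n" "j < n"
  have "char_poly_matrix (A \<alpha>) $$ (i, j) = [:0, 1:] * (if i = j then 1 else 0) + [:- A \<alpha> $$ (i, j):]" for \<alpha>
    using ij A[of \<alpha>] by (auto simp: char_poly_matrix_def)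
  then show "poly_coeffs_polyfun I (\<lambda>\<alpha>. char_poly_matrix (A \<alpha>) $$ (i, j))"
    using entries[OF ij] by (simp only:) (intro poly_coeffs_add poly_coeffs_const poly_coeffs_constant polyfun_uminus)
qed

text \<open>The degrees have to be constant for the Sylvester matrix to have a fixed size.\<close>

lemma polyfun_resultant:
  assumes P: "poly_coeffs_polyfun I P" "\<And>\<alpha>. degree (P \<alpha>) = m" and Q: "poly_coeffs_polyfun I Q" "\<And>\<alpha>. degree (Q \<alpha>) = k"
  shows "polyfun I (\<lambda>\<alpha>. resultant (P \<alpha>) (Q \<alpha>))"
  unfolding resultant_def sylvester_mat_def P(2) Q(2)
proof (rule polyfun_det)
  show "sylvester_mat_sub m k (P \<alpha>) (Q \<alpha>) \<in> carrier_mat (m + k) (m + k)" for \<alpha>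
    by (rule sylvester_mat_sub_carrier)
  fix i j assume ij: "i < m + k" "j < m + k"
  show "polyfun I (\<lambda>\<alpha>. sylvester_mat_sub m k (P \<alpha>) (Q \<alpha>) $$ (i, j))"
    unfolding sylvester_mat_sub_index[OF ij]
    using P(1) Q(1) by (intro polyfun_if polyfun.const) (auto simp: poly_coeffs_polyfun_def)
qed

lemma polyfun_continuous: "polyfun I F \<Longrightarrow> continuous_map (powertop_real I) euclidean F"
proof (induction rule: polyfun.induct)
  case (coord i)
  have "continuous_map (powertop_real I) euclideanreal (\<lambda>\<alpha>. \<alpha> i)"
    using continuous_map_product_projection[OF coord] .
  moreover have "continuous_map euclideanreal euclidean complex_of_real"
    by (simp add: continuous_on_of_real)
  ultimately show ?case using continuous_map_compose[of _ _ "\<lambda>\<alpha>. \<alpha> i" _ complex_of_real] by (simp add: o_def)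
next
  case (add F H)
  then show ?case by (simp add: continuous_map_atin tendsto_add)
next
  case (mult F H)
  then show ?case by (simp add: continuous_map_atin tendsto_mult)
qed simp

lemma polyfun_line:
  assumes "polyfun I F"
  shows "\<exists>p. \<forall>t. F (\<lambda>i\<in>I. a i + t * b i) = poly p (complex_of_real t)"
  using assms
proof (induction rule: polyfun.induct)
  case (const c)
  show ?case by (rule exI[of _ "[:c:]"]) simp
next
  case (coord i)
  show ?case by (rule exI[of _ "[:complex_of_real (a i), complex_of_real (b i):]"]) (use coord in simp)
next
  case (add F H)
  then obtain p q where pq: "\<And>t. F (\<lambda>i\<in>I. a i + t * b i) = poly p (complex_of_real t)"
    "\<And>t. H (\<lambda>i\<in>I. a i + t * b i) = poly q (complex_of_real t)" by blast
  show ?case by (intro exI[of _ "p + q"] allI) (simp only: pq poly_add)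
next
  case (mult F H)
  then obtain p q where pq: "\<And>t. F (\<lambda>i\<in>I. a i + t * b i) = poly p (complex_of_real t)"
    "\<And>t. H (\<lambda>i\<in>I. a i + t * b i) = poly q (complex_of_real t)" by blast
  show ?case by (intro exI[of _ "p * q"] allI) (simp only: pq poly_mult)
qed

text \<open>Restricted to the line from \<open>w\<close> to the point \<open>a0\<close> where it does not vanish, the function is a nonzero
  polynomial in one variable, and so has finitely many zeros near \<open>w\<close>.\<close>

lemma polyfun_nonzero_in_open:
  assumes F: "polyfun I F" and a0: "a0 \<in> I \<rightarrow>\<^sub>E UNIV" "F a0 \<noteq> 0"
    and U: "openin (powertop_real I) U" "w \<in> U"
  shows "\<exists>w'\<in>U. F w' \<noteq> 0"
proof -
  define \<gamma> where "\<gamma> t = (\<lambda>i\<in>I. w i + t * (a0 i - w i))" for t :: real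
  have wE: "w \<in> I \<rightarrow>\<^sub>E UNIV" using openin_subset[OF U(1)] U(2) by auto
  have cont: "continuous_map euclideanreal (powertop_real I) \<gamma>"
    unfolding continuous_map_componentwise \<gamma>_def
    by (auto intro!: continuous_intros simp: restrict_def extensional_def)
  have "openin euclideanreal {t \<in> topspace euclideanreal. \<gamma> t \<in> U}"
    by (rule openin_continuous_map_preimage[OF cont U(1)])
  then have "open {t. \<gamma> t \<in> U}" by simp
  moreover have "\<gamma> 0 = w" using wE by (auto simp: \<gamma>_def fun_eq_iff PiE_iff extensional_def)
  ultimately obtain e where e: "e > 0" "\<And>t. dist t 0 < e \<Longrightarrow> \<gamma> t \<in> U"
    using U(2) unfolding open_dist by force
  have "\<gamma> 1 = a0" using a0(1) by (auto simp: \<gamma>_def fun_eq_iff PiE_iff extensional_def)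
  obtain p where p: "\<And>t. F (\<gamma> t) = poly p (complex_of_real t)"
    using polyfun_line[OF F, of w "\<lambda>i. a0 i - w i"] unfolding \<gamma>_def by blast
  have "p \<noteq> 0" using p[of 1] a0(2) \<open>\<gamma> 1 = a0\<close> by auto
  then have "finite {z. poly p z = 0}" by (rule poly_roots_finite)
  moreover have "infinite (complex_of_real ` {0<..<e})"
    using e(1) finite_imageD[of complex_of_real "{0<..<e}"] infinite_Ioo[of 0 e] by (auto simp: inj_on_def)
  ultimately have "\<not> complex_of_real ` {0<..<e} \<subseteq> {z. poly p z = 0}" using finite_subset by blast
  then obtain z where "z \<in> complex_of_real ` {0<..<e}" "poly p z \<noteq> 0" by blast
  then obtain t where "0 < t" "t < e" "poly p (complex_of_real t) \<noteq> 0" by auto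
  then show ?thesis using e(2)[of t] p[of t] by (intro bexI[of _ "\<gamma> t"]) auto
qed

text \<open>The nonzero set of each function meets every nonempty open set in a nonempty open set.\<close>

lemma polyfuns_common_nonzero:
  assumes fin: "finite \<F>" and F: "\<And>F. F \<in> \<F> \<Longrightarrow> polyfun I F" "\<And>F. F \<in> \<F> \<Longrightarrow> \<exists>a\<in>I \<rightarrow>\<^sub>E UNIV. F a \<noteq> 0"
    and U: "openin (powertop_real I) U" "U \<noteq> {}"
  shows "\<exists>w\<in>U. \<forall>F\<in>\<F>. F w \<noteq> 0"
  using fin F U
proof (induction \<F> arbitrary: U rule: finite_induct)
  case empty
  then show ?case by auto
next
  case (insert F \<F>)
  define V where "V = {w \<in> topspace (powertop_real I). F w \<in> - {0}} \<inter> U"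
  have "openin (powertop_real I) {w \<in> topspace (powertop_real I). F w \<in> - {0}}"
    by (rule openin_continuous_map_preimage[OF polyfun_continuous]) (use insert.prems(1) in auto)
  then have oV: "openin (powertop_real I) V" unfolding V_def using insert.prems(3) by (rule openin_Int)
  obtain a w where a: "a \<in> I \<rightarrow>\<^sub>E UNIV" "F a \<noteq> 0" and w: "w \<in> U" using insert.prems(2)[of F] insert.prems(4) by auto
  have pF: "polyfun I F" using insert.prems(1) by simp
  then obtain w' where "w' \<in> U" "F w' \<noteq> 0"
    using polyfun_nonzero_in_open[OF pF a insert.prems(3) w] by blast
  then have "w' \<in> V" using openin_subset[OF insert.prems(3)] unfolding V_def by blast
  then have "V \<noteq> {}" by blast
  then obtain v where "v \<in> V" "\<forall>F\<in>\<F>. F v \<noteq> 0" using insert.IH[OF _ _ oV] insert.prems(1,2) by auto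
  then show ?case by (auto simp: V_def)
qed

lemma polyfun_zeros_nowhere_dense:
  assumes F: "polyfun I F" "a \<in> I \<rightarrow>\<^sub>E UNIV" "F a \<noteq> 0" and L: "openin (powertop_real I) L"
  shows "nowhere_dense_in (subtopology (powertop_real I) L) {w \<in> L. F w = 0}"
  unfolding nowhere_dense_in_def
proof (intro conjI)
  let ?X = "subtopology (powertop_real I) L"
  have top: "topspace ?X = L" using openin_subset[OF L] by auto
  then show "{w \<in> L. F w = 0} \<subseteq> topspace ?X" by auto
  have "closedin ?X {w \<in> topspace ?X. F w \<in> {0}}"
    by (rule closedin_continuous_map_preimage[OF continuous_map_from_subtopology[OF polyfun_continuous[OF F(1)]]]) simp
  then have "closedin ?X {w \<in> L. F w = 0}" unfolding top by simp
  then have cl: "?X closure_of {w \<in> L. F w = 0} = {w \<in> L. F w = 0}" by (rule closure_of_closedin)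
  show "?X interior_of (?X closure_of {w \<in> L. F w = 0}) = {}"
    unfolding cl interior_of_eq_empty
  proof (intro allI impI, rule ccontr)
    fix T assume T: "openin ?X T \<and> T \<subseteq> {w \<in> L. F w = 0}" "T \<noteq> {}"
    have oT: "openin (powertop_real I) T" using T(1) openin_open_subtopology[OF L] by blast
    obtain w where "w \<in> T" using T(2) by blast
    then obtain w' where "w' \<in> T" "F w' \<noteq> 0" using polyfun_nonzero_in_open[OF F oT] by blast
    then show False using T(1) by blast
  qed
qed

section \<open>Generic weights\<close>

context cayley
begin

abbreviation pairs :: "'a set set" where "pairs \<equiv> inverse_pairs G S"

lemma finite_pairs: "finite pairs" using finite_S by (simp add: inverse_pairs_def)

lemma weights_eq: "left_invariant_weights G S = (\<Pi>\<^sub>E i\<in>pairs. {0<..})"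
  by (auto simp: left_invariant_weights_def coefficient_space_def PiE_iff extensional_def)

lemma openin_weights: "openin (powertop_real pairs) (left_invariant_weights G S)"
  unfolding weights_eq by (rule iffD2[OF openin_PiE[OF finite_pairs]]) auto

lemma weights_nonempty: "left_invariant_weights G S \<noteq> {}"
  unfolding weights_eq by (auto simp: PiE_eq_empty_iff)

lemma poly_coeffs_rep_char_poly: "poly_coeffs_polyfun pairs (rep_char_poly G S n \<rho>)"
proof -
  have e: "rep_char_poly G S n \<rho> = (\<lambda>\<alpha>. char_poly (rep_operator G S n \<rho> \<alpha>))"
    by (simp add: rep_char_poly_def fun_eq_iff)
  show ?thesis
    unfolding e
  proof (rule poly_coeffs_char_poly)
    fix i j assume "i < n" "j < n"
    then have "rep_operator G S n \<rho> \<alpha> $$ (i, j) = - (\<Sum>s\<in>S. complex_of_real (\<alpha> {s, inv s}) *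
        (\<rho> s $$ (i, j) - \<rho> \<one> $$ (i, j)))" for \<alpha>
      by (simp add: rep_operator_def)
    moreover have "{s, inv s} \<in> pairs" if "s \<in> S" for s using that by (auto simp: inverse_pairs_def)
    ultimately show "polyfun pairs (\<lambda>\<alpha>. rep_operator G S n \<rho> \<alpha> $$ (i, j))"
      by (simp only:) (intro polyfun_uminus polyfun_sum polyfun.mult polyfun.const polyfun.coord)
  qed simp
qed

lemma degree_rep_char_poly: "degree (rep_char_poly G S n \<rho> \<alpha>) = n"
  unfolding rep_char_poly_def using degree_monic_char_poly[OF rep_operator_carrier, of n \<rho> \<alpha>] by simp

lemma polyfun_a_res: "polyfun pairs (a_res G S n \<rho> m \<sigma>)"
proof -
  have "a_res G S n \<rho> m \<sigma> = (\<lambda>\<alpha>. resultant (rep_char_poly G S n \<rho> \<alpha>) (rep_char_poly G S m \<sigma> \<alpha>))"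
    by (simp add: a_res_def fun_eq_iff)
  then show ?thesis
    using polyfun_resultant[OF poly_coeffs_rep_char_poly degree_rep_char_poly poly_coeffs_rep_char_poly degree_rep_char_poly] by simp
qed

lemma polyfun_b_res: "polyfun pairs (b_res G S n \<rho>)"
proof -
  have "b_res G S n \<rho> = (\<lambda>\<alpha>. resultant (rep_char_poly G S n \<rho> \<alpha>) (pderiv (rep_char_poly G S n \<rho> \<alpha>)))"
    by (simp add: b_res_def fun_eq_iff)
  moreover have "degree (pderiv (rep_char_poly G S n \<rho> \<alpha>)) = n - 1" for \<alpha>
    by (simp add: degree_pderiv degree_rep_char_poly)
  ultimately show ?thesis
    using polyfun_resultant[OF poly_coeffs_rep_char_poly degree_rep_char_poly poly_coeffs_pderiv[OF poly_coeffs_rep_char_poly]] by simp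
qed

lemma polyfun_c_res: "polyfun pairs (c_res G S n \<rho>)"
proof -
  have "c_res G S n \<rho> = (\<lambda>\<alpha>. resultant (rep_char_poly G S n \<rho> \<alpha>) (pderiv (pderiv (rep_char_poly G S n \<rho> \<alpha>))))"
    by (simp add: c_res_def fun_eq_iff)
  moreover have "degree (pderiv (pderiv (rep_char_poly G S n \<rho> \<alpha>))) = n - 1 - 1" for \<alpha>
    by (simp add: degree_pderiv degree_rep_char_poly)
  ultimately show ?thesis
    using polyfun_resultant[OF poly_coeffs_rep_char_poly degree_rep_char_poly
        poly_coeffs_pderiv[OF poly_coeffs_pderiv[OF poly_coeffs_rep_char_poly]]] by simp
qed

text \<open>The functions of which the three conditions demand that they do not vanish identically.\<close>

definition resultant_conditions :: "(('a set \<Rightarrow> real) \<Rightarrow> complex) set"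
  where "resultant_conditions =
    {a_res G S n \<rho> m \<sigma> | n \<rho> m \<sigma>. irreducible_rep G n \<rho> \<and> irreducible_rep G m \<sigma> \<and>
      \<not> isomorphic_reps G m \<sigma> n \<rho> \<and> \<not> isomorphic_reps G m \<sigma> n (dual_rep G \<rho>)} \<union>
    {b_res G S n \<rho> | n \<rho>. irreducible_rep G n \<rho> \<and> (real_type G n \<rho> \<or> complex_type G n \<rho>)} \<union>
    {c_res G S n \<rho> | n \<rho>. irreducible_rep G n \<rho> \<and> quaternionic_type G n \<rho>}"

lemma ball_resultant_conditions:
  "(\<forall>F\<in>resultant_conditions. Q F) \<longleftrightarrow>
    (\<forall>n \<rho> m \<sigma>. irreducible_rep G n \<rho> \<and> irreducible_rep G m \<sigma> \<and>
      \<not> isomorphic_reps G m \<sigma> n \<rho> \<and> \<not> isomorphic_reps G m \<sigma> n (dual_rep G \<rho>) \<longrightarrow> Q (a_res G S n \<rho> m \<sigma>)) \<and>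
    (\<forall>n \<rho>. irreducible_rep G n \<rho> \<and> (real_type G n \<rho> \<or> complex_type G n \<rho>) \<longrightarrow> Q (b_res G S n \<rho>)) \<and>
    (\<forall>n \<rho>. irreducible_rep G n \<rho> \<and> quaternionic_type G n \<rho> \<longrightarrow> Q (c_res G S n \<rho>))"
  unfolding resultant_conditions_def by blast

text \<open>The resultants depend on the representations only through their characteristic polynomials.\<close>

lemma finite_resultant_conditions: "finite resultant_conditions"
proof -
  let ?P = "{rep_char_poly G S n \<rho> | n \<rho>. irreducible_rep G n \<rho>}"
  let ?A = "(\<lambda>(P, Q) \<alpha>. resultant (P \<alpha>) (Q \<alpha>)) ` (?P \<times> ?P)"
  let ?B = "(\<lambda>P \<alpha>. resultant (P \<alpha>) (pderiv (P \<alpha>))) ` ?P"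
  let ?C = "(\<lambda>P \<alpha>. resultant (P \<alpha>) (pderiv (pderiv (P \<alpha>)))) ` ?P"
  have mem: "rep_char_poly G S n \<rho> \<in> ?P" if "irreducible_rep G n \<rho>" for n \<rho> using that by blast
  have "a_res G S n \<rho> m \<sigma> \<in> ?A" if "irreducible_rep G n \<rho>" "irreducible_rep G m \<sigma>" for n \<rho> m \<sigma>
    by (rule image_eqI[where x="(rep_char_poly G S n \<rho>, rep_char_poly G S m \<sigma>)"])
      (auto simp: a_res_def fun_eq_iff intro!: mem that)
  moreover have "b_res G S n \<rho> \<in> ?B" if "irreducible_rep G n \<rho>" for n \<rho>
    by (rule image_eqI[OF _ mem[OF that]]) (simp add: b_res_def fun_eq_iff)
  moreover have "c_res G S n \<rho> \<in> ?C" if "irreducible_rep G n \<rho>" for n \<rho>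
    by (rule image_eqI[OF _ mem[OF that]]) (simp add: c_res_def fun_eq_iff)
  ultimately have "resultant_conditions \<subseteq> ?A \<union> ?B \<union> ?C" unfolding resultant_conditions_def by blast
  then show ?thesis by (rule finite_subset) (intro finite_UnI finite_imageI finite_cartesian_product finite_rep_char_polys)
qed

lemma polyfun_resultant_conditions: "F \<in> resultant_conditions \<Longrightarrow> polyfun pairs F"
  unfolding resultant_conditions_def using polyfun_a_res polyfun_b_res polyfun_c_res by blast

lemma real_G_simple_iff: "real_G_simple G S w \<longleftrightarrow> (\<forall>F\<in>resultant_conditions. F w \<noteq> 0)"
proof
  assume "real_G_simple G S w"
  then have s: "simple_at w" by (rule real_G_simple_imp_simple_at)
  show "\<forall>F\<in>resultant_conditions. F w \<noteq> 0"
    unfolding ball_resultant_conditions using simple_imp_a_res[OF s] simple_imp_b_res[OF s] simple_imp_c_res[OF s] by blast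
next
  assume "\<forall>F\<in>resultant_conditions. F w \<noteq> 0"
  then have "simple_at w" unfolding ball_resultant_conditions by (intro resultants_imp_simple) blast+
  then show "real_G_simple G S w" by (rule simple_at_imp_real_G_simple)
qed

text \<open>The same finitely many polynomial functions decide simplicity at every weight, and they have a common
  nonzero among the positive weights as soon as none of them vanishes identically.\<close>

lemma simple_weight_exists_iff:
  "(\<exists>w\<in>left_invariant_weights G S. real_G_simple G S w) \<longleftrightarrow>
    (\<forall>F\<in>resultant_conditions. \<not> (\<forall>\<alpha>\<in>coefficient_space G S. F \<alpha> = 0))"
proof
  assume "\<exists>w\<in>left_invariant_weights G S. real_G_simple G S w"
  then show "\<forall>F\<in>resultant_conditions. \<not> (\<forall>\<alpha>\<in>coefficient_space G S. F \<alpha> = 0)"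
    unfolding real_G_simple_iff by (auto simp: left_invariant_weights_def)
next
  assume a: "\<forall>F\<in>resultant_conditions. \<not> (\<forall>\<alpha>\<in>coefficient_space G S. F \<alpha> = 0)"
  have "\<exists>w\<in>left_invariant_weights G S. \<forall>F\<in>resultant_conditions. F w \<noteq> 0"
    by (rule polyfuns_common_nonzero[OF finite_resultant_conditions polyfun_resultant_conditions _ openin_weights weights_nonempty])
      (use a in \<open>auto simp: coefficient_space_def\<close>)
  then show "\<exists>w\<in>left_invariant_weights G S. real_G_simple G S w" unfolding real_G_simple_iff .
qed

lemma simple_weights_residual:
  assumes "\<exists>w\<in>left_invariant_weights G S. real_G_simple G S w"
  shows "residual_in (weight_topology G S) {w \<in> left_invariant_weights G S. real_G_simple G S w}"
proof -
  let ?L = "left_invariant_weights G S"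
  have top: "topspace (weight_topology G S) = ?L"
    unfolding weight_topology_def using openin_subset[OF openin_weights] by auto
  define \<N> where "\<N> = (\<lambda>F. {w \<in> ?L. F w = 0}) ` resultant_conditions"
  have nd: "nowhere_dense_in (weight_topology G S) M" if M: "M \<in> \<N>" for M
  proof -
    obtain F where F: "F \<in> resultant_conditions" "M = {w \<in> ?L. F w = 0}" using M by (auto simp: \<N>_def)
    obtain a where "a \<in> coefficient_space G S" "F a \<noteq> 0" using assms F(1) unfolding simple_weight_exists_iff by blast
    then show ?thesis
      unfolding weight_topology_def F(2) coefficient_space_def
      using polyfun_zeros_nowhere_dense[OF polyfun_resultant_conditions[OF F(1)] _ _ openin_weights] by blast
  qed
  have "?L - {w \<in> ?L. real_G_simple G S w} = \<Union>\<N>" unfolding \<N>_def real_G_simple_iff by auto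
  moreover have "countable \<N>" unfolding \<N>_def using finite_resultant_conditions by (simp add: countable_finite)
  ultimately show ?thesis unfolding residual_in_def meager_in_def top using nd by blast
qed

end

theorem theorem1p1:
  fixes G :: "('a, 'b) monoid_scheme" and S :: "'a set"
  assumes "group G" and "finite (carrier G)"
    and "S \<subseteq> carrier G - {\<one>\<^bsub>G\<^esub>}"
    and "\<forall>s\<in>S. inv\<^bsub>G\<^esub> s \<in> S"
    and "generate G S = carrier G"
  shows
    "((\<exists>w\<in>left_invariant_weights G S. real_G_simple G S w) \<longleftrightarrow>
        (\<forall>n\<^sub>1 \<rho>\<^sub>1 n\<^sub>2 \<rho>\<^sub>2.
           irreducible_rep G n\<^sub>1 \<rho>\<^sub>1 \<and> irreducible_rep G n\<^sub>2 \<rho>\<^sub>2 \<and>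
           \<not> isomorphic_reps G n\<^sub>2 \<rho>\<^sub>2 n\<^sub>1 \<rho>\<^sub>1 \<and>
           \<not> isomorphic_reps G n\<^sub>2 \<rho>\<^sub>2 n\<^sub>1 (dual_rep G \<rho>\<^sub>1) \<longrightarrow>
           \<not> (\<forall>\<alpha>\<in>coefficient_space G S. a_res G S n\<^sub>1 \<rho>\<^sub>1 n\<^sub>2 \<rho>\<^sub>2 \<alpha> = 0)) \<and>
        (\<forall>n \<rho>. irreducible_rep G n \<rho> \<and> (real_type G n \<rho> \<or> complex_type G n \<rho>) \<longrightarrow>
           \<not> (\<forall>\<alpha>\<in>coefficient_space G S. b_res G S n \<rho> \<alpha> = 0)) \<and>
        (\<forall>n \<rho>. irreducible_rep G n \<rho> \<and> quaternionic_type G n \<rho> \<longrightarrow>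
           \<not> (\<forall>\<alpha>\<in>coefficient_space G S. c_res G S n \<rho> \<alpha> = 0)))
     \<and>
     ((\<exists>w\<in>left_invariant_weights G S. real_G_simple G S w) \<longrightarrow>
        residual_in (weight_topology G S)
          {w \<in> left_invariant_weights G S. real_G_simple G S w})"
proof -
  interpret group G by fact
  interpret cayley G S by unfold_locales (use assms in auto)
  show ?thesis
    unfolding simple_weight_exists_iff[unfolded ball_resultant_conditions, symmetric]
    using simple_weights_residual by blast
qed

end
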